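(* Let $k$ be a field of characteristic zero, $n\ge 1$, and let $\underline{\mathscr A}=\{\mathscr A_I\}_{I\subseteq[n]}$ be a hypercube of small dg categories over $k$. Then $\underline{\mathscr A}$ is acyclic if and only if the natural dg functor $\pi:\mathscr A_\varnothing\to\mathrm{Glue}(\underline{\mathscr A}^\circ)$ is quasi fully faithful (i.e. induces quasi-isomorphisms on all Hom complexes).
   Context: **Hypercubes.** $[n]=\{0,\dots,n-1\}$. A hypercube ($n$-cube) of dg categories is a (strict) functor $2^{[n]}\to\mathrm{dgcat}$, $I\mapsto\mathscr A_I$, where $2^{[n]}$ is the poset of subsets ordered by inclusion. For disjoint $I,J$, $V_J:\mathscr A_I\to\mathscr A_{I\sqcup J}$ denotes the corresponding dg functor (write $V_i=V_{\{i\}}$). The punctured hypercube $\underline{\mathscr A}^\circ$ is obtained by removing $\mathscr A_\varnothing$. **Totalisation.** Let $\Lambda$ be the exterior $k$-algebra on $X_0,\dots,X_{n-1}$ placed in degree $-1$, and $\partial_l=\partial/\partial X_l$ the degree $1$ antiderivation. For a hypercube $\{A_I,\alpha_{I,l}:A_I\to A_{I\cup\{l\}}\}$ of complexes of $k$-vector spaces, its totalisation is $$t(\underline A)=\bigoplus_{I\subseteq[n]}k\Big(\prod_{l\in[n]\setminus I}X_l\Big)\otimes_kA_I,\qquad d=\bigoplus_I\Big(\sum_{l\in[n]\setminus I}\partial_l\otimes\alpha_{I,l}+1\otimes d_{A_I}\Big),$$ with the Koszul sign rule. **Acyclic hypercube.** $\underline{\mathscr A}$ is acyclic if for all $A,B\in\mathscr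 A_\varnothing$ the complex $t(\{\mathscr A_I(V_IA,V_IB)\}_I)$ (maps induced by the $V_l$) is acyclic. **Gluing.** For $0\le i\le j\le n-1$ put $J_{ij}=\{I\subseteq[n]\mid\{i,j\}\subseteq I\subseteq\{i,i+1,\dots,j\}\}$. The dg category $\mathrm{Gac}(\underline{\mathscr A}^\circ)$ has objects $\bigsqcup_{i=0}^{n-1}\mathrm{Obj}\,\mathscr A_i$ and, for $A_i\in\mathscr A_i$, $A_j\in\mathscr A_j$, $\mathrm{Hom}(A_i,A_j)=0$ if $i>j$, and for $i\le j$ $$\mathrm{Hom}(A_i,A_j)=\bigoplus_{I\in J_{ij}}k\Big(\prod_{l\in\{i,\dots,j\}\setminus I}X_l\Big)\otimes_k\mathscr A_I(V_{I\setminus\{i\}}A_i,V_{I\setminus\{j\}}A_j)$$ with differential $\sum_{l\in\{i,\dots,j\}\setminus I}\partial_l\otimes V_l+1\otimes d$ on the summand $I$. For $X_{S'}\otimes g\in\mathrm{Hom}(A_j,A_h)$ in summand $I'$ and $X_S\otimes f\in\mathrm{Hom}(A_i,A_j)$ in summand $I$ the composition is $(-1)^{|g||S|}X_{S'}X_S\otimes V_{I\setminus I'}(g)V_{I'\setminus I}(f)$ in summand $I\cup I'$; units are $1\otimes 1_{A_i}$. Then $\mathrm{Glue}(\underline{\mathscr A}^\circ)=\mathrm{tw}(\mathrm{Gac}(\underline{\mathscr A}^\circ))$. **Twisted complexes.** For a dg category $\mathscr C$, objects of $\mathrm{tw}\,\mathscr C$ are pairs $(\oplus_iA_i[k_i],\delta)$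 (finite formal sums of formal shifts), $\delta=(\delta_{ij})$ with $\delta_{ij}:A_j[k_j]\to A_i[k_i]$ of degree $1$, $\delta_{ij}=0$ for $i\ge j$, and $d\delta+\delta^2=0$. Here $\mathrm{Hom}(A[p],B[q])$ is $\mathscr C(A,B)[q-p]$ as a graded space, with differential $(-1)^qd_{\mathscr C}$ and composition induced from $\mathscr C$. Morphisms are matrices, with differential $f\mapsto df+\delta'f-(-1)^{|f|}f\delta$. **The functor $\pi$.** Write $\underline i=n-1-i$. On objects $\pi A=(\oplus_{i=0}^{n-1}V_{\underline i}A[i],\alpha)$ where $\alpha_{ji}=0$ for $j\ge i$, and for $j<i$ $$\alpha_{ji}=(-1)^jX_{\underline j-1}X_{\underline j-2}\cdots X_{\underline i+1}\otimes1_{V_{\{\underline i,\underline j\}}A}$$ in the summand $I=\{\underline i,\underline j\}$ of $\mathrm{Hom}(V_{\underline i}A,V_{\underline j}A)$. On morphisms, $\pi f$ is the diagonal morphism $\oplus_i(-1)^{(n-1-i)|f|}V_if$ with $V_if\in\mathscr A_i(V_iA,V_iB)$. *)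

theory Defs
  imports Complex_Main "HOL-Library.Function_Algebras"
begin

section \<open>Complexes over a field\<close>

text \<open>
  All graded pieces of all complexes under consideration are subspaces of one ambient
  \<open>k\<close>-vector space, namely a type with scalar multiplication \<open>s\<close>.  This costs no
  generality, as the direct sum of any family of spaces can serve as the ambient space.
  The pieces are not assumed to be disjoint or independent, so every operation on homogeneous
  elements takes the degrees (and, below, the objects) as explicit arguments, and its values
  outside the relevant pieces are irrelevant.
\<close>

record 'm cplx =
  gr :: "int \<Rightarrow> 'm set"
  dif :: "int \<Rightarrow> 'm \<Rightarrow> 'm"

definition linear_on ::
  "('k \<Rightarrow> 'a \<Rightarrow> 'a) \<Rightarrow> ('k \<Rightarrow> 'b \<Rightarrow> 'b) \<Rightarrow> 'a::ab_group_add set \<Rightarrow> ('a \<Rightarrow> 'b::ab_group_add) \<Rightarrow> bool"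
  where "linear_on s t S f \<longleftrightarrow>
    (\<forall>x\<in>S. \<forall>y\<in>S. f (x + y) = f x + f y) \<and> (\<forall>c. \<forall>x\<in>S. f (s c x) = t c (f x))"

locale cochain_complex = vector_space s
  for s :: "'k::field \<Rightarrow> 'm::ab_group_add \<Rightarrow> 'm" +
  fixes C :: "'m cplx"
  assumes gr_subspace: "subspace (gr C p)"
    and dif_in: "x \<in> gr C p \<Longrightarrow> dif C p x \<in> gr C (p + 1)"
    and dif_linear: "linear_on s s (gr C p) (dif C p)"
    and dif_dif: "x \<in> gr C p \<Longrightarrow> dif C (p + 1) (dif C p x) = 0"

definition cocycles :: "'m::ab_group_add cplx \<Rightarrow> int \<Rightarrow> 'm set"
  where "cocycles C p = {x \<in> gr C p. dif C p x = 0}"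

definition coboundaries :: "'m::ab_group_add cplx \<Rightarrow> int \<Rightarrow> 'm set"
  where "coboundaries C p = dif C (p - 1) ` gr C (p - 1)"

definition cohom_rel :: "'m::ab_group_add cplx \<Rightarrow> int \<Rightarrow> ('m \<times> 'm) set"
  where "cohom_rel C p =
    {(x, y). x \<in> cocycles C p \<and> y \<in> cocycles C p \<and> x - y \<in> coboundaries C p}"

definition cohom :: "'m::ab_group_add cplx \<Rightarrow> int \<Rightarrow> 'm set set"
  where "cohom C p = cocycles C p // cohom_rel C p"

definition cohom_map ::
  "'m'::ab_group_add cplx \<Rightarrow> (int \<Rightarrow> 'm \<Rightarrow> 'm') \<Rightarrow> int \<Rightarrow> 'm set \<Rightarrow> 'm' set"
  where "cohom_map D f p X = (\<Union>x\<in>X. cohom_rel D p `` {f p x})"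

definition acyclic_cplx :: "'m::ab_group_add cplx \<Rightarrow> bool"
  where "acyclic_cplx C \<longleftrightarrow> (\<forall>p. cocycles C p = coboundaries C p)"

text \<open>Meant for \<open>f\<close> a chain map; this is part of the only use below, for dg functors.\<close>

definition quasi_iso ::
  "'m::ab_group_add cplx \<Rightarrow> 'm'::ab_group_add cplx \<Rightarrow> (int \<Rightarrow> 'm \<Rightarrow> 'm') \<Rightarrow> bool"
  where "quasi_iso C D f \<longleftrightarrow> (\<forall>p. bij_betw (cohom_map D f p) (cohom C p) (cohom D p))"

text \<open>\<open>sg e x\<close> is \<open>(-1)\<^sup>e x\<close>.\<close>

definition sg :: "int \<Rightarrow> 'm::ab_group_add \<Rightarrow> 'm"
  where "sg e x = (if even e then x else - x)"


section \<open>Dg categories and dg functors\<close>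

text \<open>
  \<open>cmp \<C> A B C p q g f\<close> is the composite \<open>g f\<close> of \<open>g : B \<rightarrow> C\<close> of degree \<open>p\<close> and
  \<open>f : A \<rightarrow> B\<close> of degree \<open>q\<close>.
\<close>

record ('o, 'm) dgcat =
  Obj :: "'o set"
  Hom :: "'o \<Rightarrow> 'o \<Rightarrow> 'm cplx"
  cmp :: "'o \<Rightarrow> 'o \<Rightarrow> 'o \<Rightarrow> int \<Rightarrow> int \<Rightarrow> 'm \<Rightarrow> 'm \<Rightarrow> 'm"
  idm :: "'o \<Rightarrow> 'm"

locale dg_category = vector_space s
  for s :: "'k::field \<Rightarrow> 'm::ab_group_add \<Rightarrow> 'm" +
  fixes \<C> :: "('o, 'm) dgcat"
  assumes Hom_complex:
      "\<lbrakk>A \<in> Obj \<C>; B \<in> Obj \<C>\<rbrakk> \<Longrightarrow> cochain_complex s (Hom \<C> A B)"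
    and cmp_in:
      "\<lbrakk>A \<in> Obj \<C>; B \<in> Obj \<C>; C \<in> Obj \<C>; g \<in> gr (Hom \<C> B C) p; f \<in> gr (Hom \<C> A B) q\<rbrakk>
        \<Longrightarrow> cmp \<C> A B C p q g f \<in> gr (Hom \<C> A C) (p + q)"
    and cmp_linear_left:
      "\<lbrakk>A \<in> Obj \<C>; B \<in> Obj \<C>; C \<in> Obj \<C>; f \<in> gr (Hom \<C> A B) q\<rbrakk>
        \<Longrightarrow> linear_on s s (gr (Hom \<C> B C) p) (\<lambda>g. cmp \<C> A B C p q g f)"
    and cmp_linear_right:
      "\<lbrakk>A \<in> Obj \<C>; B \<in> Obj \<C>; C \<in> Obj \<C>; g \<in> gr (Hom \<C> B C) p\<rbrakk>
        \<Longrightarrow> linear_on s s (gr (Hom \<C> A B) q) (\<lambda>f. cmp \<C> A B C p q g f)"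
    and cmp_assoc:
      "\<lbrakk>A \<in> Obj \<C>; B \<in> Obj \<C>; C \<in> Obj \<C>; D \<in> Obj \<C>;
        h \<in> gr (Hom \<C> C D) p; g \<in> gr (Hom \<C> B C) q; f \<in> gr (Hom \<C> A B) r\<rbrakk>
        \<Longrightarrow> cmp \<C> A C D p (q + r) h (cmp \<C> A B C q r g f)
          = cmp \<C> A B D (p + q) r (cmp \<C> B C D p q h g) f"
    and leibniz:
      "\<lbrakk>A \<in> Obj \<C>; B \<in> Obj \<C>; C \<in> Obj \<C>; g \<in> gr (Hom \<C> B C) p; f \<in> gr (Hom \<C> A B) q\<rbrakk>
        \<Longrightarrow> dif (Hom \<C> A C) (p + q) (cmp \<C> A B C p q g f)
          = cmp \<C> A B C (p + 1) q (dif (Hom \<C> B C) p g) f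
            + sg p (cmp \<C> A B C p (q + 1) g (dif (Hom \<C> A B) q f))"
    and idm_in: "A \<in> Obj \<C> \<Longrightarrow> idm \<C> A \<in> gr (Hom \<C> A A) 0"
    and idm_left:
      "\<lbrakk>A \<in> Obj \<C>; B \<in> Obj \<C>; f \<in> gr (Hom \<C> A B) p\<rbrakk>
        \<Longrightarrow> cmp \<C> A B B 0 p (idm \<C> B) f = f"
    and idm_right:
      "\<lbrakk>A \<in> Obj \<C>; B \<in> Obj \<C>; f \<in> gr (Hom \<C> A B) p\<rbrakk>
        \<Longrightarrow> cmp \<C> A A B p 0 f (idm \<C> A) = f"

record ('o, 'm, 'o2, 'm2) dgfun =
  fobj :: "'o \<Rightarrow> 'o2"
  fmor :: "'o \<Rightarrow> 'o \<Rightarrow> int \<Rightarrow> 'm \<Rightarrow> 'm2"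

definition dg_functor ::
  "('k::field \<Rightarrow> 'm::ab_group_add \<Rightarrow> 'm) \<Rightarrow> ('k \<Rightarrow> 'm2::ab_group_add \<Rightarrow> 'm2) \<Rightarrow>
   ('o, 'm) dgcat \<Rightarrow> ('o2, 'm2) dgcat \<Rightarrow> ('o, 'm, 'o2, 'm2) dgfun \<Rightarrow> bool"
  where "dg_functor s t \<C> \<D> F \<longleftrightarrow>
    (\<forall>A\<in>Obj \<C>. fobj F A \<in> Obj \<D>) \<and>
    (\<forall>A\<in>Obj \<C>. \<forall>B\<in>Obj \<C>. \<forall>p.
      linear_on s t (gr (Hom \<C> A B) p) (fmor F A B p) \<and>
      (\<forall>f\<in>gr (Hom \<C> A B) p.
        fmor F A B p f \<in> gr (Hom \<D> (fobj F A) (fobj F B)) p \<and>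
        fmor F A B (p + 1) (dif (Hom \<C> A B) p f)
          = dif (Hom \<D> (fobj F A) (fobj F B)) p (fmor F A B p f))) \<and>
    (\<forall>A\<in>Obj \<C>. \<forall>B\<in>Obj \<C>. \<forall>C\<in>Obj \<C>. \<forall>p q.
      \<forall>g\<in>gr (Hom \<C> B C) p. \<forall>f\<in>gr (Hom \<C> A B) q.
        fmor F A C (p + q) (cmp \<C> A B C p q g f)
          = cmp \<D> (fobj F A) (fobj F B) (fobj F C) p q (fmor F B C p g) (fmor F A B q f)) \<and>
    (\<forall>A\<in>Obj \<C>. fmor F A A 0 (idm \<C> A) = idm \<D> (fobj F A))"

definition quasi_fully_faithful ::
  "('k::field \<Rightarrow> 'm::ab_group_add \<Rightarrow> 'm) \<Rightarrow> ('k \<Rightarrow> 'm2::ab_group_add \<Rightarrow> 'm2) \<Rightarrow>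
   ('o, 'm) dgcat \<Rightarrow> ('o2, 'm2) dgcat \<Rightarrow> ('o, 'm, 'o2, 'm2) dgfun \<Rightarrow> bool"
  where "quasi_fully_faithful s t \<C> \<D> F \<longleftrightarrow>
    dg_functor s t \<C> \<D> F \<and>
    (\<forall>A\<in>Obj \<C>. \<forall>B\<in>Obj \<C>.
      quasi_iso (Hom \<C> A B) (Hom \<D> (fobj F A) (fobj F B)) (fmor F A B))"


section \<open>Hypercubes of dg categories\<close>

text \<open>
  \<open>tr Q I K\<close>, for \<open>I \<subseteq> K\<close>, is the functor from \<open>cat Q I\<close> to \<open>cat Q K\<close>; the functor
  \<open>V\<^sub>J\<close> on \<open>cat Q I\<close> is \<open>tr Q I (I \<union> J)\<close>.
\<close>

record ('o, 'm) hypercube =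
  cat :: "nat set \<Rightarrow> ('o, 'm) dgcat"
  tr :: "nat set \<Rightarrow> nat set \<Rightarrow> ('o, 'm, 'o, 'm) dgfun"

locale dg_hypercube =
  fixes s :: "'k::field \<Rightarrow> 'm::ab_group_add \<Rightarrow> 'm"
    and n :: nat
    and Q :: "('o, 'm) hypercube"
  assumes cat_dg: "I \<subseteq> {..<n} \<Longrightarrow> dg_category s (cat Q I)"
    and tr_dg: "\<lbrakk>I \<subseteq> K; K \<subseteq> {..<n}\<rbrakk> \<Longrightarrow> dg_functor s s (cat Q I) (cat Q K) (tr Q I K)"
    and tr_id_obj: "\<lbrakk>I \<subseteq> {..<n}; A \<in> Obj (cat Q I)\<rbrakk> \<Longrightarrow> fobj (tr Q I I) A = A"
    and tr_id_mor:
      "\<lbrakk>I \<subseteq> {..<n}; A \<in> Obj (cat Q I); B \<in> Obj (cat Q I); f \<in> gr (Hom (cat Q I) A B) p\<rbrakk>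
        \<Longrightarrow> fmor (tr Q I I) A B p f = f"
    and tr_tr_obj:
      "\<lbrakk>I \<subseteq> K; K \<subseteq> L; L \<subseteq> {..<n}; A \<in> Obj (cat Q I)\<rbrakk>
        \<Longrightarrow> fobj (tr Q K L) (fobj (tr Q I K) A) = fobj (tr Q I L) A"
    and tr_tr_mor:
      "\<lbrakk>I \<subseteq> K; K \<subseteq> L; L \<subseteq> {..<n}; A \<in> Obj (cat Q I); B \<in> Obj (cat Q I);
        f \<in> gr (Hom (cat Q I) A B) p\<rbrakk>
        \<Longrightarrow> fmor (tr Q K L) (fobj (tr Q I K) A) (fobj (tr Q I K) B) p (fmor (tr Q I K) A B p f)
          = fmor (tr Q I L) A B p f"


section \<open>Totalisation\<close>

text \<open>
  For a finite set \<open>S\<close> let \<open>X\<^sub>S\<close> be the product of the \<open>X\<^sub>l\<close>, \<open>l \<in> S\<close>, in increasing order; these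
  monomials form a basis of the exterior algebra.  The structure of the algebra is given by

  \<^item> \<open>X\<^sub>S X\<^sub>T = (-1)\<^sup>e X\<^bsub>S \<union> T\<^esub>\<close> with \<open>e = mul_exp S T\<close>, for disjoint \<open>S\<close> and \<open>T\<close>;
  \<^item> \<open>\<partial>\<^sub>l X\<^sub>S = (-1)\<^sup>e X\<^bsub>S - {l}\<^esub>\<close> with \<open>e = del_exp l S\<close>, for \<open>l \<in> S\<close>;
  \<^item> the product of the \<open>X\<^sub>l\<close> over a list \<open>w\<close> of distinct indices, taken in the order of \<open>w\<close>, is
    \<open>(-1)\<^sup>e X\<^bsub>set w\<^esub>\<close> with \<open>e = word_exp w\<close>.
\<close>

definition mul_exp :: "nat set \<Rightarrow> nat set \<Rightarrow> int"
  where "mul_exp S T = int (card {(a, b). a \<in> S \<and> b \<in> T \<and> b < a})"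

definition del_exp :: "nat \<Rightarrow> nat set \<Rightarrow> int"
  where "del_exp l S = int (card {a \<in> S. a < l})"

fun word_exp :: "nat list \<Rightarrow> int" where
  "word_exp [] = 0"
| "word_exp (l # w) = mul_exp {l} (set w) + word_exp w"

text \<open>
  The complex \<open>\<Oplus>\<^bsub>I \<in> J\<^esub> k X\<^bsub>U - I\<^esub> \<otimes> A\<^sub>I\<close> with differential
  \<open>\<Sum>\<^sub>l \<partial>\<^sub>l \<otimes> \<alpha>\<^bsub>I,l\<^esub> + 1 \<otimes> d\<close>, where \<open>J\<close> is a set of subsets of the finite set \<open>U\<close>.  The
  element \<open>\<Sum>\<^sub>I X\<^bsub>U - I\<^esub> \<otimes> x\<^sub>I\<close> is represented by the function \<open>I \<mapsto> x\<^sub>I\<close>, zero outside \<open>J\<close>.  As \<open>X\<^sub>S\<close> has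
  degree \<open>- card S\<close>, in total degree \<open>p\<close> the component \<open>x\<^sub>I\<close> has degree \<open>p + card (U - I)\<close>.
  The component of the differential at \<open>K\<close> collects the contributions of \<open>K\<close> itself, with the Koszul
  sign for moving \<open>d\<close> past \<open>X\<^bsub>U - K\<^esub>\<close>, and of all \<open>I = K - {l}\<close> in \<open>J\<close> with \<open>l \<in> K\<close>.
\<close>

definition ext_cplx ::
  "nat set \<Rightarrow> nat set set \<Rightarrow> (nat set \<Rightarrow> 'm cplx) \<Rightarrow> (nat set \<Rightarrow> nat \<Rightarrow> int \<Rightarrow> 'm \<Rightarrow> 'm) \<Rightarrow>
   (nat set \<Rightarrow> 'm::ab_group_add) cplx"
  where "ext_cplx U J A \<alpha> =
    \<lparr> gr = (\<lambda>p. {x. (\<forall>I\<in>J. x I \<in> gr (A I) (p + int (card (U - I)))) \<and> (\<forall>I. I \<notin> J \<longrightarrow> x I = 0)}),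
      dif = (\<lambda>p x K. if K \<in> J then
          (\<Sum>l\<in>{l\<in>K. K - {l} \<in> J}.
             let I = K - {l} in
             sg (del_exp l (U - I)) (\<alpha> I l (p + int (card (U - I))) (x I)))
          + sg (int (card (U - K))) (dif (A K) (p + int (card (U - K))) (x K))
        else 0) \<rparr>"

definition totalisation ::
  "nat \<Rightarrow> (nat set \<Rightarrow> 'm cplx) \<Rightarrow> (nat set \<Rightarrow> nat \<Rightarrow> int \<Rightarrow> 'm \<Rightarrow> 'm) \<Rightarrow>
   (nat set \<Rightarrow> 'm::ab_group_add) cplx"
  where "totalisation n A \<alpha> = ext_cplx {..<n} (Pow {..<n}) A \<alpha>"

definition acyclic_hypercube :: "nat \<Rightarrow> ('o, 'm::ab_group_add) hypercube \<Rightarrow> bool"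
  where "acyclic_hypercube n Q \<longleftrightarrow>
    (\<forall>A\<in>Obj (cat Q {}). \<forall>B\<in>Obj (cat Q {}).
      acyclic_cplx (totalisation n
        (\<lambda>I. Hom (cat Q I) (fobj (tr Q {} I) A) (fobj (tr Q {} I) B))
        (\<lambda>I l. fmor (tr Q I (insert l I)) (fobj (tr Q {} I) A) (fobj (tr Q {} I) B))))"


section \<open>The category Gac\<close>

text \<open>This is empty for \<open>i > j\<close>, so that the corresponding Hom complexes below vanish.\<close>

definition Jset :: "nat \<Rightarrow> nat \<Rightarrow> nat set set"
  where "Jset i j = {I. {i, j} \<subseteq> I \<and> I \<subseteq> {i..j}}"

text \<open>The object \<open>A\<close> of \<open>cat Q {i}\<close> is represented by \<open>(i, A)\<close>.\<close>

definition gac_Hom ::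
  "('o, 'm::ab_group_add) hypercube \<Rightarrow> nat \<times> 'o \<Rightarrow> nat \<times> 'o \<Rightarrow> (nat set \<Rightarrow> 'm) cplx"
  where "gac_Hom Q = (\<lambda>(i, A) (j, B). ext_cplx {i..j} (Jset i j)
    (\<lambda>I. Hom (cat Q I) (fobj (tr Q {i} I) A) (fobj (tr Q {j} I) B))
    (\<lambda>I l. fmor (tr Q I (insert l I)) (fobj (tr Q {i} I) A) (fobj (tr Q {j} I) B)))"

text \<open>
  The bilinear extension of the composition rule for elementary tensors: the component at \<open>K\<close> collects
  the composites of \<open>X\<^sub>T \<otimes> y\<^sub>L\<close> and \<open>X\<^sub>S \<otimes> x\<^sub>I\<close> for all \<open>L\<close> and \<open>I\<close> with \<open>I \<union> L = K\<close>.
\<close>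

definition gac_cmp ::
  "('o, 'm::ab_group_add) hypercube \<Rightarrow> nat \<times> 'o \<Rightarrow> nat \<times> 'o \<Rightarrow> nat \<times> 'o \<Rightarrow> int \<Rightarrow> int \<Rightarrow>
   (nat set \<Rightarrow> 'm) \<Rightarrow> (nat set \<Rightarrow> 'm) \<Rightarrow> nat set \<Rightarrow> 'm"
  where "gac_cmp Q = (\<lambda>(i, A) (j, B) (h, C) p q y x K.
    \<Sum>(L, I)\<in>{(L, I). L \<in> Jset j h \<and> I \<in> Jset i j \<and> I \<union> L = K}.
      let T = {j..h} - L; S = {i..j} - I;
          p' = p + int (card T); q' = q + int (card S)
      in sg (p' * int (card S) + mul_exp T S)
          (cmp (cat Q K) (fobj (tr Q {i} K) A) (fobj (tr Q {j} K) B) (fobj (tr Q {h} K) C) p' q'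
            (fmor (tr Q L K) (fobj (tr Q {j} L) B) (fobj (tr Q {h} L) C) p' (y L))
            (fmor (tr Q I K) (fobj (tr Q {i} I) A) (fobj (tr Q {j} I) B) q' (x I))))"

definition Gac :: "nat \<Rightarrow> ('o, 'm::ab_group_add) hypercube \<Rightarrow> (nat \<times> 'o, nat set \<Rightarrow> 'm) dgcat"
  where "Gac n Q =
    \<lparr> Obj = {(i, A). i < n \<and> A \<in> Obj (cat Q {i})},
      Hom = gac_Hom Q,
      cmp = gac_cmp Q,
      idm = (\<lambda>(i, A) I. if I = {i} then idm (cat Q {i}) A else 0) \<rparr>"


section \<open>Twisted complexes\<close>

text \<open>
  The formal sum \<open>\<Oplus>\<^sub>i A\<^sub>i[k\<^sub>i]\<close> is the list of the pairs \<open>(A\<^sub>i, k\<^sub>i)\<close>, and a morphism is a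
  matrix \<open>f\<close>, zero outside the index range, with \<open>f i j\<close> going from the \<open>j\<close>-th summand of the source
  to the \<open>i\<close>-th summand of the target.
\<close>

type_synonym 'o fsum = "('o \<times> int) list"
type_synonym 'm mat = "nat \<Rightarrow> nat \<Rightarrow> 'm"

definition mat_gr ::
  "('o, 'm::ab_group_add) dgcat \<Rightarrow> 'o fsum \<Rightarrow> 'o fsum \<Rightarrow> int \<Rightarrow> 'm mat set"
  where "mat_gr \<C> as bs p = {f. \<forall>i j.
    if i < length bs \<and> j < length as
    then f i j \<in> gr (Hom \<C> (fst (as ! j)) (fst (bs ! i))) (p + snd (bs ! i) - snd (as ! j))
    else f i j = 0}"

definition mat_dif ::
  "('o, 'm::ab_group_add) dgcat \<Rightarrow> 'o fsum \<Rightarrow> 'o fsum \<Rightarrow> int \<Rightarrow> 'm mat \<Rightarrow> 'm mat"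
  where "mat_dif \<C> as bs p f = (\<lambda>i j.
    if i < length bs \<and> j < length as
    then sg (snd (bs ! i))
      (dif (Hom \<C> (fst (as ! j)) (fst (bs ! i))) (p + snd (bs ! i) - snd (as ! j)) (f i j))
    else 0)"

definition mat_cmp ::
  "('o, 'm::ab_group_add) dgcat \<Rightarrow> 'o fsum \<Rightarrow> 'o fsum \<Rightarrow> 'o fsum \<Rightarrow> int \<Rightarrow> int \<Rightarrow>
   'm mat \<Rightarrow> 'm mat \<Rightarrow> 'm mat"
  where "mat_cmp \<C> as bs cs p q g f = (\<lambda>i l.
    if i < length cs \<and> l < length as
    then \<Sum>j<length bs. cmp \<C> (fst (as ! l)) (fst (bs ! j)) (fst (cs ! i))
      (p + snd (cs ! i) - snd (bs ! j)) (q + snd (bs ! j) - snd (as ! l)) (g i j) (f j l)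
    else 0)"

definition tw :: "('o, 'm::ab_group_add) dgcat \<Rightarrow> ('o fsum \<times> 'm mat, 'm mat) dgcat"
  where "tw \<C> =
    \<lparr> Obj = {(as, \<delta>). fst ` set as \<subseteq> Obj \<C> \<and> \<delta> \<in> mat_gr \<C> as as 1 \<and>
        (\<forall>i j. j \<le> i \<longrightarrow> \<delta> i j = 0) \<and>
        mat_dif \<C> as as 1 \<delta> + mat_cmp \<C> as as as 1 1 \<delta> \<delta> = 0},
      Hom = (\<lambda>(as, \<delta>) (bs, \<delta>').
        \<lparr> gr = mat_gr \<C> as bs,
          dif = (\<lambda>p f. mat_dif \<C> as bs p f + mat_cmp \<C> as bs bs 1 p \<delta>' f
                   - sg p (mat_cmp \<C> as as bs p 1 f \<delta>)) \<rparr>),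
      cmp = (\<lambda>(as, _) (bs, _) (cs, _). mat_cmp \<C> as bs cs),
      idm = (\<lambda>(as, _) i j. if i = j \<and> i < length as then idm \<C> (fst (as ! i)) else 0) \<rparr>"

definition Glue ::
  "nat \<Rightarrow> ('o, 'm::ab_group_add) hypercube \<Rightarrow>
   ((nat \<times> 'o) fsum \<times> (nat set \<Rightarrow> 'm) mat, (nat set \<Rightarrow> 'm) mat) dgcat"
  where "Glue n Q = tw (Gac n Q)"

text \<open>Scalar multiplication on the ambient space of the Hom complexes of \<open>Glue n Q\<close>.\<close>

definition glue_scale ::
  "('k \<Rightarrow> 'm \<Rightarrow> 'm) \<Rightarrow> 'k \<Rightarrow> (nat set \<Rightarrow> 'm) mat \<Rightarrow> (nat set \<Rightarrow> 'm) mat"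
  where "glue_scale s c f = (\<lambda>i j I. s c (f i j I))"


section \<open>The functor \<open>\<pi>\<close>\<close>

definition ul :: "nat \<Rightarrow> nat \<Rightarrow> nat"
  where "ul n i = n - 1 - i"

text \<open>
  The sign \<open>word_exp\<close> appears because the monomial in \<open>\<alpha>\<^sub>j\<^sub>i\<close> is a product in decreasing order.
\<close>

definition pi_twist ::
  "nat \<Rightarrow> ('o, 'm::ab_group_add) hypercube \<Rightarrow> 'o \<Rightarrow> (nat set \<Rightarrow> 'm) mat"
  where "pi_twist n Q A = (\<lambda>j i I.
    if j < i \<and> i < n \<and> I = {ul n i, ul n j}
    then sg (int j + word_exp (rev [ul n i + 1 ..< ul n j])) (idm (cat Q I) (fobj (tr Q {} I) A))
    else 0)"

text \<open>
  In \<open>\<pi> f\<close> the morphism \<open>V\<^bsub>u\<^esub> f\<close> sits at position \<open>i\<close>, where \<open>u = ul n i\<close>, since \<open>\<pi> A\<close> lists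
  the objects \<open>V\<^bsub>u\<^esub> A\<close> in the order of decreasing \<open>u\<close>.
\<close>

definition pi_functor ::
  "nat \<Rightarrow> ('o, 'm::ab_group_add) hypercube \<Rightarrow>
   ('o, 'm, (nat \<times> 'o) fsum \<times> (nat set \<Rightarrow> 'm) mat, (nat set \<Rightarrow> 'm) mat) dgfun"
  where "pi_functor n Q =
    \<lparr> fobj = (\<lambda>A. (map (\<lambda>i. ((ul n i, fobj (tr Q {} {ul n i}) A), int i)) [0..<n],
                   pi_twist n Q A)),
      fmor = (\<lambda>A B p f i' i I.
        if i' = i \<and> i < n \<and> I = {ul n i}
        then sg (int (n - 1 - ul n i) * p) (fmor (tr Q {} {ul n i}) A B p f)
        else 0) \<rparr>"

end

theory Submission
  imports Defs
begin

text \<open>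
  The \<open>I\<close>-summand, \<open>I \<noteq> {}\<close>, of \<open>Hom (\<pi> A) (\<pi> B)\<close> sits in the matrix entry from \<open>V\<^sub>u A\<close> to
  \<open>V\<^sub>v B\<close> with \<open>u = Min I\<close> and \<open>v = Max I\<close>, so as a graded space \<open>Hom (\<pi> A) (\<pi> B)\<close> is the part
  of the totalisation that is indexed by the nonempty sets, while \<open>Hom A B\<close> is the part at \<open>{}\<close>.  In the
  differential of \<open>Hom (\<pi> A) (\<pi> B)\<close> the maps that adjoin an element strictly between \<open>u\<close> and \<open>v\<close>
  come from the gluing category, those that adjoin a new maximum from composing with the twist of
  \<open>\<pi> B\<close>, and those that adjoin a new minimum from composing with the twist of \<open>\<pi> A\<close>.  After a
  change of signs on each summand the totalisation is the cone of \<open>\<pi> : Hom A B \<rightarrow> Hom (\<pi> A) (\<pi> B)\<close>,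
  up to a shift by \<open>n\<close>, and a chain map is a quasi-isomorphism iff its cone is acyclic.
\<close>

section \<open>Signs\<close>

text \<open>The shifts in \<open>\<pi> A\<close> make the internal degree at \<open>I\<close> depend
  on \<open>card I\<close> alone: it is \<open>p + 1 - card I\<close> for a morphism of degree
  \<open>p\<close>, against \<open>p - card I\<close> in the totalisation in degree
  \<open>p - n\<close>. This explains the shift by \<open>n\<close>, since the empty set carries all
  \<open>n\<close> variables, and the degree \<open>p - 1\<close> of the second component of the
  cone.

  The obstacle is the meeting of five kinds of signs: those of the exterior algebra, the shifts, the
  composition in the gluing category, the twist and \<open>\<pi>\<close> itself. They are compared
  once, in \<open>cone_iso_dif\<close>. Squaring the differential of
  \<open>Hom (\<pi> A) (\<pi> B)\<close> directly would involve associativity and the Leibniz rule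
  in the gluing category. Instead d^2 = 0 is verified on the totalisation, where it rests on
  commuting squares and anticommuting derivations, and is transported along the cone isomorphism;
  the same identity makes \<open>\<pi>\<close> a chain map. The Maurer-Cartan equation enters
  because \<open>\<pi> A\<close> has to be an object of \<open>tw\<close>.\<close>

lemma sg_0 [simp]: "sg 0 x = x"
  and sg_zero [simp]: "sg e 0 = 0"
  and sg_sg [simp]: "sg a (sg b x) = sg (a + b) x"
  and sg_add: "sg e (x + y) = sg e x + sg e y"
  and sg_minus: "sg e (- x) = - sg e x"
  by (auto simp: sg_def)

lemma sg_cong: "even (a - b) \<Longrightarrow> sg a x = sg b x"
  by (auto simp: sg_def)

lemma sg_odd: "odd (a - b) \<Longrightarrow> sg a x = - sg b x"
  by (auto simp: sg_def)

lemma sg_sum: "sg e (sum f S) = (\<Sum>x\<in>S. sg e (f x))"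
  by (auto simp: sg_def sum_negf)

lemma sg_fun_apply: "sg e f x = sg e (f x)"
  by (simp add: sg_def)

lemma sg_diff: "sg e (x - y) = sg e x - sg e y"
  by (simp add: sg_def)

lemma (in vector_space) scale_sg: "scale c (sg e x) = sg e (scale c x)"
  by (simp add: sg_def)

text \<open>Triangular numbers are the exponents of the signs of word reversal. The function is
  extended to all integers so that the gap \<open>Max K - Min K - 1\<close> of a singleton, which is
  -1, is a legal argument; its value 1 there is used when the component of \<open>\<pi>\<close> is
  compared.\<close>

definition tri :: "int \<Rightarrow> int"
  where "tri x = x * (x - 1) div 2"

lemma double_tri: "2 * tri x = x * (x - 1)"
  by (simp add: tri_def)

lemma tri_add: "tri (x + y) = tri x + tri y + x * y"
proof -
  have "2 * tri (x + y) = 2 * (tri x + tri y + x * y)"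
    by (simp only: double_tri distrib_left) (simp add: algebra_simps)
  then show ?thesis by simp
qed

lemma tri_simps [simp]: "tri 0 = 0" "tri 1 = 0"
  by (simp_all add: tri_def)

text \<open>No element of \<open>T\<close> lies below an element of \<open>S\<close>, and none is
  equal to one, so every pair is an inversion. In a composite through \<open>w\<close> the variables
  of the two factors are separated by \<open>w\<close> in this way.\<close>

lemma mul_exp_separated:
  assumes "S \<subseteq> {..<w}" "T \<subseteq> {w..}"
  shows "mul_exp T S = int (card T) * int (card S)"
proof -
  have "{(a, b). a \<in> T \<and> b \<in> S \<and> b < a} = T \<times> S"
    using assms by force
  then show ?thesis by (simp add: mul_exp_def card_cartesian_product)
qed

text \<open>In a decreasing word every pair of letters is an inversion, so the sign is that of
  reversing \<open>m\<close> letters.\<close>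

lemma word_exp_rev_upt: "word_exp (rev [a..<a + m]) = tri (int m)"
proof (induction m)
  case (Suc m)
  have "mul_exp {a + m} {a..<a + m} = int m"
    by (subst mul_exp_separated[where w = "a + m"]) auto
  then show ?case
    using tri_add[of "int m" 1] by (simp add: Suc add.commute)
qed simp

text \<open>The gap is cut as \<open>(v - w) + (w - u - 1)\<close> and \<open>tri_add\<close>
  supplies the cross term. This identity makes signs match whenever an element \<open>w\<close>
  between \<open>u\<close> and \<open>v\<close> becomes, or ceases to be, an end of an
  interval.\<close>

lemma tri_split:
  "tri (int v - int u - 1) =
    tri (int v - int w - 1) + (int v - int w - 1) + tri (int w - int u - 1) + (int v - int w) * (int w - int u - 1)"
proof -
  have "tri (int v - int u - 1) = tri ((int v - int w) + (int w - int u - 1))"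
    by (rule arg_cong[of _ _ tri]) simp
  also have "\<dots> = tri (int v - int w - 1 + 1) + tri (int w - int u - 1) + (int v - int w) * (int w - int u - 1)"
    by (simp only: tri_add[of "int v - int w"] diff_add_cancel)
  finally show ?thesis by (simp only: tri_add[of _ 1] tri_simps) simp
qed

section \<open>Mapping cones\<close>

text \<open>Cohomology and acyclicity see only addition. Subgroups and additive maps treat the three
  complexes of the cone argument uniformly, although their elements have three different
  types.\<close>

definition subgroup_set :: "'a::ab_group_add set \<Rightarrow> bool"
  where "subgroup_set S \<longleftrightarrow> 0 \<in> S \<and> (\<forall>x\<in>S. \<forall>y\<in>S. x + y \<in> S) \<and> (\<forall>x\<in>S. - x \<in> S)"

definition additive_on :: "'a::ab_group_add set \<Rightarrow> ('a \<Rightarrow> 'b::ab_group_add) \<Rightarrow> bool"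
  where "additive_on S f \<longleftrightarrow> (\<forall>x\<in>S. \<forall>y\<in>S. f (x + y) = f x + f y)"

lemma subgroup_setD:
  assumes "subgroup_set S"
  shows "0 \<in> S" "x \<in> S \<Longrightarrow> y \<in> S \<Longrightarrow> x + y \<in> S" "x \<in> S \<Longrightarrow> - x \<in> S"
    "x \<in> S \<Longrightarrow> y \<in> S \<Longrightarrow> x - y \<in> S" "x \<in> S \<Longrightarrow> sg e x \<in> S"
proof -
  show "x - y \<in> S" if "x \<in> S" "y \<in> S"
    using assms that unfolding subgroup_set_def by (metis diff_conv_add_uminus)
qed (use assms in \<open>auto simp: subgroup_set_def sg_def\<close>)

lemma subgroup_set_sum:
  "subgroup_set S \<Longrightarrow> (\<And>i. i \<in> I \<Longrightarrow> f i \<in> S) \<Longrightarrow> sum f I \<in> S"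
  by (induction I rule: infinite_finite_induct) (auto simp: subgroup_setD)

lemma additive_onD:
  assumes "subgroup_set S" "additive_on S f"
  shows "f 0 = 0" "x \<in> S \<Longrightarrow> y \<in> S \<Longrightarrow> f (x + y) = f x + f y" "x \<in> S \<Longrightarrow> f (- x) = - f x"
    "x \<in> S \<Longrightarrow> y \<in> S \<Longrightarrow> f (x - y) = f x - f y" "x \<in> S \<Longrightarrow> f (sg e x) = sg e (f x)"
proof -
  have add: "f (x + y) = f x + f y" if "x \<in> S" "y \<in> S" for x y
    using assms(2) that by (simp add: additive_on_def)
  show zero: "f 0 = 0"
    using add[of 0 0] subgroup_setD(1)[OF assms(1)] by simp
  have neg: "f (- x) = - f x" if "x \<in> S" for x
    using add[of x "- x"] zero subgroup_setD(3)[OF assms(1)] that by (simp add: eq_neg_iff_add_eq_0 add.commute)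
  show "x \<in> S \<Longrightarrow> y \<in> S \<Longrightarrow> f (x + y) = f x + f y" "x \<in> S \<Longrightarrow> f (- x) = - f x"
    "x \<in> S \<Longrightarrow> f (sg e x) = sg e (f x)"
    using add neg by (auto simp: sg_def)
  show "x \<in> S \<Longrightarrow> y \<in> S \<Longrightarrow> f (x - y) = f x - f y"
    using add[of x "- y"] neg[of y] subgroup_setD(3)[OF assms(1)] by simp
qed

lemma additive_on_sum:
  "subgroup_set S \<Longrightarrow> additive_on S f \<Longrightarrow> (\<And>i. i \<in> I \<Longrightarrow> g i \<in> S) \<Longrightarrow> f (sum g I) = (\<Sum>i\<in>I. f (g i))"
  by (induction I rule: infinite_finite_induct) (auto simp: additive_onD subgroup_set_sum)

lemma linear_on_additive: "linear_on c d S f \<Longrightarrow> additive_on S f"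
  by (simp add: linear_on_def additive_on_def)

text \<open>The two clauses are trivial kernel and surjectivity on cohomology, in terms of
  representatives. Trivial kernel amounts to injectivity because two cocycles are equivalent exactly
  when their difference is a coboundary.\<close>

lemma quasi_iso_iff:
  fixes C :: "'a::ab_group_add cplx" and D :: "'b::ab_group_add cplx"
  assumes C: "\<And>p. subgroup_set (gr C p)" "\<And>p. additive_on (gr C p) (dif C p)"
      "\<And>p x. x \<in> gr C p \<Longrightarrow> dif C p x \<in> gr C (p + 1)"
    and D: "\<And>p. subgroup_set (gr D p)" "\<And>p. additive_on (gr D p) (dif D p)"
      "\<And>p x. x \<in> gr D p \<Longrightarrow> dif D p x \<in> gr D (p + 1)"
    and f: "\<And>p x. x \<in> gr C p \<Longrightarrow> f p x \<in> gr D p" "\<And>p. additive_on (gr C p) (f p)"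
      "\<And>p x. x \<in> gr C p \<Longrightarrow> f (p + 1) (dif C p x) = dif D p (f p x)"
  shows "quasi_iso C D f \<longleftrightarrow>
    (\<forall>p. (\<forall>x\<in>cocycles C p. f p x \<in> coboundaries D p \<longrightarrow> x \<in> coboundaries C p) \<and>
         (\<forall>y\<in>cocycles D p. \<exists>x\<in>cocycles C p. y - f p x \<in> coboundaries D p))"
proof -
  have sub: "subgroup_set (cocycles E p)" "subgroup_set (coboundaries E p)"
    if E: "\<And>p. subgroup_set (gr E p)" "\<And>p. additive_on (gr E p) (dif E p)"
    for E :: "'e::ab_group_add cplx" and p
  proof -
    note s = subgroup_setD[OF E(1)] and a = additive_onD[OF E]
    show "subgroup_set (cocycles E p)"
      unfolding subgroup_set_def cocycles_def by (auto simp: s a)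
    have "0 \<in> coboundaries E p"
      unfolding coboundaries_def using s(1)[of "p - 1"] a(1)[of "p - 1"] by (metis imageI)
    moreover have "x + y \<in> coboundaries E p" if xy: "x \<in> coboundaries E p" "y \<in> coboundaries E p" for x y
    proof -
      obtain x' y' where "x' \<in> gr E (p - 1)" "x = dif E (p - 1) x'" "y' \<in> gr E (p - 1)" "y = dif E (p - 1) y'"
        using xy unfolding coboundaries_def by blast
      then show ?thesis
        unfolding coboundaries_def by (intro image_eqI[of _ _ "x' + y'"]) (simp_all only: a s)
    qed
    moreover have "- x \<in> coboundaries E p" if x: "x \<in> coboundaries E p" for x
    proof -
      obtain x' where "x' \<in> gr E (p - 1)" "x = dif E (p - 1) x'"
        using x unfolding coboundaries_def by blast
      then show ?thesis
        unfolding coboundaries_def by (intro image_eqI[of _ _ "- x'"]) (simp_all only: a s)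
    qed
    ultimately show "subgroup_set (coboundaries E p)" unfolding subgroup_set_def by blast
  qed
  note subC = sub[OF C(1,2)] and subD = sub[OF D(1,2)]
  have eqv: "equiv (cocycles E p) (cohom_rel E p)"
    if "subgroup_set (coboundaries E p)"
    for E :: "'e::ab_group_add cplx" and p
  proof (rule equivI)
    show "cohom_rel E p \<subseteq> cocycles E p \<times> cocycles E p"
      by (auto simp: cohom_rel_def)
    show "refl_on (cocycles E p) (cohom_rel E p)"
      using subgroup_setD(1)[OF that] by (auto simp: refl_on_def cohom_rel_def)
    show "sym (cohom_rel E p)"
      using subgroup_setD(3)[OF that] by (fastforce simp: sym_def cohom_rel_def)
    show "trans (cohom_rel E p)"
      using subgroup_setD(2)[OF that] by (fastforce simp: trans_def cohom_rel_def)
  qed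
  note eC = eqv[OF subC(2)] and eD = eqv[OF subD(2)]
  have f_coc: "f p x \<in> cocycles D p" if "x \<in> cocycles C p" for p x
    using that f(1)[of x p] f(3)[of x p] additive_onD(1)[OF C(1) f(2)] by (auto simp: cocycles_def)
  have f_cob: "f p x \<in> coboundaries D p" if "x \<in> coboundaries C p" for p x
    using that f(3)[of _ "p - 1"] f(1)[of _ "p - 1"] by (force simp: coboundaries_def)
  have f_diff: "f p x - f p y = f p (x - y)" if "x \<in> cocycles C p" "y \<in> cocycles C p" for p x y
    using that additive_onD(4)[OF C(1) f(2)] by (auto simp: cocycles_def)
  \<comment> \<open>\<open>cohom_map\<close> is a union over all representatives of a class, so it
    has the expected value only once all of them are known to have equivalent images.\<close>
  have cls: "cohom_map D f p (cohom_rel C p `` {x}) = cohom_rel D p `` {f p x}"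
    if x: "x \<in> cocycles C p" for p x
  proof -
    have "cohom_rel D p `` {f p y} = cohom_rel D p `` {f p x}" if "(x, y) \<in> cohom_rel C p" for y
    proof (rule equiv_class_eq[OF eD, symmetric])
      show "(f p x, f p y) \<in> cohom_rel D p"
        using that f_coc f_cob f_diff by (auto simp: cohom_rel_def)
    qed
    moreover have "(x, x) \<in> cohom_rel C p"
      using eC x by (auto simp: equiv_def refl_on_def)
    ultimately show ?thesis unfolding cohom_map_def by blast
  qed
  have clsD: "cohom_rel D p `` {y} = cohom_rel D p `` {y'} \<longleftrightarrow> y - y' \<in> coboundaries D p"
    if "y \<in> cocycles D p" "y' \<in> cocycles D p" for y y' p
    using eq_equiv_class_iff[OF eD that] that by (auto simp: cohom_rel_def)
  have clsC: "cohom_rel C p `` {y} = cohom_rel C p `` {y'} \<longleftrightarrow> y - y' \<in> coboundaries C p"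
    if "y \<in> cocycles C p" "y' \<in> cocycles C p" for y y' p
    using eq_equiv_class_iff[OF eC that] that by (auto simp: cohom_rel_def)
  have "bij_betw (cohom_map D f p) (cohom C p) (cohom D p) \<longleftrightarrow>
      (\<forall>x\<in>cocycles C p. f p x \<in> coboundaries D p \<longrightarrow> x \<in> coboundaries C p) \<and>
      (\<forall>y\<in>cocycles D p. \<exists>x\<in>cocycles C p. y - f p x \<in> coboundaries D p)" for p
  proof -
    have into: "cohom_map D f p ` cohom C p \<subseteq> cohom D p"
    proof
      fix Y assume "Y \<in> cohom_map D f p ` cohom C p"
      then obtain x where "x \<in> cocycles C p" "Y = cohom_map D f p (cohom_rel C p `` {x})"
        unfolding cohom_def quotient_def by blast
      then show "Y \<in> cohom D p"
        unfolding cohom_def by (simp only: cls) (intro quotientI f_coc)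
    qed
    have inj: "inj_on (cohom_map D f p) (cohom C p) \<longleftrightarrow>
      (\<forall>x\<in>cocycles C p. f p x \<in> coboundaries D p \<longrightarrow> x \<in> coboundaries C p)" (is "?L \<longleftrightarrow> ?R")
    proof
      assume L: ?L
      show ?R
      proof (intro ballI impI)
        fix x assume x: "x \<in> cocycles C p" "f p x \<in> coboundaries D p"
        have z: "0 \<in> cocycles C p" using subgroup_setD(1)[OF subC(1)] .
        have f0: "f p 0 = 0" using additive_onD(1)[OF C(1) f(2)] .
        have "cohom_rel D p `` {f p x} = cohom_rel D p `` {f p 0}"
          using clsD[OF f_coc f_coc, OF x(1) z] x(2) by (simp add: f0)
        then have "cohom_rel C p `` {x} = cohom_rel C p `` {0}"
          using x(1) z by (intro inj_onD[OF L]) (simp_all add: cls cohom_def quotientI)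
        then show "x \<in> coboundaries C p" using clsC[OF x(1) z] by simp
      qed
    next
      assume R: ?R
      show ?L
      proof (rule inj_onI)
        fix X Y assume XY: "X \<in> cohom C p" "Y \<in> cohom C p" "cohom_map D f p X = cohom_map D f p Y"
        then obtain x y where xy: "x \<in> cocycles C p" "y \<in> cocycles C p"
            "X = cohom_rel C p `` {x}" "Y = cohom_rel C p `` {y}"
          unfolding cohom_def quotient_def by blast
        then have "f p (x - y) \<in> coboundaries D p"
          using XY(3) clsD[OF f_coc f_coc] cls f_diff by metis
        then show "X = Y" using R xy clsC subgroup_setD(4)[OF subC(1)] by blast
      qed
    qed
    have surj: "cohom D p \<subseteq> cohom_map D f p ` cohom C p \<longleftrightarrow>
      (\<forall>y\<in>cocycles D p. \<exists>x\<in>cocycles C p. y - f p x \<in> coboundaries D p)"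
    proof -
      have "cohom D p \<subseteq> cohom_map D f p ` cohom C p \<longleftrightarrow>
        (\<forall>y\<in>cocycles D p. \<exists>x\<in>cocycles C p. cohom_rel D p `` {y} = cohom_rel D p `` {f p x})"
        unfolding cohom_def quotient_def by (auto simp: cls subset_iff image_iff)
      then show ?thesis using clsD f_coc by (metis (no_types, lifting))
    qed
    show ?thesis unfolding bij_betw_def using into inj surj by blast
  qed
  then show ?thesis unfolding quasi_iso_def by blast
qed

text \<open>
  The complex \<open>T\<close> is, up to a shift by \<open>c\<close> and the isomorphism \<open>e\<close>, the cone of \<open>f\<close>.  That \<open>T\<close> is a
  complex forces \<open>D\<close> to be a complex and \<open>f\<close> to be a chain map.
\<close>

locale mapping_cone =
  fixes C :: "'a::ab_group_add cplx" and D :: "'b::ab_group_add cplx" and T :: "'c::ab_group_add cplx"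
    and f :: "int \<Rightarrow> 'a \<Rightarrow> 'b" and e :: "int \<Rightarrow> 'a \<Rightarrow> 'b \<Rightarrow> 'c" and c :: int
  assumes C_sub: "subgroup_set (gr C p)"
    and C_add: "additive_on (gr C p) (dif C p)"
    and C_in: "x \<in> gr C p \<Longrightarrow> dif C p x \<in> gr C (p + 1)"
    and C_dd: "x \<in> gr C p \<Longrightarrow> dif C (p + 1) (dif C p x) = 0"
    and D_sub: "subgroup_set (gr D p)"
    and D_in: "y \<in> gr D p \<Longrightarrow> dif D p y \<in> gr D (p + 1)"
    and f_in: "x \<in> gr C p \<Longrightarrow> f p x \<in> gr D p"
    and f_add: "additive_on (gr C p) (f p)"
    and T_sub: "subgroup_set (gr T p)"
    and T_add: "additive_on (gr T p) (dif T p)"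
    and T_dd: "z \<in> gr T p \<Longrightarrow> dif T (p + 1) (dif T p z) = 0"
    and e_bij: "bij_betw (\<lambda>(x, y). e p x y) (gr C p \<times> gr D (p - 1)) (gr T (p + c))"
    and e_add: "\<lbrakk>x \<in> gr C p; x' \<in> gr C p; y \<in> gr D (p - 1); y' \<in> gr D (p - 1)\<rbrakk>
      \<Longrightarrow> e p (x + x') (y + y') = e p x y + e p x' y'"
    and T_e: "\<lbrakk>x \<in> gr C p; y \<in> gr D (p - 1)\<rbrakk>
      \<Longrightarrow> dif T (p + c) (e p x y) = e (p + 1) (- dif C p x) (f p x + dif D (p - 1) y)"
begin

lemmas C_s = subgroup_setD[OF C_sub] and D_s = subgroup_setD[OF D_sub]
  and C_a = additive_onD[OF C_sub C_add] and f_a = additive_onD[OF C_sub f_add]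

lemma e_in: "x \<in> gr C p \<Longrightarrow> y \<in> gr D (p - 1) \<Longrightarrow> e p x y \<in> gr T (p + c)"
  using e_bij[of p] by (auto simp: bij_betw_def)

lemma shift: "p + c + 1 = p + 1 + c"
  by simp

lemma e_inj:
  "\<lbrakk>e p x y = e p x' y'; x \<in> gr C p; y \<in> gr D (p - 1); x' \<in> gr C p; y' \<in> gr D (p - 1)\<rbrakk>
    \<Longrightarrow> x = x' \<and> y = y'"
  using e_bij[of p] unfolding bij_betw_def inj_on_def by auto

lemma e_inj_snd:
  "\<lbrakk>e (p + 1) 0 y = e (p + 1) 0 y'; y \<in> gr D p; y' \<in> gr D p\<rbrakk> \<Longrightarrow> y = y'"
  using e_inj[of "p + 1" 0 y 0 y'] by (simp add: C_sub subgroup_setD(1))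

lemma e_0: "e p 0 0 = 0"
  using e_add[of 0 p 0 0 0] by (simp add: C_s D_s)

lemma D_in': "y \<in> gr D (p - 1) \<Longrightarrow> dif D (p - 1) y \<in> gr D p"
  using D_in[of y "p - 1"] by simp

lemma D_in2: "y \<in> gr D (p - 2) \<Longrightarrow> dif D (p - 2) y \<in> gr D (p - 1)"
  using D_in[of y "p - 2"] by simp

text \<open>The pairs with first component 0 form the subcomplex of the cone given by
  \<open>D\<close>. Identities in \<open>D\<close> therefore follow from identities in
  \<open>T\<close> by injectivity of \<open>e\<close>.\<close>

lemma T_e_snd:
  assumes "y \<in> gr D p"
  shows "dif T (p + 1 + c) (e (p + 1) 0 y) = e (p + 1 + 1) 0 (dif D p y)"
  using T_e[of 0 "p + 1" y] assms by (simp add: C_s C_a f_a)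

lemma D_add: "additive_on (gr D p) (dif D p)"
  unfolding additive_on_def
proof (intro ballI)
  fix y y' assume y: "y \<in> gr D p" "y' \<in> gr D p"
  have "e (p + 1 + 1) 0 (dif D p (y + y')) = dif T (p + 1 + c) (e (p + 1) 0 y + e (p + 1) 0 y')"
    using T_e_snd[of "y + y'" p] e_add[of 0 "p + 1" 0 y y'] y by (simp add: C_s D_s)
  also have "\<dots> = e (p + 1 + 1) 0 (dif D p y) + e (p + 1 + 1) 0 (dif D p y')"
    using y T_e_snd by (simp add: additive_onD(2)[OF T_sub T_add] e_in C_s)
  also have "\<dots> = e (p + 1 + 1) 0 (dif D p y + dif D p y')"
    using e_add[of 0 "p + 1 + 1" 0 "dif D p y" "dif D p y'"] D_in[OF y(1)] D_in[OF y(2)]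
    by (simp only: C_s add_diff_cancel_right' add_0_left)
  finally show "dif D p (y + y') = dif D p y + dif D p y'"
    using y by (intro e_inj_snd[of "p + 1"]) (auto intro!: D_s D_in)
qed

lemmas D_a = additive_onD[OF D_sub D_add]

lemma D_dd:
  assumes "y \<in> gr D p"
  shows "dif D (p + 1) (dif D p y) = 0"
proof -
  have "0 = dif T (p + 1 + c + 1) (dif T (p + 1 + c) (e (p + 1) 0 y))"
    using assms by (intro T_dd[symmetric] e_in) (auto simp: C_s)
  also have "\<dots> = e (p + 1 + 1 + 1) 0 (dif D (p + 1) (dif D p y))"
    using T_e_snd[OF D_in[OF assms]] unfolding T_e_snd[OF assms] by (simp only: shift)
  finally show ?thesis
    by (intro e_inj_snd[OF _ D_in[OF D_in[OF assms]] D_s(1)]) (simp only: e_0)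
qed

text \<open>This is the second component of d^2 = 0, applied to the pair
  \<open>(x, 0)\<close>.\<close>

lemma chain_map:
  assumes x: "x \<in> gr C p"
  shows "f (p + 1) (dif C p x) = dif D p (f p x)"
proof -
  have 1: "dif T (p + c) (e p x 0) = e (p + 1) (- dif C p x) (f p x)"
    using T_e[OF x, of 0] by (simp add: D_s D_a)
  have "0 = dif T (p + c + 1) (dif T (p + c) (e p x 0))"
    using x by (intro T_dd[symmetric] e_in) (auto simp: D_s)
  also have "\<dots> = e (p + 1 + 1) (- dif C (p + 1) (- dif C p x)) (f (p + 1) (- dif C p x) + dif D p (f p x))"
    using T_e[of "- dif C p x" "p + 1" "f p x"] C_s(3)[OF C_in[OF x]] f_in[OF x]
    unfolding 1 by (simp only: shift add_diff_cancel_right')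
  also have "\<dots> = e (p + 1 + 1) 0 (dif D p (f p x) - f (p + 1) (dif C p x))"
    using x by (simp add: C_a f_a C_in C_dd)
  finally have "dif D p (f p x) - f (p + 1) (dif C p x) = 0"
    by (intro e_inj_snd[OF _ D_s(4)[OF D_in[OF f_in[OF x]] f_in[OF C_in[OF x]]] D_s(1)])
      (simp only: e_0)
  then show ?thesis by simp
qed

lemma chain_map': "x \<in> gr C (p - 1) \<Longrightarrow> f p (dif C (p - 1) x) = dif D (p - 1) (f (p - 1) x)"
  using chain_map[of x "p - 1"] by simp

lemma e_cocycle_iff:
  assumes "x \<in> gr C p" "y \<in> gr D (p - 1)"
  shows "e p x y \<in> cocycles T (p + c) \<longleftrightarrow> dif C p x = 0 \<and> f p x + dif D (p - 1) y = 0"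
proof -
  have "e p x y \<in> cocycles T (p + c) \<longleftrightarrow>
      e (p + 1) (- dif C p x) (f p x + dif D (p - 1) y) = e (p + 1) 0 0"
    using assms by (simp add: cocycles_def e_in T_e e_0)
  also have "\<dots> \<longleftrightarrow> dif C p x = 0 \<and> f p x + dif D (p - 1) y = 0"
    using e_inj[of "p + 1" "- dif C p x" "f p x + dif D (p - 1) y" 0 0] assms
    by (auto simp: C_s D_s C_in D_in' f_in)
  finally show ?thesis .
qed

lemma e_coboundary_iff:
  assumes "x \<in> gr C p" "y \<in> gr D (p - 1)"
  shows "e p x y \<in> coboundaries T (p + c) \<longleftrightarrow> (\<exists>x'\<in>gr C (p - 1). \<exists>y'\<in>gr D (p - 1 - 1).
    x = - dif C (p - 1) x' \<and> y = f (p - 1) x' + dif D (p - 1 - 1) y')"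
proof -
  have "e p x y \<in> coboundaries T (p + c) \<longleftrightarrow> (\<exists>x'\<in>gr C (p - 1). \<exists>y'\<in>gr D (p - 1 - 1).
      e p x y = dif T (p - 1 + c) (e (p - 1) x' y'))"
  proof -
    have "gr T (p + c - 1) = (\<lambda>(x, y). e (p - 1) x y) ` (gr C (p - 1) \<times> gr D (p - 1 - 1))"
      using bij_betw_imp_surj_on[OF e_bij[of "p - 1"]] by (simp add: algebra_simps)
    then show ?thesis unfolding coboundaries_def by (auto simp: algebra_simps)
  qed
  also have "\<dots> \<longleftrightarrow> (\<exists>x'\<in>gr C (p - 1). \<exists>y'\<in>gr D (p - 1 - 1).
      e p x y = e p (- dif C (p - 1) x') (f (p - 1) x' + dif D (p - 1 - 1) y'))"
    using T_e[of _ "p - 1"] by simp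
  also have "\<dots> \<longleftrightarrow> (\<exists>x'\<in>gr C (p - 1). \<exists>y'\<in>gr D (p - 1 - 1).
      x = - dif C (p - 1) x' \<and> y = f (p - 1) x' + dif D (p - 1 - 1) y')"
  proof -
    have "e p x y = e p (- dif C (p - 1) x') (f (p - 1) x' + dif D (p - 1 - 1) y') \<longleftrightarrow>
      x = - dif C (p - 1) x' \<and> y = f (p - 1) x' + dif D (p - 1 - 1) y'"
      if "x' \<in> gr C (p - 1)" "y' \<in> gr D (p - 1 - 1)" for x' y'
      using e_inj[OF _ assms, of "- dif C (p - 1) x'" "f (p - 1) x' + dif D (p - 1 - 1) y'"] that
        C_in[of x' "p - 1"] by (auto simp: C_s D_s D_in2 f_in)
    then show ?thesis by blast
  qed
  finally show ?thesis .
qed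

text \<open>In the coordinates \<open>(x, y)\<close> exactness becomes a pair of equations. Closure
  of the pieces of \<open>T\<close> under its differential is derived on the way, by writing each
  element as some \<open>e p x y\<close>, so that coboundaries have coordinates too.\<close>

lemma acyclic_iff:
  "acyclic_cplx T \<longleftrightarrow> (\<forall>p. \<forall>x\<in>gr C p. \<forall>y\<in>gr D (p - 1).
    dif C p x = 0 \<and> f p x + dif D (p - 1) y = 0 \<longleftrightarrow>
    (\<exists>x'\<in>gr C (p - 1). \<exists>y'\<in>gr D (p - 1 - 1).
      x = - dif C (p - 1) x' \<and> y = f (p - 1) x' + dif D (p - 1 - 1) y'))"
proof -
  have T_in: "dif T p z \<in> gr T (p + 1)" if z: "z \<in> gr T p" for p z
  proof -
    obtain x y where "x \<in> gr C (p - c)" "y \<in> gr D (p - c - 1)" "z = e (p - c) x y"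
    proof -
      have "z \<in> (\<lambda>(x, y). e (p - c) x y) ` (gr C (p - c) \<times> gr D (p - c - 1))"
        using z bij_betw_imp_surj_on[OF e_bij[of "p - c"]] by simp
      with that show thesis by auto
    qed
    then show "dif T p z \<in> gr T (p + 1)"
      using T_e[of x "p - c" y] e_in[of "- dif C (p - c) x" "p - c + 1"
        "f (p - c) x + dif D (p - c - 1) y"]
      by (simp add: C_s D_s C_in D_in' f_in)
  qed
  have "acyclic_cplx T \<longleftrightarrow> (\<forall>p. cocycles T (p + c) = coboundaries T (p + c))"
    unfolding acyclic_cplx_def by (metis diff_add_cancel)
  also have "\<dots> \<longleftrightarrow> (\<forall>p. \<forall>z\<in>gr T (p + c). z \<in> cocycles T (p + c) \<longleftrightarrow> z \<in> coboundaries T (p + c))"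
    using T_in[of _ "p + c - 1" for p]
    by (fastforce simp: set_eq_iff cocycles_def coboundaries_def)
  also have "\<dots> \<longleftrightarrow> (\<forall>p. \<forall>x\<in>gr C p. \<forall>y\<in>gr D (p - 1).
      e p x y \<in> cocycles T (p + c) \<longleftrightarrow> e p x y \<in> coboundaries T (p + c))"
    by (simp flip: bij_betw_imp_surj_on[OF e_bij])
  finally show ?thesis using e_cocycle_iff e_coboundary_iff by simp
qed

theorem acyclic_iff_quasi_iso: "acyclic_cplx T \<longleftrightarrow> quasi_iso C D f"
proof -
  let ?qi = "\<lambda>p. (\<forall>x\<in>cocycles C p. f p x \<in> coboundaries D p \<longrightarrow> x \<in> coboundaries C p) \<and>
         (\<forall>y\<in>cocycles D p. \<exists>x\<in>cocycles C p. y - f p x \<in> coboundaries D p)"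
  have qi: "quasi_iso C D f \<longleftrightarrow> (\<forall>p. ?qi p)"
    using C_sub C_add C_in D_sub D_add D_in f_in f_add chain_map by (intro quasi_iso_iff) auto
  show ?thesis
  proof
    assume "acyclic_cplx T"
    then have ac: "\<And>p x y. x \<in> gr C p \<Longrightarrow> y \<in> gr D (p - 1) \<Longrightarrow>
      dif C p x = 0 \<Longrightarrow> f p x + dif D (p - 1) y = 0 \<Longrightarrow>
      (\<exists>x'\<in>gr C (p - 1). \<exists>y'\<in>gr D (p - 1 - 1).
        x = - dif C (p - 1) x' \<and> y = f (p - 1) x' + dif D (p - 1 - 1) y')"
      unfolding acyclic_iff by blast
    show "quasi_iso C D f"
      unfolding qi
    proof (intro allI conjI ballI impI)
      fix p x assume x: "x \<in> cocycles C p" "f p x \<in> coboundaries D p"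
      then obtain y where y: "y \<in> gr D (p - 1)" "f p x = dif D (p - 1) y"
        by (auto simp: coboundaries_def)
      \<comment> \<open>As \<open>f p x\<close> is the differential of \<open>y\<close>, the pair
        \<open>(x, - y)\<close> is a cocycle of the cone; the first component of a bounding pair
        bounds \<open>x\<close> up to sign.\<close>
      obtain x' where "x' \<in> gr C (p - 1)" "x = - dif C (p - 1) x'"
        using ac[of x p "- y"] x(1) y by (auto simp: cocycles_def D_s D_a)
      then show "x \<in> coboundaries C p"
        by (auto simp: coboundaries_def C_s C_a intro!: image_eqI[of _ _ "- x'"])
    next
      fix p y assume y: "y \<in> cocycles D p"
      \<comment> \<open>The pair \<open>(0, y)\<close> is a cocycle of the cone in degree
        \<open>p + 1\<close>. A bounding pair consists of a cocycle of \<open>C\<close> whose image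
        represents the class of \<open>y\<close>, and of a primitive of the difference.\<close>
      obtain x' y' where *: "x' \<in> gr C p" "y' \<in> gr D (p - 1)"
        "0 = - dif C p x'" "y = f p x' + dif D (p - 1) y'"
        using ac[of 0 "p + 1" y] y by (auto simp: cocycles_def C_s C_a f_a)
      then show "\<exists>x\<in>cocycles C p. y - f p x \<in> coboundaries D p"
        by (auto simp: cocycles_def coboundaries_def intro!: bexI[of _ x'])
    qed
  next
    assume "quasi_iso C D f"
    then have inj: "\<And>p x. x \<in> cocycles C p \<Longrightarrow> f p x \<in> coboundaries D p \<Longrightarrow> x \<in> coboundaries C p"
      and surj: "\<And>p y. y \<in> cocycles D p \<Longrightarrow> \<exists>x\<in>cocycles C p. y - f p x \<in> coboundaries D p"
      unfolding qi by blast+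
    show "acyclic_cplx T"
      unfolding acyclic_iff
    proof (intro allI ballI iffI)
      fix p x y
      assume xy: "x \<in> gr C p" "y \<in> gr D (p - 1)"
      assume coc: "dif C p x = 0 \<and> f p x + dif D (p - 1) y = 0"
      then have "f p x = dif D (p - 1) (- y)"
        using xy by (simp add: D_a eq_neg_iff_add_eq_0)
      then have "x \<in> coboundaries C p"
        using xy coc by (intro inj) (auto simp: cocycles_def coboundaries_def D_s)
      then obtain x1 where x1: "x1 \<in> gr C (p - 1)" "x = dif C (p - 1) x1"
        by (auto simp: coboundaries_def)
      \<comment> \<open>Injectivity gave a primitive \<open>x1\<close> of \<open>x\<close>. Its
        defect in the second component is a cocycle of \<open>D\<close>, which by surjectivity is
        cohomologous to the image of a cocycle \<open>z\<close>. The bounding pair is then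
        \<open>(z - x1, y')\<close>.\<close>
      have "f (p - 1) x1 + y \<in> cocycles D (p - 1)"
        using xy x1 coc chain_map'[OF x1(1)] by (auto simp: cocycles_def D_s D_a f_in)
      then obtain z y' where z: "z \<in> gr C (p - 1)" "dif C (p - 1) z = 0" "y' \<in> gr D (p - 1 - 1)"
        "f (p - 1) x1 + y - f (p - 1) z = dif D (p - 1 - 1) y'"
        using surj[of "f (p - 1) x1 + y" "p - 1"] by (auto simp: cocycles_def coboundaries_def)
      then have y: "y = f (p - 1) z - f (p - 1) x1 + dif D (p - 1 - 1) y'"
        by (simp add: algebra_simps)
      show "\<exists>x'\<in>gr C (p - 1). \<exists>y'\<in>gr D (p - 1 - 1).
          x = - dif C (p - 1) x' \<and> y = f (p - 1) x' + dif D (p - 1 - 1) y'"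
        using z(1-3) x1 y by (intro bexI[of _ "z - x1"] bexI[of _ y']) (simp_all add: C_s C_a f_a)
    next
      fix p x y
      assume "\<exists>x'\<in>gr C (p - 1). \<exists>y'\<in>gr D (p - 1 - 1).
          x = - dif C (p - 1) x' \<and> y = f (p - 1) x' + dif D (p - 1 - 1) y'"
      then obtain x' y' where *: "x' \<in> gr C (p - 1)" "y' \<in> gr D (p - 1 - 1)"
        "x = - dif C (p - 1) x'" "y = f (p - 1) x' + dif D (p - 1 - 1) y'" by blast
      have "dif C (p - 1) x' \<in> gr C p" "dif C p (dif C (p - 1) x') = 0"
        using C_in[OF *(1)] C_dd[OF *(1)] by simp_all
      moreover have "dif D (p - 1 - 1) y' \<in> gr D (p - 1)" "dif D (p - 1) (dif D (p - 1 - 1) y') = 0"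
        using D_in[OF *(2)] D_dd[OF *(2)] by simp_all
      ultimately show "dif C p x = 0 \<and> f p x + dif D (p - 1) y = 0"
        using * by (simp add: C_a f_a D_a f_in chain_map')
    qed
  qed
qed

end

section \<open>Totalisations are complexes\<close>

lemma int_card_compl:
  "K \<subseteq> {..<n} \<Longrightarrow> int (card ({..<n} - K)) = int n - int (card K)"
  using card_mono[of "{..<n}" K] by (simp add: card_Diff_subset finite_subset of_nat_diff)

lemma int_card_Diff_singleton: "finite K \<Longrightarrow> l \<in> K \<Longrightarrow> int (card (K - {l})) = int (card K) - 1"
  using card_gt_0_iff[of K] by (auto simp: card_Diff_singleton of_nat_diff)

text \<open>Below \<open>l\<close>, the complement of \<open>K - {l}\<close> consists of the
  \<open>l - a\<close> numbers of the interval without the elements of \<open>K\<close>. Exponents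
  thus become functions of \<open>K\<close> itself, which can be compared between different ambient
  intervals.\<close>

lemma del_exp_interval_Diff:
  assumes "K \<subseteq> {a..<b}" "l \<in> K"
  shows "del_exp l ({a..<b} - (K - {l})) = int l - int a - int (card {m \<in> K. m < l})"
proof -
  have "{m \<in> {a..<b} - (K - {l}). m < l} = {a..<l} - {m \<in> K. m < l}"
    using assms by auto
  moreover have "{m \<in> K. m < l} \<subseteq> {a..<l}" "a \<le> l"
    using assms by auto
  ultimately show ?thesis
    using card_mono[of "{a..<l}" "{m \<in> K. m < l}"]
    by (simp add: del_exp_def card_Diff_subset finite_subset of_nat_diff)
qed

text \<open>The terms at \<open>(l, m)\<close> and \<open>(m, l)\<close> cancel. Comparing the sum
  with its transpose would only show that twice the sum vanishes, which does not suffice in an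
  abelian group; hence the induction.\<close>

lemma sum_antisym_eq_0:
  fixes h :: "'a \<Rightarrow> 'a \<Rightarrow> 'b::ab_group_add"
  assumes "finite K" "\<And>l m. l \<in> K \<Longrightarrow> m \<in> K \<Longrightarrow> l \<noteq> m \<Longrightarrow> h l m = - h m l"
  shows "(\<Sum>l\<in>K. \<Sum>m\<in>K - {l}. h l m) = 0"
  using assms
proof (induction K rule: finite_induct)
  case (insert a K)
  have "(\<Sum>m\<in>insert a K - {l}. h l m) = h l a + (\<Sum>m\<in>K - {l}. h l m)" if "l \<in> K" for l
  proof -
    have "insert a K - {l} = insert a (K - {l})" using insert.hyps that by auto
    moreover have "finite (K - {l})" "a \<notin> K - {l}" using insert.hyps by auto
    ultimately show ?thesis by (simp only: sum.insert simp_thms)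
  qed
  then have "(\<Sum>l\<in>K. \<Sum>m\<in>insert a K - {l}. h l m) =
      (\<Sum>l\<in>K. h l a + (\<Sum>m\<in>K - {l}. h l m))"
    by (intro sum.cong refl)
  moreover have "insert a K - {a} = K" using insert.hyps by auto
  ultimately have "(\<Sum>l\<in>insert a K. \<Sum>m\<in>insert a K - {l}. h l m) =
      (\<Sum>m\<in>K. h a m) + ((\<Sum>l\<in>K. h l a) + (\<Sum>l\<in>K. \<Sum>m\<in>K - {l}. h l m))"
    by (simp only: sum.insert[OF insert.hyps] sum.distrib)
  also have "(\<Sum>l\<in>K. h l a) = (\<Sum>l\<in>K. - h a l)"
    using insert.hyps by (intro sum.cong insert.prems) auto
  also have "(\<Sum>l\<in>K. \<Sum>m\<in>K - {l}. h l m) = 0"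
    by (intro insert.IH insert.prems) auto
  finally show ?case by (simp add: sum_negf)
qed simp

text \<open>The squares in \<open>\<alpha>_comm\<close> commute and do not anticommute: all signs
  come from the exterior algebra.\<close>

locale cplx_cube =
  fixes n :: nat and A :: "nat set \<Rightarrow> 'm::ab_group_add cplx"
    and \<alpha> :: "nat set \<Rightarrow> nat \<Rightarrow> int \<Rightarrow> 'm \<Rightarrow> 'm"
  assumes A_sub: "I \<subseteq> {..<n} \<Longrightarrow> subgroup_set (gr (A I) p)"
    and A_add: "I \<subseteq> {..<n} \<Longrightarrow> additive_on (gr (A I) p) (dif (A I) p)"
    and A_in: "I \<subseteq> {..<n} \<Longrightarrow> x \<in> gr (A I) p \<Longrightarrow> dif (A I) p x \<in> gr (A I) (p + 1)"
    and A_dd: "I \<subseteq> {..<n} \<Longrightarrow> x \<in> gr (A I) p \<Longrightarrow> dif (A I) (p + 1) (dif (A I) p x) = 0"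
    and \<alpha>_add: "insert l I \<subseteq> {..<n} \<Longrightarrow> additive_on (gr (A I) p) (\<alpha> I l p)"
    and \<alpha>_in: "insert l I \<subseteq> {..<n} \<Longrightarrow> x \<in> gr (A I) p \<Longrightarrow> \<alpha> I l p x \<in> gr (A (insert l I)) p"
    and \<alpha>_dif: "insert l I \<subseteq> {..<n} \<Longrightarrow> x \<in> gr (A I) p
      \<Longrightarrow> \<alpha> I l (p + 1) (dif (A I) p x) = dif (A (insert l I)) p (\<alpha> I l p x)"
    and \<alpha>_comm: "insert l (insert m I) \<subseteq> {..<n} \<Longrightarrow> x \<in> gr (A I) p
      \<Longrightarrow> \<alpha> (insert m I) l p (\<alpha> I m p x) = \<alpha> (insert l I) m p (\<alpha> I l p x)"
begin

abbreviation "T \<equiv> totalisation n A \<alpha>"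

lemmas A_s = subgroup_setD[OF A_sub] and A_a = additive_onD[OF A_sub A_add]

lemma \<alpha>_a:
  assumes "insert l I \<subseteq> {..<n}"
  shows "\<alpha> I l p 0 = 0"
    "x \<in> gr (A I) p \<Longrightarrow> y \<in> gr (A I) p \<Longrightarrow> \<alpha> I l p (x + y) = \<alpha> I l p x + \<alpha> I l p y"
    "x \<in> gr (A I) p \<Longrightarrow> \<alpha> I l p (sg e x) = sg e (\<alpha> I l p x)"
    "(\<And>i. i \<in> S \<Longrightarrow> g i \<in> gr (A I) p) \<Longrightarrow> \<alpha> I l p (sum g S) = (\<Sum>i\<in>S. \<alpha> I l p (g i))"
  using assms A_sub[of I p] \<alpha>_add[of l I p] by (auto simp: additive_onD additive_on_sum)

lemma T_gr:
  "x \<in> gr T p \<longleftrightarrow> (\<forall>I\<subseteq>{..<n}. x I \<in> gr (A I) (p + (int n - int (card I)))) \<and>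
    (\<forall>I. \<not> I \<subseteq> {..<n} \<longrightarrow> x I = 0)"
  unfolding totalisation_def ext_cplx_def using int_card_compl[of _ n] by auto

lemma T_dif_out: "\<not> K \<subseteq> {..<n} \<Longrightarrow> dif T p x K = 0"
  by (simp add: totalisation_def ext_cplx_def)

text \<open>The set \<open>K - {l}\<close> carries one variable more than \<open>K\<close>, so its
  component sits one internal degree higher; hence \<open>p + 1\<close> under the edge maps.\<close>

lemma T_dif:
  assumes K: "K \<subseteq> {..<n}"
  shows "dif T p x K =
    (\<Sum>l\<in>K. sg (int l - int (card {m \<in> K. m < l}))
      (\<alpha> (K - {l}) l (p + 1 + (int n - int (card K))) (x (K - {l})))) +
    sg (int n - int (card K)) (dif (A K) (p + (int n - int (card K))) (x K))"
proof -
  have fin: "finite K" using K finite_subset by blast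
  have "del_exp l ({..<n} - (K - {l})) = int l - int (card {m \<in> K. m < l})" if "l \<in> K" for l
    using del_exp_interval_Diff[of K 0 n l] K that by (simp add: lessThan_atLeast0)
  moreover have "p + int (card ({..<n} - (K - {l}))) = p + 1 + (int n - int (card K))"
    if "l \<in> K" for l
    using int_card_compl[OF subset_trans[OF Diff_subset K], of "{l}"]
      int_card_Diff_singleton[OF fin that] by simp
  moreover have "{l \<in> K. K - {l} \<subseteq> {..<n}} = K"
    using K by auto
  ultimately show ?thesis
    using K by (simp add: totalisation_def ext_cplx_def Let_def int_card_compl add.assoc cong: sum.cong)
qed

lemma T_sub: "subgroup_set (gr T p)"
  by (auto simp: subgroup_set_def T_gr A_s)

lemma T_add: "additive_on (gr T p) (dif T p)"
  unfolding additive_on_def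
proof (intro ballI ext)
  fix x y K assume xy: "x \<in> gr T p" "y \<in> gr T p"
  show "dif T p (x + y) K = (dif T p x + dif T p y) K"
  proof (cases "K \<subseteq> {..<n}")
    case K: True
    then have fin: "finite K" using finite_subset by blast
    have "\<alpha> (K - {l}) l (p + 1 + (int n - int (card K))) (x (K - {l}) + y (K - {l})) =
        \<alpha> (K - {l}) l (p + 1 + (int n - int (card K))) (x (K - {l})) +
        \<alpha> (K - {l}) l (p + 1 + (int n - int (card K))) (y (K - {l}))" if l: "l \<in> K" for l
    proof (rule \<alpha>_a(2))
      have "K - {l} \<subseteq> {..<n}" "int n - int (card (K - {l})) = 1 + (int n - int (card K))"
        using K int_card_Diff_singleton[OF fin l] by auto
      then show "x (K - {l}) \<in> gr (A (K - {l})) (p + 1 + (int n - int (card K)))"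
        "y (K - {l}) \<in> gr (A (K - {l})) (p + 1 + (int n - int (card K)))"
        using xy unfolding T_gr by (metis add.assoc)+
    qed (use K l in auto)
    moreover have "dif (A K) (p + (int n - int (card K))) (x K + y K) =
      dif (A K) (p + (int n - int (card K))) (x K) + dif (A K) (p + (int n - int (card K))) (y K)"
      using xy K by (intro A_a) (auto simp: T_gr)
    ultimately show ?thesis
      using K by (simp add: T_dif sg_add sum.distrib add_ac)
  qed (simp add: T_dif_out)
qed

text \<open>Twice the internal differential is 0. The mixed terms cancel because the Koszul exponent
  \<open>n - card K\<close> changes by one along an edge. The terms with two edges cancel in pairs
  since the squares commute and the derivations \<open>\<partial>\<^sub>l\<close>
  anticommute.\<close>

lemma T_dd:
  assumes x: "x \<in> gr T p"
  shows "dif T (p + 1) (dif T p x) = 0"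
proof
  fix K
  show "dif T (p + 1) (dif T p x) K = 0 K"
  proof (cases "K \<subseteq> {..<n}")
    case K: True
    then have fin: "finite K" using finite_subset by blast
    define q where "q = p + (int n - int (card K))"
    define c where "c K l = int l - int (card {m \<in> K. m < l})" for K l
    have degK: "x K \<in> gr (A K) q"
      using x K by (simp add: T_gr q_def)
    have deg1: "x (K - {l}) \<in> gr (A (K - {l})) (q + 1)" if l: "l \<in> K" for l
    proof -
      have "K - {l} \<subseteq> {..<n}" "p + (int n - int (card (K - {l}))) = q + 1"
        using K int_card_Diff_singleton[OF fin l] by (auto simp: q_def)
      then show ?thesis using x unfolding T_gr by metis
    qed
    have deg2: "x (K - {l} - {m}) \<in> gr (A (K - {l} - {m})) (q + 2)" if "l \<in> K" "m \<in> K - {l}" for l m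
    proof -
      have "K - {l} - {m} \<subseteq> {..<n}" "p + (int n - int (card (K - {l} - {m}))) = q + 2"
        using K int_card_Diff_singleton[OF fin that(1)]
          int_card_Diff_singleton[of "K - {l}" m] fin that by (auto simp: q_def)
      then show ?thesis using x unfolding T_gr by metis
    qed
    define h where "h = (\<lambda>l m. sg (c K l + c (K - {l}) m)
      (\<alpha> (K - {l}) l (q + 2) (\<alpha> (K - {l} - {m}) m (q + 2) (x (K - {l} - {m})))))"
    have T1: "\<alpha> (K - {l}) l (q + 2) (dif T p x (K - {l})) =
        (\<Sum>m\<in>K - {l}. sg (c (K - {l}) m)
          (\<alpha> (K - {l}) l (q + 2) (\<alpha> (K - {l} - {m}) m (q + 2) (x (K - {l} - {m}))))) +
        sg (int n - int (card K) + 1) (dif (A K) (q + 1) (\<alpha> (K - {l}) l (q + 1) (x (K - {l}))))"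
      (is "_ = ?s + ?t") if l: "l \<in> K" for l
    proof -
      have Kl: "K - {l} \<subseteq> {..<n}" "insert l (K - {l}) \<subseteq> {..<n}" "insert l (K - {l}) = K"
        and k: "int n - int (card (K - {l})) = int n - int (card K) + 1"
        "p + 1 + (int n - int (card K) + 1) = q + 2" "p + (int n - int (card K) + 1) = q + 1"
        using K int_card_Diff_singleton[OF fin l] l by (auto simp: q_def)
      have \<alpha>m: "\<alpha> (K - {l} - {m}) m (q + 2) (x (K - {l} - {m})) \<in> gr (A (K - {l})) (q + 2)"
        if m: "m \<in> K - {l}" for m
      proof -
        have "insert m (K - {l} - {m}) = K - {l}" "m < n" using m K by auto
        with \<alpha>_in[OF _ deg2[OF l m], of m] Kl(1) show ?thesis by simp
      qed
      have dl: "dif (A (K - {l})) (q + 1) (x (K - {l})) \<in> gr (A (K - {l})) (q + 2)"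
        using A_in[OF Kl(1) deg1[OF l]] by (simp only: add.assoc one_add_one)
      have "\<alpha> (K - {l}) l (q + 2) (dif T p x (K - {l})) =
        (\<Sum>m\<in>K - {l}. sg (c (K - {l}) m)
          (\<alpha> (K - {l}) l (q + 2) (\<alpha> (K - {l} - {m}) m (q + 2) (x (K - {l} - {m}))))) +
        sg (int n - int (card K) + 1)
          (\<alpha> (K - {l}) l (q + 2) (dif (A (K - {l})) (q + 1) (x (K - {l}))))"
      proof -
        have sub: "subgroup_set (gr (A (K - {l})) (q + 2))"
          by (rule A_sub[OF Kl(1)])
        note s = subgroup_setD[OF sub] and a = \<alpha>_a[OF Kl(2)]
        have sgm: "sg (c (K - {l}) m) (\<alpha> (K - {l} - {m}) m (q + 2) (x (K - {l} - {m})))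
            \<in> gr (A (K - {l})) (q + 2)" if "m \<in> K - {l}" for m
          by (rule s(5)[OF \<alpha>m[OF that]])
        show ?thesis
          unfolding T_dif[OF Kl(1)] k c_def[symmetric]
          by (subst a(2)[OF subgroup_set_sum[OF sub sgm] s(5)[OF dl]], assumption,
              subst a(4)[OF sgm], assumption, subst a(3)[OF dl])
            (intro arg_cong2[of _ _ _ _ "(+)"] sum.cong refl a(3) \<alpha>m)
      qed
      also have "\<alpha> (K - {l}) l (q + 2) (dif (A (K - {l})) (q + 1) (x (K - {l}))) =
          dif (A K) (q + 1) (\<alpha> (K - {l}) l (q + 1) (x (K - {l})))"
        using \<alpha>_dif[OF Kl(2) deg1[OF l]] by (simp only: Kl(3) add.assoc one_add_one)
      finally show ?thesis .
    qed
    have \<alpha>l: "\<alpha> (K - {l}) l (q + 1) (x (K - {l})) \<in> gr (A K) (q + 1)" if l: "l \<in> K" for l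
      using \<alpha>_in[OF _ deg1[OF l], of l] K l by (simp add: insert_absorb)
    have dK: "dif (A K) q (x K) \<in> gr (A K) (q + 1)"
      using A_in[OF K degK] .
    note a = additive_onD[OF A_sub[OF K] A_add[OF K]] and s = subgroup_setD[OF A_sub[OF K]]
    have T2: "dif (A K) (q + 1) (dif T p x K) =
        (\<Sum>l\<in>K. sg (c K l) (dif (A K) (q + 1) (\<alpha> (K - {l}) l (q + 1) (x (K - {l})))))"
    proof -
      have e: "p + (int n - int (card K)) = q" "p + 1 + (int n - int (card K)) = q + 1"
        by (simp_all add: q_def)
      show ?thesis
        unfolding T_dif[OF K] e c_def[symmetric]
        using \<alpha>l dK A_dd[OF K degK]
        by (simp add: a s subgroup_set_sum[OF A_sub[OF K]] additive_on_sum[OF A_sub[OF K] A_add[OF K]]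
            cong: sum.cong)
    qed
    have h_antisym: "h l m = - h m l" if lm: "l \<in> K" "m \<in> K" "l \<noteq> m" for l m
    proof -
      have i: "insert m (K - {l} - {m}) = K - {l}" "insert l (K - {l} - {m}) = K - {m}"
        "K - {m} - {l} = K - {l} - {m}" "insert l (insert m (K - {l} - {m})) \<subseteq> {..<n}"
        using lm K by auto
      have "\<alpha> (K - {l}) l (q + 2) (\<alpha> (K - {l} - {m}) m (q + 2) (x (K - {l} - {m}))) =
          \<alpha> (K - {m}) m (q + 2) (\<alpha> (K - {m} - {l}) l (q + 2) (x (K - {m} - {l})))"
        using \<alpha>_comm[OF i(4) deg2] lm i by simp
      \<comment> \<open>Removing the smaller of the two indices first raises the exponent of the
        larger by one, while removing the larger first leaves that of the smaller unchanged.\<close>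
      moreover have "odd (c K l + c (K - {l}) m - (c K m + c (K - {m}) l))"
      proof -
        have c_less: "c (K - {a}) b = c K b + 1" if "a < b" "a \<in> K" for a b
        proof -
          have "{m \<in> K - {a}. m < b} = {m \<in> K. m < b} - {a}" by auto
          then show ?thesis
            using int_card_Diff_singleton[of "{m \<in> K. m < b}" a] fin that by (simp add: c_def)
        qed
        have c_greater: "c (K - {a}) b = c K b" if "b < a" for a b
        proof -
          have "{m \<in> K - {a}. m < b} = {m \<in> K. m < b}" using that by auto
          then show ?thesis by (simp add: c_def)
        qed
        show ?thesis
          using lm c_less c_greater by (cases "l < m") auto
      qed
      ultimately show ?thesis
        unfolding h_def by (simp add: sg_odd)
    qed
    have "dif T (p + 1) (dif T p x) K =
        (\<Sum>l\<in>K. sg (c K l) (\<alpha> (K - {l}) l (q + 2) (dif T p x (K - {l})))) +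
        sg (int n - int (card K)) (dif (A K) (q + 1) (dif T p x K))"
      unfolding T_dif[OF K, of "p + 1"] by (simp add: c_def q_def algebra_simps)
    also have "\<dots> = (\<Sum>l\<in>K. \<Sum>m\<in>K - {l}. h l m)"
      unfolding T2
      by (simp add: T1 sg_add sum.distrib sg_sum h_def add_ac cong: sum.cong)
         (auto simp: sg_def sum.distrib[symmetric] intro!: sum.neutral)
    also have "\<dots> = 0"
      using fin h_antisym by (rule sum_antisym_eq_0)
    finally show ?thesis by simp
  qed (simp add: T_dif_out)
qed

end

section \<open>Morphisms between the twisted complexes \<open>\<pi> A\<close>\<close>

lemma ul_less: "u < n \<Longrightarrow> ul n u < n"
  and ul_ul: "u < n \<Longrightarrow> ul n (ul n u) = u"
  and int_ul: "u < n \<Longrightarrow> int (ul n u) = int n - 1 - int u"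
  and ul_inject: "u < n \<Longrightarrow> v < n \<Longrightarrow> ul n u = ul n v \<longleftrightarrow> u = v"
  by (auto simp: ul_def)

lemma ul_less_iff: "u < n \<Longrightarrow> v < n \<Longrightarrow> ul n u < ul n v \<longleftrightarrow> v < u"
  by (auto simp: ul_def)

text \<open>Membership fixes the two ends of \<open>K\<close>. Together with
  \<open>Jset_Min_Max\<close> this says that the sets \<open>Jset u v\<close> partition the nonempty
  finite sets, so each nonempty \<open>K\<close> belongs to exactly one matrix entry.\<close>

lemma JsetD:
  assumes "K \<in> Jset u v"
  shows "u \<in> K" "v \<in> K" "K \<subseteq> {u..v}" "u \<le> v" "finite K" "K \<noteq> {}" "Min K = u" "Max K = v"
proof -
  show *: "u \<in> K" "v \<in> K" "K \<subseteq> {u..v}"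
    using assms by (auto simp: Jset_def)
  show fin: "finite K" using * finite_subset by blast
  show "u \<le> v" "K \<noteq> {}" using * by auto
  show "Min K = u" "Max K = v" using * fin by (auto intro!: Min_eqI Max_eqI)
qed

lemma Jset_subset: "K \<in> Jset u v \<Longrightarrow> v < n \<Longrightarrow> K \<subseteq> {..<n}"
  by (auto simp: Jset_def)

lemma Jset_Min_Max: "finite K \<Longrightarrow> K \<noteq> {} \<Longrightarrow> K \<in> Jset (Min K) (Max K)"
  by (auto simp: Jset_def)

lemma Jset_singleton: "{u} \<in> Jset u u"
  by (simp add: Jset_def)

lemma Jset_refl: "K \<in> Jset u u \<longleftrightarrow> K = {u}"
  by (auto simp: Jset_def)

lemma int_card_interval_Diff:
  "K \<in> Jset u v \<Longrightarrow> int (card ({u..v} - K)) = int v - int u + 1 - int (card K)"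
  using JsetD[of K u v] card_mono[of "{u..v}" K]
  by (simp add: card_Diff_subset of_nat_diff)

lemma
  assumes F: "dg_functor s t \<C> \<D> F" and "A \<in> Obj \<C>" "B \<in> Obj \<C>"
  shows dg_functor_linear: "linear_on s t (gr (Hom \<C> A B) p) (fmor F A B p)"
    and dg_functor_in: "f \<in> gr (Hom \<C> A B) p \<Longrightarrow> fmor F A B p f \<in> gr (Hom \<D> (fobj F A) (fobj F B)) p"
    and dg_functor_dif: "f \<in> gr (Hom \<C> A B) p \<Longrightarrow>
      fmor F A B (p + 1) (dif (Hom \<C> A B) p f) = dif (Hom \<D> (fobj F A) (fobj F B)) p (fmor F A B p f)"
    and dg_functor_cmp: "\<lbrakk>C \<in> Obj \<C>; g \<in> gr (Hom \<C> B C) p; f \<in> gr (Hom \<C> A B) q\<rbrakk> \<Longrightarrow>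
      fmor F A C (p + q) (cmp \<C> A B C p q g f) =
      cmp \<D> (fobj F A) (fobj F B) (fobj F C) p q (fmor F B C p g) (fmor F A B q f)"
    and dg_functor_idm: "fmor F A A 0 (idm \<C> A) = idm \<D> (fobj F A)"
  using assms unfolding dg_functor_def by blast+

text \<open>The predecessor \<open>w\<close> of \<open>v\<close> in \<open>K\<close> is the only
  element below \<open>v\<close> at which cutting \<open>K\<close> leaves a pair as upper part, and
  hence the only cut at which the upper factor can be a nonzero twist. \<open>Jset_first\<close> is
  the mirror image.\<close>

lemma Jset_last:
  assumes K: "K \<in> Jset u v" and "u < v" and w: "w = Max (K - {v})"
  shows "w \<in> K" "w < v" "K \<inter> {w..} = {w, v}" "K \<inter> {..w} = K - {v}" "K - {v} \<in> Jset u w"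
    "w' \<in> K \<Longrightarrow> w' < v \<Longrightarrow> K \<inter> {w'..} = {w', v} \<Longrightarrow> w' = w"
proof -
  note J = JsetD[OF K]
  have fin: "finite (K - {v})" "K - {v} \<noteq> {}" "u \<in> K - {v}" using J assms(2) by auto
  have w1: "w \<in> K - {v}" using Max_in[OF fin(1,2)] w by simp
  have le: "\<forall>x\<in>K. x = v \<or> x \<le> w" using Max_ge[OF fin(1)] w by blast
  have lv: "\<And>x. x \<in> K \<Longrightarrow> x \<le> v" and gu: "\<And>x. x \<in> K \<Longrightarrow> u \<le> x" using J by auto
  show wK: "w \<in> K" and wv: "w < v" using w1 lv[of w] by auto
  show "K \<inter> {w..} = {w, v}"
    using le wK wv J(2) by (auto intro: order_antisym)
  show "K \<inter> {..w} = K - {v}"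
    using le wv by auto
  show "K - {v} \<in> Jset u w"
  proof -
    have "K - {v} \<subseteq> {u..w}" using le gu by auto
    then show ?thesis unfolding Jset_def using w1 fin(3) by blast
  qed
  show "w' = w" if "w' \<in> K" "w' < v" "K \<inter> {w'..} = {w', v}"
    using that le wK wv by auto
qed

lemma Jset_first:
  assumes K: "K \<in> Jset u v" and "u < v" and w: "w = Min (K - {u})"
  shows "w \<in> K" "u < w" "K \<inter> {..w} = {u, w}" "K \<inter> {w..} = K - {u}" "K - {u} \<in> Jset w v"
    "w' \<in> K \<Longrightarrow> u < w' \<Longrightarrow> K \<inter> {..w'} = {u, w'} \<Longrightarrow> w' = w"
proof -
  note J = JsetD[OF K]
  have fin: "finite (K - {u})" "K - {u} \<noteq> {}" "v \<in> K - {u}" using J assms(2) by auto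
  have w1: "w \<in> K - {u}" using Min_in[OF fin(1,2)] w by simp
  have ge: "\<forall>x\<in>K. x = u \<or> w \<le> x" using Min_le[OF fin(1)] w by blast
  have lv: "\<And>x. x \<in> K \<Longrightarrow> x \<le> v" and gu: "\<And>x. x \<in> K \<Longrightarrow> u \<le> x" using J by auto
  show wK: "w \<in> K" and wv: "u < w" using w1 gu[of w] by auto
  show "K \<inter> {..w} = {u, w}"
    using ge wK wv J(1) by (auto intro: order_antisym)
  show "K \<inter> {w..} = K - {u}"
    using ge wv by auto
  show "K - {u} \<in> Jset w v"
  proof -
    have "K - {u} \<subseteq> {w..v}" using ge lv by auto
    then show ?thesis unfolding Jset_def using w1 fin(3) by blast
  qed
  show "w' = w" if "w' \<in> K" "u < w'" "K \<inter> {..w'} = {u, w'}"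
    using that ge wK wv by auto
qed

lemma sum_fun_apply: "sum f S x = (\<Sum>i\<in>S. f i x)"
  for f :: "'a \<Rightarrow> 'b \<Rightarrow> 'c::ab_group_add"
  by (induction S rule: infinite_finite_induct) auto

text \<open>The differential at \<open>K\<close> uses an edge only from \<open>K - {l}\<close> to
  \<open>K\<close> with both sets in \<open>J\<close>. Agreement on those edges gives equality of
  the whole records, including values outside the graded pieces.\<close>

lemma ext_cplx_cong:
  assumes "\<And>I. I \<in> J \<Longrightarrow> C I = C' I" "\<And>I l p x. I \<in> J \<Longrightarrow> insert l I \<in> J \<Longrightarrow> \<beta> I l p x = \<beta>' I l p x"
  shows "ext_cplx U J C \<beta> = ext_cplx U J C' \<beta>'"
proof -
  have "(\<lambda>p x K. if K \<in> J then
          (\<Sum>l\<in>{l\<in>K. K - {l} \<in> J}.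
             let I = K - {l} in
             sg (del_exp l (U - I)) (\<beta> I l (p + int (card (U - I))) (x I)))
          + sg (int (card (U - K))) (dif (C K) (p + int (card (U - K))) (x K))
        else 0) = (\<lambda>p x K. if K \<in> J then
          (\<Sum>l\<in>{l\<in>K. K - {l} \<in> J}.
             let I = K - {l} in
             sg (del_exp l (U - I)) (\<beta>' I l (p + int (card (U - I))) (x I)))
          + sg (int (card (U - K))) (dif (C' K) (p + int (card (U - K))) (x K))
        else 0)"
    using assms by (intro ext if_cong arg_cong2[of _ _ _ _ "(+)"] sum.cong) (auto simp: Let_def insert_absorb)
  then show ?thesis
    unfolding ext_cplx_def using assms(1) by auto
qed

section \<open>The cube of Hom complexes between two objects of \<open>cat Q {}\<close>\<close>

context dg_hypercube
begin

abbreviation "Ob \<equiv> Obj (cat Q {})"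

text \<open>All objects in the image of \<open>\<pi>\<close> are built from images of objects of
  \<open>cat Q {}\<close>. Naming them by their origin removes intermediate indices: by
  functoriality every chain of transition functors reaching \<open>I\<close> gives the same
  \<open>V A I\<close>.\<close>

definition V :: "'o \<Rightarrow> nat set \<Rightarrow> 'o"
  where "V A I = fobj (tr Q {} I) A"

definition H :: "'o \<Rightarrow> 'o \<Rightarrow> nat set \<Rightarrow> 'm cplx"
  where "H A B I = Hom (cat Q I) (V A I) (V B I)"

definition F :: "'o \<Rightarrow> 'o \<Rightarrow> nat set \<Rightarrow> nat set \<Rightarrow> int \<Rightarrow> 'm \<Rightarrow> 'm"
  where "F A B I K = fmor (tr Q I K) (V A I) (V B I)"

definition \<alpha> :: "'o \<Rightarrow> 'o \<Rightarrow> nat set \<Rightarrow> nat \<Rightarrow> int \<Rightarrow> 'm \<Rightarrow> 'm"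
  where "\<alpha> A B I l = F A B I (insert l I)"

definition vcmp :: "'o \<Rightarrow> 'o \<Rightarrow> 'o \<Rightarrow> nat set \<Rightarrow> int \<Rightarrow> int \<Rightarrow> 'm \<Rightarrow> 'm \<Rightarrow> 'm"
  where "vcmp A B C I = cmp (cat Q I) (V A I) (V B I) (V C I)"

definition unit :: "'o \<Rightarrow> nat set \<Rightarrow> 'm"
  where "unit A I = idm (cat Q I) (V A I)"

lemma V_empty: "A \<in> Ob \<Longrightarrow> V A {} = A"
  by (simp add: V_def tr_id_obj)

lemma V_obj: "A \<in> Ob \<Longrightarrow> I \<subseteq> {..<n} \<Longrightarrow> V A I \<in> Obj (cat Q I)"
  using tr_dg[of "{}" I] by (simp add: V_def dg_functor_def)

lemma tr_V: "A \<in> Ob \<Longrightarrow> I \<subseteq> K \<Longrightarrow> K \<subseteq> {..<n} \<Longrightarrow> fobj (tr Q I K) (V A I) = V A K"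
  using tr_tr_obj[of "{}" I K A] by (simp add: V_def)

lemma H_complex: "\<lbrakk>A \<in> Ob; B \<in> Ob; I \<subseteq> {..<n}\<rbrakk> \<Longrightarrow> cochain_complex s (H A B I)"
  unfolding H_def by (intro dg_category.Hom_complex[OF cat_dg] V_obj)

lemma H_sub:
  assumes "A \<in> Ob" "B \<in> Ob" "I \<subseteq> {..<n}"
  shows "subgroup_set (gr (H A B I) p)"
proof -
  interpret cochain_complex s "H A B I" using H_complex[OF assms] .
  show ?thesis
    using gr_subspace[of p] unfolding subgroup_set_def
    by (auto simp: subspace_0 subspace_add subspace_neg)
qed

lemma H_add: "\<lbrakk>A \<in> Ob; B \<in> Ob; I \<subseteq> {..<n}\<rbrakk> \<Longrightarrow> additive_on (gr (H A B I) p) (dif (H A B I) p)"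
  by (rule linear_on_additive[OF cochain_complex.dif_linear[OF H_complex]])

lemma H_in:
  "\<lbrakk>A \<in> Ob; B \<in> Ob; I \<subseteq> {..<n}; x \<in> gr (H A B I) p\<rbrakk> \<Longrightarrow> dif (H A B I) p x \<in> gr (H A B I) (p + 1)"
  using cochain_complex.dif_in[OF H_complex] by blast

lemma H_dd:
  "\<lbrakk>A \<in> Ob; B \<in> Ob; I \<subseteq> {..<n}; x \<in> gr (H A B I) p\<rbrakk> \<Longrightarrow> dif (H A B I) (p + 1) (dif (H A B I) p x) = 0"
  using cochain_complex.dif_dif[OF H_complex] by blast

lemma
  assumes "A \<in> Ob" "B \<in> Ob" "I \<subseteq> K" "K \<subseteq> {..<n}"
  shows F_linear: "linear_on s s (gr (H A B I) p) (F A B I K p)"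
    and F_in: "x \<in> gr (H A B I) p \<Longrightarrow> F A B I K p x \<in> gr (H A B K) p"
    and F_dif: "x \<in> gr (H A B I) p \<Longrightarrow> F A B I K (p + 1) (dif (H A B I) p x) = dif (H A B K) p (F A B I K p x)"
    and F_add: "additive_on (gr (H A B I) p) (F A B I K p)"
proof -
  have "V A I \<in> Obj (cat Q I)" "V B I \<in> Obj (cat Q I)"
    using assms V_obj by (meson subset_trans)+
  note D = this
  have tr: "dg_functor s s (cat Q I) (cat Q K) (tr Q I K)"
    using assms by (intro tr_dg)
  note tr_VA = tr_V[OF assms(1,3,4)] and tr_VB = tr_V[OF assms(2-4)]
  show "linear_on s s (gr (H A B I) p) (F A B I K p)"
    "x \<in> gr (H A B I) p \<Longrightarrow> F A B I K p x \<in> gr (H A B K) p"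
    "x \<in> gr (H A B I) p \<Longrightarrow> F A B I K (p + 1) (dif (H A B I) p x) = dif (H A B K) p (F A B I K p x)"
    using dg_functor_linear[OF tr D, of p] dg_functor_in[OF tr D, of x p] dg_functor_dif[OF tr D, of x p]
    by (simp_all add: H_def F_def tr_VA tr_VB)
  then show "additive_on (gr (H A B I) p) (F A B I K p)"
    using linear_on_additive by blast
qed

lemma F_F:
  assumes "A \<in> Ob" "B \<in> Ob" "I \<subseteq> K" "K \<subseteq> L" "L \<subseteq> {..<n}" "x \<in> gr (H A B I) p"
  shows "F A B K L p (F A B I K p x) = F A B I L p x"
proof -
  have "V A I \<in> Obj (cat Q I)" "V B I \<in> Obj (cat Q I)"
    "fobj (tr Q I K) (V A I) = V A K" "fobj (tr Q I K) (V B I) = V B K"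
    using assms V_obj tr_V by (meson subset_trans)+
  then show ?thesis
    using tr_tr_mor[OF assms(3-5), of "V A I" "V B I" x p] assms(6) by (simp add: F_def H_def)
qed

lemma F_id: "\<lbrakk>A \<in> Ob; B \<in> Ob; I \<subseteq> {..<n}; x \<in> gr (H A B I) p\<rbrakk> \<Longrightarrow> F A B I I p x = x"
  unfolding F_def H_def by (intro tr_id_mor V_obj)

lemma F_vcmp:
  assumes "A \<in> Ob" "B \<in> Ob" "C \<in> Ob" "I \<subseteq> K" "K \<subseteq> {..<n}" "g \<in> gr (H B C I) p" "f \<in> gr (H A B I) q"
  shows "F A C I K (p + q) (vcmp A B C I p q g f) = vcmp A B C K p q (F B C I K p g) (F A B I K q f)"
proof -
  have "V A I \<in> Obj (cat Q I)" "V B I \<in> Obj (cat Q I)" "V C I \<in> Obj (cat Q I)"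
    using assms V_obj by (meson subset_trans)+
  then show ?thesis
    using dg_functor_cmp[OF tr_dg[OF assms(4,5)], of "V A I" "V B I" "V C I" g p f q] assms(6,7)
    by (simp add: H_def F_def vcmp_def tr_V[OF assms(1,4,5)] tr_V[OF assms(2,4,5)] tr_V[OF assms(3-5)])
qed

lemma F_unit:
  assumes "A \<in> Ob" "I \<subseteq> K" "K \<subseteq> {..<n}"
  shows "F A A I K 0 (unit A I) = unit A K"
proof -
  have "V A I \<in> Obj (cat Q I)"
    using assms V_obj by (meson subset_trans)
  then show ?thesis
    using dg_functor_idm[OF tr_dg[OF assms(2,3)], of "V A I"] by (simp add: F_def unit_def tr_V[OF assms])
qed

lemma unit_in: "A \<in> Ob \<Longrightarrow> I \<subseteq> {..<n} \<Longrightarrow> unit A I \<in> gr (H A A I) 0"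
  unfolding unit_def H_def by (intro dg_category.idm_in[OF cat_dg] V_obj)

lemma
  assumes "A \<in> Ob" "B \<in> Ob" "I \<subseteq> {..<n}" "f \<in> gr (H A B I) p"
  shows unit_left: "vcmp A B B I 0 p (unit B I) f = f"
    and unit_right: "vcmp A A B I p 0 f (unit A I) = f"
  using assms unfolding unit_def H_def vcmp_def
  by (intro dg_category.idm_left[OF cat_dg] dg_category.idm_right[OF cat_dg] V_obj; simp)+

lemma
  assumes "A \<in> Ob" "B \<in> Ob" "C \<in> Ob" "I \<subseteq> {..<n}"
  shows vcmp_add_left: "f \<in> gr (H A B I) q \<Longrightarrow> additive_on (gr (H B C I) p) (\<lambda>g. vcmp A B C I p q g f)"
    and vcmp_add_right: "g \<in> gr (H B C I) p \<Longrightarrow> additive_on (gr (H A B I) q) (\<lambda>f. vcmp A B C I p q g f)"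
  using assms unfolding H_def vcmp_def
  by (auto intro!: V_obj
      linear_on_additive[OF dg_category.cmp_linear_left[OF cat_dg]]
      linear_on_additive[OF dg_category.cmp_linear_right[OF cat_dg]])

text \<open>The Leibniz rule for the square of the unit gives \<open>d 1 = d 1 + d 1\<close>. Closed
  units are what the Maurer-Cartan equation needs on two-element sets.\<close>

lemma unit_dif:
  assumes "A \<in> Ob" "I \<subseteq> {..<n}"
  shows "dif (H A A I) 0 (unit A I) = 0"
proof -
  let ?d = "dif (H A A I) 0 (unit A I)"
  have d: "?d \<in> gr (H A A I) 1"
    using H_in[OF assms(1,1,2) unit_in[OF assms]] by simp
  have "dif (H A A I) (0 + 0) (vcmp A A A I 0 0 (unit A I) (unit A I)) =
      vcmp A A A I (0 + 1) 0 ?d (unit A I) + sg 0 (vcmp A A A I 0 (0 + 1) (unit A I) ?d)"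
    unfolding unit_def H_def vcmp_def
    using assms dg_category.idm_in[OF cat_dg[OF assms(2)] V_obj[OF assms]]
    by (intro dg_category.leibniz[OF cat_dg] V_obj)
  then have "?d = ?d + ?d"
    using unit_left[OF assms(1,1,2) d] unit_right[OF assms(1,1,2) d]
      unit_left[OF assms(1,1,2) unit_in[OF assms]] by simp
  then show ?thesis by simp
qed

lemma cube: "A \<in> Ob \<Longrightarrow> B \<in> Ob \<Longrightarrow> cplx_cube n (H A B) (\<alpha> A B)"
proof
  fix l m I p x
  assume *: "A \<in> Ob" "B \<in> Ob" "insert l (insert m I) \<subseteq> {..<n}" "x \<in> gr (H A B I) p"
  have "F A B (insert m I) (insert l (insert m I)) p (F A B I (insert m I) p x) =
      F A B (insert l I) (insert l (insert m I)) p (F A B I (insert l I) p x)"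
    using * by (subst (1 2) F_F) auto
  then show "\<alpha> A B (insert m I) l p (\<alpha> A B I m p x) = \<alpha> A B (insert l I) m p (\<alpha> A B I l p x)"
    by (simp add: \<alpha>_def insert_commute)
qed (auto simp: \<alpha>_def intro!: H_sub H_add H_in H_dd F_add F_in F_dif)

section \<open>The gluing category on objects coming from \<open>cat Q {}\<close>\<close>

lemma gac_Hom_V:
  assumes "A \<in> Ob" "B \<in> Ob" "u < n" "v < n"
  shows "gac_Hom Q (u, V A {u}) (v, V B {v}) = ext_cplx {u..v} (Jset u v) (H A B) (\<alpha> A B)"
proof -
  have *: "fobj (tr Q {u} I) (V A {u}) = V A I" "fobj (tr Q {v} I) (V B {v}) = V B I"
    if "I \<in> Jset u v" for I
    using assms tr_V Jset_subset[OF that assms(4)] JsetD[OF that] by auto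
  show ?thesis
    unfolding gac_Hom_def prod.case
    by (rule ext_cplx_cong) (auto simp: * H_def \<alpha>_def F_def)
qed

lemma gac_gr:
  assumes "A \<in> Ob" "B \<in> Ob" "u < n" "v < n"
  shows "x \<in> gr (gac_Hom Q (u, V A {u}) (v, V B {v})) p \<longleftrightarrow>
    (\<forall>I. if I \<in> Jset u v then x I \<in> gr (H A B I) (p + (int v - int u + 1 - int (card I))) else x I = 0)"
  unfolding gac_Hom_V[OF assms] by (auto simp: ext_cplx_def int_card_interval_Diff)

lemma gac_dif_out:
  assumes "A \<in> Ob" "B \<in> Ob" "u < n" "v < n" "K \<notin> Jset u v"
  shows "dif (gac_Hom Q (u, V A {u}) (v, V B {v})) p x K = 0"
  unfolding gac_Hom_V[OF assms(1-4)] using assms(5) by (simp add: ext_cplx_def)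

text \<open>Only interior \<open>l\<close> occur, since \<open>K - {l}\<close> must keep the ends of
  \<open>K\<close>. The constant 2 under the edge maps, against 1 in the last term, accounts for the
  extra variable at \<open>K - {l}\<close>.\<close>

lemma gac_dif:
  assumes "A \<in> Ob" "B \<in> Ob" "u < n" "v < n" "K \<in> Jset u v"
  shows "dif (gac_Hom Q (u, V A {u}) (v, V B {v})) p x K =
    (\<Sum>l\<in>K - {u, v}. sg (int l - int u - int (card {m \<in> K. m < l}))
      (\<alpha> A B (K - {l}) l (p + (int v - int u + 2 - int (card K))) (x (K - {l})))) +
    sg (int v - int u + 1 - int (card K)) (dif (H A B K) (p + (int v - int u + 1 - int (card K))) (x K))"
proof -
  note K = JsetD[OF assms(5)]
  have set: "{l \<in> K. K - {l} \<in> Jset u v} = K - {u, v}"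
    using K by (auto simp: Jset_def)
  have "del_exp l ({u..v} - (K - {l})) = int l - int u - int (card {m \<in> K. m < l})"
    if "l \<in> K - {u, v}" for l
    using del_exp_interval_Diff[of K u "Suc v" l] K(3) that by (simp add: atLeastLessThanSuc_atLeastAtMost)
  moreover have "p + int (card ({u..v} - (K - {l}))) = p + (int v - int u + 2 - int (card K))"
    if l: "l \<in> K - {u, v}" for l
  proof -
    have "K - {l} \<in> Jset u v" "l \<in> K" using l K by (auto simp: Jset_def)
    then show ?thesis
      by (simp only: int_card_interval_Diff int_card_Diff_singleton[OF K(5)])
  qed
  ultimately have "(\<Sum>l\<in>K - {u, v}. sg (del_exp l ({u..v} - (K - {l})))
      (\<alpha> A B (K - {l}) l (p + int (card ({u..v} - (K - {l})))) (x (K - {l})))) =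
    (\<Sum>l\<in>K - {u, v}. sg (int l - int u - int (card {m \<in> K. m < l}))
      (\<alpha> A B (K - {l}) l (p + (int v - int u + 2 - int (card K))) (x (K - {l}))))"
    by (intro sum.cong) (simp_all only:)
  then show ?thesis
    unfolding gac_Hom_V[OF assms(1-4)] using assms(5)
    by (simp add: ext_cplx_def set int_card_interval_Diff Let_def)
qed

text \<open>Sets with ends \<open>u, w\<close> and \<open>w, v\<close> meet only in
  \<open>w\<close>, so \<open>K\<close> has at most one such decomposition, its cut at
  \<open>w\<close>. The degrees \<open>p + w - v\<close> and \<open>q + u - w\<close> are those that
  entries of matrices of degrees \<open>p\<close> and \<open>q\<close> acquire from the shifts in
  \<open>\<pi>\<close>.\<close>

lemma gac_cmp_V:
  assumes "A \<in> Ob" "B \<in> Ob" "C \<in> Ob" "u < n" "w < n" "v < n"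
  shows "gac_cmp Q (u, V A {u}) (w, V B {w}) (v, V C {v}) (p + int w - int v) (q + int u - int w) y x K =
    (if K \<in> Jset u v \<and> w \<in> K then
      sg ((p + int w - int v) * (int w - int u + 1 - int (card (K \<inter> {..w}))))
       (vcmp A B C K (p + 1 - int (card (K \<inter> {w..}))) (q + 1 - int (card (K \<inter> {..w})))
         (F B C (K \<inter> {w..}) K (p + 1 - int (card (K \<inter> {w..}))) (y (K \<inter> {w..})))
         (F A B (K \<inter> {..w}) K (q + 1 - int (card (K \<inter> {..w}))) (x (K \<inter> {..w}))))
     else 0)"
proof -
  let ?S = "{(L, I). L \<in> Jset w v \<and> I \<in> Jset u w \<and> I \<union> L = K}"
  show ?thesis
  proof (cases "K \<in> Jset u v \<and> w \<in> K")
    case True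
    define L I where "L = K \<inter> {w..}" and "I = K \<inter> {..w}"
    note K = JsetD[OF conjunct1[OF True]]
    have uniq: "I' = I \<and> L' = L" if "L' \<in> Jset w v" "I' \<in> Jset u w" "I' \<union> L' = K" for L' I'
    proof -
      have "w \<in> L'" "\<forall>x\<in>L'. w \<le> x" "w \<in> I'" "\<forall>x\<in>I'. x \<le> w"
        using that by (auto simp: Jset_def)
      then have "x \<in> I' \<longleftrightarrow> x \<in> K \<and> x \<le> w" "x \<in> L' \<longleftrightarrow> x \<in> K \<and> w \<le> x" for x
        using that(3) by (metis Un_iff order_antisym)+
      then show ?thesis unfolding I_def L_def by auto
    qed
    have LI: "L \<in> Jset w v" "I \<in> Jset u w" "I \<union> L = K"
    proof -
      have "w \<in> K" "u \<le> w" "w \<le> v" using True K by auto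
      then show "L \<in> Jset w v" "I \<in> Jset u w"
        using K(1-3) unfolding Jset_def I_def L_def by (auto dest: subsetD)
      show "I \<union> L = K" unfolding I_def L_def by (simp only: Int_Un_distrib[symmetric]) (auto simp: set_eq_iff)
    qed
    have S: "?S = {(L, I)}"
    proof (intro equalityI subsetI)
      fix z assume "z \<in> ?S"
      then show "z \<in> {(L, I)}" using uniq by (cases z) (simp only: mem_Collect_eq prod.case, blast)
    qed (use LI in blast)
    have KU: "K \<subseteq> {..<n}" using Jset_subset True assms by blast
    have LK: "L \<subseteq> K" "I \<subseteq> K" using LI by auto
    have objK: "fobj (tr Q {u} K) (V A {u}) = V A K" "fobj (tr Q {w} K) (V B {w}) = V B K"
      "fobj (tr Q {v} K) (V C {v}) = V C K"
      using K True KU assms by (auto intro!: tr_V)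
    have objL: "fobj (tr Q {w} L) (V B {w}) = V B L" "fobj (tr Q {v} L) (V C {v}) = V C L"
      using JsetD[OF LI(1)] KU LK assms by (auto intro!: tr_V)
    have objI: "fobj (tr Q {u} I) (V A {u}) = V A I" "fobj (tr Q {w} I) (V B {w}) = V B I"
      using JsetD[OF LI(2)] KU LK assms by (auto intro!: tr_V)
    have cards: "int (card ({w..v} - L)) = int v - int w + 1 - int (card L)"
      "int (card ({u..w} - I)) = int w - int u + 1 - int (card I)"
      using LI by (simp_all add: int_card_interval_Diff)
    have mul: "mul_exp ({w..v} - L) ({u..w} - I) =
        (int v - int w + 1 - int (card L)) * (int w - int u + 1 - int (card I))"
    proof -
      have "{u..w} - I \<subseteq> {..<w}"
      proof
        fix x assume "x \<in> {u..w} - I"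
        then show "x \<in> {..<w}" using JsetD(2)[OF LI(2)] by (cases "x = w") auto
      qed
      then show ?thesis
        by (subst mul_exp_separated[where w = w]) (auto simp: cards)
    qed
    have deg: "p + int w - int v + (int v - int w + 1 - int (card L)) = p + 1 - int (card L)"
      "q + int u - int w + (int w - int u + 1 - int (card I)) = q + 1 - int (card I)" by simp_all
    \<comment> \<open>Let \<open>T\<close> and \<open>S\<close> be the variables of the left and
      right factor. The internal degree of the left factor is its total degree plus
      \<open>card T\<close>, and this extra term, multiplied by \<open>card S\<close>, cancels
      against the sign of the product of the monomials.\<close>
    have "even ((p + 1 - int (card L)) * (int w - int u + 1 - int (card I)) +
        (int v - int w + 1 - int (card L)) * (int w - int u + 1 - int (card I)) -
        (p + int w - int v) * (int w - int u + 1 - int (card I)))"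
      by (simp add: even_add even_diff even_mult_iff) blast
    note sign = sg_cong[OF this]
    have "gac_cmp Q (u, V A {u}) (w, V B {w}) (v, V C {v}) (p + int w - int v) (q + int u - int w) y x K =
        sg ((p + int w - int v) * (int w - int u + 1 - int (card I)))
         (vcmp A B C K (p + 1 - int (card L)) (q + 1 - int (card I))
           (F B C L K (p + 1 - int (card L)) (y L)) (F A B I K (q + 1 - int (card I)) (x I)))"
      unfolding gac_cmp_def prod.case S
      by (simp add: Let_def cards deg mul objK objL objI sign flip: F_def vcmp_def)
    then show ?thesis using True by (simp add: L_def I_def)
  next
    case False
    have S: "?S = {}"
    proof -
      have "K \<in> Jset u v \<and> w \<in> K" if "L \<in> Jset w v" "I \<in> Jset u w" "I \<union> L = K" for L I
      proof -
        have "L \<subseteq> {w..v}" "I \<subseteq> {u..w}" "u \<in> I" "w \<in> I" "v \<in> L" "u \<le> w" "w \<le> v"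
          using JsetD[OF that(1)] JsetD[OF that(2)] by auto
        moreover from this have "{w..v} \<subseteq> {u..v}" "{u..w} \<subseteq> {u..v}" by auto
        ultimately show ?thesis unfolding Jset_def that(3)[symmetric] by blast
      qed
      then show ?thesis using False by auto
    qed
    show ?thesis unfolding gac_cmp_def prod.case S if_not_P[OF False] by (rule sum.empty)
  qed
qed

section \<open>Matrices between the sums underlying \<open>\<pi> A\<close> and
  \<open>\<pi> B\<close>, entry by entry\<close>

definition objs :: "'o \<Rightarrow> (nat \<times> 'o) fsum"
  where "objs A = map (\<lambda>i. ((ul n i, V A {ul n i}), int i)) [0..<n]"

abbreviation M :: "'o \<Rightarrow> 'o \<Rightarrow> int \<Rightarrow> (nat set \<Rightarrow> 'm) mat set"
  where "M A B \<equiv> mat_gr (Gac n Q) (objs A) (objs B)"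

text \<open>Entries are addressed by the subscripts of their source \<open>V\<^sub>u A\<close> and
  target \<open>V\<^sub>v B\<close>, in this order, instead of by row and column, which run against
  the subscripts.\<close>

definition ent :: "(nat set \<Rightarrow> 'm) mat \<Rightarrow> nat \<Rightarrow> nat \<Rightarrow> nat set \<Rightarrow> 'm"
  where "ent f u v K = f (ul n v) (ul n u) K"

lemma ent_simps [simp]:
  "ent 0 u v K = 0" "ent (f + g) u v K = ent f u v K + ent g u v K" "ent (- f) u v K = - ent f u v K"
  "ent (f - g) u v K = ent f u v K - ent g u v K" "ent (sg e f) u v K = sg e (ent f u v K)"
  by (simp_all add: ent_def sg_fun_apply)

lemma objs_simps: "length (objs A) = n" "u < n \<Longrightarrow> objs A ! ul n u = ((u, V A {u}), int n - 1 - int u)"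
  by (auto simp: objs_def ul_less ul_ul int_ul)

lemma all_ul_iff: "(\<forall>i<n. \<forall>j<n. P i j) \<longleftrightarrow> (\<forall>v<n. \<forall>u<n. P (ul n v) (ul n u))"
  by (metis ul_less ul_ul)

lemma pi_obj: "fobj (pi_functor n Q) A = (objs A, pi_twist n Q A)"
  by (simp add: pi_functor_def objs_def V_def)

lemma Gac_Hom: "Hom (Gac n Q) = gac_Hom Q" and Gac_cmp: "cmp (Gac n Q) = gac_cmp Q"
  by (simp_all add: Gac_def)

text \<open>The shifts contribute \<open>u - v\<close> to the degree of an entry and the variables
  contribute \<open>v - u + 1 - card K\<close>, so the ends cancel.\<close>

lemma M_iff:
  assumes "A \<in> Ob" "B \<in> Ob"
  shows "f \<in> M A B p \<longleftrightarrow>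
    (\<forall>u<n. \<forall>v<n. \<forall>K. if K \<in> Jset u v then ent f u v K \<in> gr (H A B K) (p + 1 - int (card K))
      else ent f u v K = 0) \<and>
    (\<forall>i j. \<not> (i < n \<and> j < n) \<longrightarrow> f i j = 0)"
proof -
  have "f \<in> M A B p \<longleftrightarrow> (\<forall>i<n. \<forall>j<n. f i j \<in> gr (Hom (Gac n Q) (fst (objs A ! j)) (fst (objs B ! i)))
      (p + snd (objs B ! i) - snd (objs A ! j))) \<and> (\<forall>i j. \<not> (i < n \<and> j < n) \<longrightarrow> f i j = 0)"
    unfolding mat_gr_def by (auto simp: objs_simps)
  also have "\<dots> \<longleftrightarrow> (\<forall>v<n. \<forall>u<n. f (ul n v) (ul n u) \<in> gr (gac_Hom Q (u, V A {u}) (v, V B {v}))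
      (p + (int u - int v))) \<and> (\<forall>i j. \<not> (i < n \<and> j < n) \<longrightarrow> f i j = 0)"
    by (subst all_ul_iff) (auto simp: objs_simps add_diff_eq Gac_Hom)
  also have "\<dots> \<longleftrightarrow> (\<forall>u<n. \<forall>v<n. \<forall>K. if K \<in> Jset u v then ent f u v K \<in> gr (H A B K) (p + 1 - int (card K))
      else ent f u v K = 0) \<and> (\<forall>i j. \<not> (i < n \<and> j < n) \<longrightarrow> f i j = 0)"
    by (auto simp: gac_gr assms ent_def add_diff_eq cong: if_cong)
  finally show ?thesis .
qed

lemma M_D:
  assumes "f \<in> M A B p" "A \<in> Ob" "B \<in> Ob"
  shows "\<lbrakk>K \<in> Jset u v; u < n; v < n\<rbrakk> \<Longrightarrow> ent f u v K \<in> gr (H A B K) (p + 1 - int (card K))"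
    "\<lbrakk>K \<notin> Jset u v; u < n; v < n\<rbrakk> \<Longrightarrow> ent f u v K = 0"
    "\<not> (i < n \<and> j < n) \<Longrightarrow> f i j = 0"
  using assms(1) unfolding M_iff[OF assms(2,3)] by metis+

lemma M_sub: "A \<in> Ob \<Longrightarrow> B \<in> Ob \<Longrightarrow> subgroup_set (M A B p)"
  unfolding subgroup_set_def by (auto simp: M_iff subgroup_setD[OF H_sub] Jset_subset split: if_splits)

lemma mat_eqI:
  assumes "\<And>u v K. u < n \<Longrightarrow> v < n \<Longrightarrow> ent f u v K = ent g u v K"
    and "\<And>i j. \<not> (i < n \<and> j < n) \<Longrightarrow> f i j = g i j"
  shows "f = g"
proof (intro ext)
  fix i j K
  show "f i j K = g i j K"
  proof (cases "i < n \<and> j < n")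
    case True
    then show ?thesis
      using assms(1)[of "ul n j" "ul n i" K] by (simp add: ent_def ul_less ul_ul)
  qed (simp add: assms(2))
qed

lemma ent_mat_dif:
  assumes "A \<in> Ob" "B \<in> Ob" "u < n" "v < n"
  shows "ent (mat_dif (Gac n Q) (objs A) (objs B) p f) u v K =
    (if K \<in> Jset u v then sg (int n - 1 - int v)
      ((\<Sum>l\<in>K - {u, v}. sg (int l - int u - int (card {m \<in> K. m < l}))
        (\<alpha> A B (K - {l}) l (p + 2 - int (card K)) (ent f u v (K - {l})))) +
       sg (int v - int u + 1 - int (card K)) (dif (H A B K) (p + 1 - int (card K)) (ent f u v K)))
     else 0)"
proof (cases "K \<in> Jset u v")
  case True
  have deg: "p + (int n - 1 - int v) - (int n - 1 - int u) + (int v - int u + c - int (card K)) =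
      p + c - int (card K)" for c
    by simp
  show ?thesis
    using True gac_dif[OF assms True]
    unfolding ent_def mat_dif_def Gac_Hom by (simp only: objs_simps ul_less assms deg sg_fun_apply fst_conv snd_conv simp_thms if_True)
next
  case False
  then show ?thesis
    using gac_dif_out[OF assms False] assms
    unfolding ent_def mat_dif_def Gac_Hom by (simp add: objs_simps ul_less sg_fun_apply)
qed

text \<open>A summand through the intermediate object \<open>w\<close> survives only if
  \<open>w \<in> K\<close>, because both factors have \<open>w\<close> as an end. Each term is thus
  a cut of \<open>K\<close> at one of its elements.\<close>

lemma ent_mat_cmp:
  assumes "A \<in> Ob" "B \<in> Ob" "C \<in> Ob" "u < n" "v < n"
  shows "ent (mat_cmp (Gac n Q) (objs A) (objs B) (objs C) p q g f) u v K =
    (if K \<in> Jset u v then \<Sum>w\<in>K.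
      sg ((p + int w - int v) * (int w - int u + 1 - int (card (K \<inter> {..w}))))
       (vcmp A B C K (p + 1 - int (card (K \<inter> {w..}))) (q + 1 - int (card (K \<inter> {..w})))
         (F B C (K \<inter> {w..}) K (p + 1 - int (card (K \<inter> {w..}))) (ent g w v (K \<inter> {w..})))
         (F A B (K \<inter> {..w}) K (q + 1 - int (card (K \<inter> {..w}))) (ent f u w (K \<inter> {..w}))))
     else 0)" (is "_ = (if _ then \<Sum>w\<in>K. ?t w else 0)")
proof -
  have "ent (mat_cmp (Gac n Q) (objs A) (objs B) (objs C) p q g f) u v K =
    (\<Sum>j<n. gac_cmp Q (fst (objs A ! ul n u)) (fst (objs B ! j)) (fst (objs C ! ul n v))
      (p + snd (objs C ! ul n v) - snd (objs B ! j)) (q + snd (objs B ! j) - snd (objs A ! ul n u))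
      (g (ul n v) j) (f j (ul n u)) K)"
    using assms by (simp add: ent_def mat_cmp_def objs_simps Gac_cmp ul_less sum_fun_apply)
  also have "\<dots> = (\<Sum>w<n. gac_cmp Q (fst (objs A ! ul n u)) (fst (objs B ! ul n w)) (fst (objs C ! ul n v))
      (p + snd (objs C ! ul n v) - snd (objs B ! ul n w)) (q + snd (objs B ! ul n w) - snd (objs A ! ul n u))
      (g (ul n v) (ul n w)) (f (ul n w) (ul n u)) K)"
    by (rule sum.reindex_bij_witness[of _ "ul n" "ul n"]) (auto simp: ul_less ul_ul)
  also have "\<dots> = (\<Sum>w<n. if K \<in> Jset u v \<and> w \<in> K then ?t w else 0)"
  proof (rule sum.cong[OF refl])
    fix w assume "w \<in> {..<n}"
    then have w: "w < n" by simp
    have "p + (int n - 1 - int v) - (int n - 1 - int w) = p + int w - int v"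
      "q + (int n - 1 - int w) - (int n - 1 - int u) = q + int u - int w" by simp_all
    then show "gac_cmp Q (fst (objs A ! ul n u)) (fst (objs B ! ul n w)) (fst (objs C ! ul n v))
      (p + snd (objs C ! ul n v) - snd (objs B ! ul n w)) (q + snd (objs B ! ul n w) - snd (objs A ! ul n u))
      (g (ul n v) (ul n w)) (f (ul n w) (ul n u)) K = (if K \<in> Jset u v \<and> w \<in> K then ?t w else 0)"
      using gac_cmp_V[OF assms(1-4) w assms(5)] assms(4,5) w
      by (simp only: objs_simps fst_conv snd_conv ent_def)
  qed
  also have "\<dots> = (if K \<in> Jset u v then \<Sum>w\<in>K. ?t w else 0)"
  proof (cases "K \<in> Jset u v")
    case True
    then have "{..<n} \<inter> K = K" using Jset_subset[OF True assms(5)] by auto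
    then show ?thesis using True by (simp add: sum.inter_restrict[symmetric])
  qed simp
  finally show ?thesis .
qed

section \<open>Twists\<close>

text \<open>The exponent \<open>j\<close> is the position \<open>n - 1 - v\<close> of the target,
  and the decreasing monomial in the variables strictly between \<open>u\<close> and
  \<open>v\<close> gives the triangular number.\<close>

lemma ent_pi_twist:
  assumes "u < n" "v < n"
  shows "ent (pi_twist n Q A) u v K =
    (if u < v \<and> K = {u, v} then sg (int n - 1 - int v + tri (int v - int u - 1)) (unit A K) else 0)"
proof (cases "u < v")
  case True
  have "rev [u + 1..<v] = rev [u + 1..<u + 1 + (v - u - 1)]" using True by simp
  then have "word_exp (rev [u + 1..<v]) = tri (int (v - u - 1))"
    using word_exp_rev_upt[of "u + 1" "v - u - 1"] by simp
  then show ?thesis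
    using assms True
    by (auto simp: ent_def pi_twist_def ul_less_iff ul_less ul_ul int_ul unit_def V_def of_nat_diff algebra_simps)
qed (use assms in \<open>auto simp: ent_def pi_twist_def ul_less_iff\<close>)

lemma pi_twist_out: "\<not> (i < n \<and> j < n) \<Longrightarrow> pi_twist n Q A i j = 0"
  by (auto simp: pi_twist_def fun_eq_iff)

lemma ent_pi_mor:
  assumes "A \<in> Ob" "B \<in> Ob" "u < n" "v < n"
  shows "ent (fmor (pi_functor n Q) A B p f) u v K =
    (if u = v \<and> K = {u} then sg ((int n - 1 - int u) * p) (F A B {} {u} p f) else 0)"
  using assms by (auto simp: ent_def pi_functor_def ul_inject ul_ul ul_less F_def V_empty of_nat_diff diff_diff_eq)

lemma pi_mor_out: "\<not> (i < n \<and> j < n) \<Longrightarrow> fmor (pi_functor n Q) A B p f i j = 0"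
  by (auto simp: pi_functor_def fun_eq_iff)

lemma pi_twist_in:
  assumes "A \<in> Ob"
  shows "pi_twist n Q A \<in> M A A 1"
proof -
  have "sg e (unit A {u, v}) \<in> gr (H A A {u, v}) (1 + 1 - int (card {u, v}))" if "u < v" "v < n" for e u v
    using that assms by (simp, intro subgroup_setD(5)[OF H_sub] unit_in) auto
  moreover have "{u, v} \<in> Jset u v" if "u < v" for u v
    using that by (auto simp: Jset_def)
  ultimately show ?thesis
    using assms by (auto simp: M_iff ent_pi_twist pi_twist_out subgroup_setD(1)[OF H_sub] Jset_subset
        simp del: card_insert_disjoint)
qed

lemma pi_mor_in:
  assumes "A \<in> Ob" "B \<in> Ob" "f \<in> gr (H A B {}) p"
  shows "fmor (pi_functor n Q) A B p f \<in> M A B p"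
proof -
  have "sg e (F A B {} {u} p f) \<in> gr (H A B {u}) (p + 1 - int (card {u}))" if "u < n" for e u
    using that assms by (simp, intro subgroup_setD(5)[OF H_sub] F_in) auto
  then show ?thesis
    using assms
    by (auto simp: M_iff ent_pi_mor pi_mor_out subgroup_setD(1)[OF H_sub] Jset_subset Jset_refl)
qed

lemma F_0:
  assumes "A \<in> Ob" "B \<in> Ob" "I \<subseteq> K" "K \<subseteq> {..<n}"
  shows "F A B I K p 0 = 0"
  using assms H_sub F_add by (intro additive_onD(1)[where S = "gr (H A B I) p"]) auto

lemma
  assumes "A \<in> Ob" "B \<in> Ob" "C \<in> Ob" "I \<subseteq> {..<n}"
  shows vcmp_0_left: "f \<in> gr (H A B I) q \<Longrightarrow> vcmp A B C I p q 0 f = 0"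
    and vcmp_0_right: "g \<in> gr (H B C I) p \<Longrightarrow> vcmp A B C I p q g 0 = 0"
  using additive_onD(1)[OF H_sub[OF assms(2-4)] vcmp_add_left[OF assms]]
    additive_onD(1)[OF H_sub[OF assms(1,2,4)] vcmp_add_right[OF assms]] by auto

text \<open>Twist entries are signed units, so composing with one leaves only a sign; these two
  rules turn composites with the twist into bare transition maps.\<close>

lemma
  assumes "A \<in> Ob" "B \<in> Ob" "I \<subseteq> K" "K \<subseteq> {..<n}" "f \<in> gr (H A B K) p"
  shows vcmp_F_unit_left: "vcmp A B B K 0 p (F B B I K 0 (sg e (unit B I))) f = sg e f"
    and vcmp_F_unit_right: "vcmp A A B K p 0 f (F A A I K 0 (sg e (unit A I))) = sg e f"
proof -
  have I: "I \<subseteq> {..<n}" using assms by auto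
  have F: "F C C I K 0 (sg e (unit C I)) = sg e (unit C K)" if "C \<in> Ob" for C
    using additive_onD(5)[OF H_sub[OF that that I] F_add[OF that that assms(3,4)] unit_in[OF that I]]
    by (simp add: F_unit that assms)
  show "vcmp A B B K 0 p (F B B I K 0 (sg e (unit B I))) f = sg e f"
    using additive_onD(5)[OF H_sub[OF assms(2,2,4)] vcmp_add_left[OF assms(1,2,2,4,5)]
        unit_in[OF assms(2,4)]]
    by (simp add: F assms(2) unit_left[OF assms(1,2,4,5)])
  show "vcmp A A B K p 0 f (F A A I K 0 (sg e (unit A I))) = sg e f"
    using additive_onD(5)[OF H_sub[OF assms(1,1,4)] vcmp_add_right[OF assms(1,1,2,4,5)]
        unit_in[OF assms(1,4)]]
    by (simp add: F assms(1) unit_right[OF assms(1,2,4,5)])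
qed

text \<open>Of all cuts of \<open>K\<close> only the one at the predecessor \<open>w\<close> of
  \<open>v\<close> meets a nonzero twist entry, at \<open>{w, v}\<close>. The twist is a signed unit
  there, so the composite reduces to the edge from \<open>K - {v}\<close> to \<open>K\<close>. For
  \<open>u = v\<close> there is no such cut.\<close>

lemma twist_left_entry:
  assumes AB: "A \<in> Ob" "B \<in> Ob" and f: "f \<in> M A B p" and K: "K \<in> Jset u v" and uv: "u < n" "v < n"
  shows "ent (mat_cmp (Gac n Q) (objs A) (objs B) (objs B) 1 p (pi_twist n Q B) f) u v K =
    (if u < v then
      let w = Max (K - {v}) in
      sg ((1 + int w - int v) * (int w - int u + 2 - int (card K)) + (int n - 1 - int v + tri (int v - int w - 1)))
        (\<alpha> A B (K - {v}) v (p + 2 - int (card K)) (ent f u w (K - {v})))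
     else 0)"
proof -
  have KU: "K \<subseteq> {..<n}" using Jset_subset K uv by blast
  define t where "t w = sg ((1 + int w - int v) * (int w - int u + 1 - int (card (K \<inter> {..w}))))
       (vcmp A B B K (1 + 1 - int (card (K \<inter> {w..}))) (p + 1 - int (card (K \<inter> {..w})))
         (F B B (K \<inter> {w..}) K (1 + 1 - int (card (K \<inter> {w..}))) (ent (pi_twist n Q B) w v (K \<inter> {w..})))
         (F A B (K \<inter> {..w}) K (p + 1 - int (card (K \<inter> {..w}))) (ent f u w (K \<inter> {..w}))))" for w
  have fw: "F A B (K \<inter> {..w}) K (p + 1 - int (card (K \<inter> {..w}))) (ent f u w (K \<inter> {..w}))
      \<in> gr (H A B K) (p + 1 - int (card (K \<inter> {..w})))" if "w \<in> K" for w
  proof (rule F_in[OF AB _ KU])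
    have "K \<inter> {..w} \<in> Jset u w" using that K by (auto simp: Jset_def)
    then show "ent f u w (K \<inter> {..w}) \<in> gr (H A B (K \<inter> {..w})) (p + 1 - int (card (K \<inter> {..w})))"
      using that KU uv by (intro M_D(1)[OF f AB]) auto
  qed simp
  have t0: "t w = 0" if w: "w \<in> K" "\<not> (w < v \<and> K \<inter> {w..} = {w, v})" for w
  proof -
    have "ent (pi_twist n Q B) w v (K \<inter> {w..}) = 0"
      using w KU uv by (subst ent_pi_twist) auto
    then show ?thesis
      unfolding t_def using vcmp_0_left[OF AB(1,2,2) KU fw[OF w(1)]] by (simp add: F_0 AB KU)
  qed
  have sum: "ent (mat_cmp (Gac n Q) (objs A) (objs B) (objs B) 1 p (pi_twist n Q B) f) u v K = sum t K"
    using ent_mat_cmp[OF AB(1,2,2) uv, of 1 p "pi_twist n Q B" f K] K by (simp only: t_def[abs_def] if_True)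
  show ?thesis
  proof (cases "u < v")
    case True
    define w where "w = Max (K - {v})"
    note l = Jset_last[OF K True w_def] and J = JsetD[OF K]
    have w: "w < n" "card {w, v} = 2" using l(1,2) KU by auto
    note fw' = fw[OF l(1)]
    have deg: "c + 1 - (int (card K) - 1) = c + 2 - int (card K)" for c by simp
    have k: "int (card (K - {v})) = int (card K) - 1"
      using J by (intro int_card_Diff_singleton)
    have "sum t K = t w + sum t (K - {w})"
      by (rule sum.remove[OF J(5) l(1)])
    also have "sum t (K - {w}) = 0"
      using l(6) by (intro sum.neutral ballI t0) auto
    finally have "sum t K = t w" by simp
    \<comment> \<open>The twist has degree 1 and \<open>{w, v}\<close> has two elements, so the
      twist entry has internal degree \<open>1 + 1 - 2 = 0\<close>, as a unit must.\<close>
    also have "t w = sg ((1 + int w - int v) * (int w - int u + 2 - int (card K)))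
       (vcmp A B B K 0 (p + 2 - int (card K))
         (F B B {w, v} K 0 (sg (int n - 1 - int v + tri (int v - int w - 1)) (unit B {w, v})))
         (F A B (K - {v}) K (p + 2 - int (card K)) (ent f u w (K - {v}))))"
      unfolding t_def l(3,4) k w(2) ent_pi_twist[OF w(1) uv(2)] deg using l(2) by simp
    also have "\<dots> = sg ((1 + int w - int v) * (int w - int u + 2 - int (card K)) +
        (int n - 1 - int v + tri (int v - int w - 1)))
        (F A B (K - {v}) K (p + 2 - int (card K)) (ent f u w (K - {v})))"
      using l(1) J(1,2) by (subst vcmp_F_unit_left[OF AB _ KU fw'[unfolded l(4) k deg]]) auto
    also have "F A B (K - {v}) K = \<alpha> A B (K - {v}) v"
      using J by (simp add: \<alpha>_def insert_absorb)
    finally show ?thesis using True by (simp add: sum w_def Let_def)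
  next
    case False
    have "sum t K = 0"
      using False JsetD[OF K] by (intro sum.neutral ballI t0) auto
    then show ?thesis using False sum by simp
  qed
qed

text \<open>Mirror image of \<open>twist_left_entry\<close>, with the cut at the successor
  \<open>w\<close> of \<open>u\<close>. The sign now depends on the degree \<open>p\<close>, because
  \<open>f\<close> stands on the left and is moved past the \<open>w - u - 1\<close> variables of
  the twist.\<close>

lemma twist_right_entry:
  assumes AB: "A \<in> Ob" "B \<in> Ob" and f: "f \<in> M A B p" and K: "K \<in> Jset u v" and uv: "u < n" "v < n"
  shows "ent (mat_cmp (Gac n Q) (objs A) (objs A) (objs B) p 1 f (pi_twist n Q A)) u v K =
    (if u < v then
      let w = Min (K - {u}) in
      sg ((p + int w - int v) * (int w - int u - 1) + (int n - 1 - int w + tri (int w - int u - 1)))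
        (\<alpha> A B (K - {u}) u (p + 2 - int (card K)) (ent f w v (K - {u})))
     else 0)"
proof -
  have KU: "K \<subseteq> {..<n}" using Jset_subset K uv by blast
  define t where "t w = sg ((p + int w - int v) * (int w - int u + 1 - int (card (K \<inter> {..w}))))
       (vcmp A A B K (p + 1 - int (card (K \<inter> {w..}))) (1 + 1 - int (card (K \<inter> {..w})))
         (F A B (K \<inter> {w..}) K (p + 1 - int (card (K \<inter> {w..}))) (ent f w v (K \<inter> {w..})))
         (F A A (K \<inter> {..w}) K (1 + 1 - int (card (K \<inter> {..w}))) (ent (pi_twist n Q A) u w (K \<inter> {..w}))))" for w
  have fw: "F A B (K \<inter> {w..}) K (p + 1 - int (card (K \<inter> {w..}))) (ent f w v (K \<inter> {w..}))
      \<in> gr (H A B K) (p + 1 - int (card (K \<inter> {w..})))" if "w \<in> K" for w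
  proof (rule F_in[OF AB _ KU])
    have "K \<inter> {w..} \<in> Jset w v" using that K by (auto simp: Jset_def)
    then show "ent f w v (K \<inter> {w..}) \<in> gr (H A B (K \<inter> {w..})) (p + 1 - int (card (K \<inter> {w..})))"
      using that KU uv by (intro M_D(1)[OF f AB]) auto
  qed simp
  have t0: "t w = 0" if w: "w \<in> K" "\<not> (u < w \<and> K \<inter> {..w} = {u, w})" for w
  proof -
    have "ent (pi_twist n Q A) u w (K \<inter> {..w}) = 0"
      using w KU uv by (subst ent_pi_twist) auto
    then show ?thesis
      unfolding t_def using vcmp_0_right[OF AB(1,1,2) KU fw[OF w(1)]] by (simp add: F_0 AB KU)
  qed
  have sum: "ent (mat_cmp (Gac n Q) (objs A) (objs A) (objs B) p 1 f (pi_twist n Q A)) u v K = sum t K"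
    using ent_mat_cmp[OF AB(1,1,2) uv, of p 1 f "pi_twist n Q A" K] K by (simp only: t_def[abs_def] if_True)
  show ?thesis
  proof (cases "u < v")
    case True
    define w where "w = Min (K - {u})"
    note l = Jset_first[OF K True w_def] and J = JsetD[OF K]
    have w: "w < n" "card {u, w} = 2" using l(1,2) KU by auto
    note fw' = fw[OF l(1)]
    have deg: "c + 1 - (int (card K) - 1) = c + 2 - int (card K)" for c by simp
    have k: "int (card (K - {u})) = int (card K) - 1"
      using J by (intro int_card_Diff_singleton)
    have "sum t K = t w + sum t (K - {w})"
      by (rule sum.remove[OF J(5) l(1)])
    also have "sum t (K - {w}) = 0"
      using l(6) by (intro sum.neutral ballI t0) auto
    finally have "sum t K = t w" by simp
    also have "t w = sg ((p + int w - int v) * (int w - int u - 1))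
       (vcmp A A B K (p + 2 - int (card K)) 0
         (F A B (K - {u}) K (p + 2 - int (card K)) (ent f w v (K - {u})))
         (F A A {u, w} K 0 (sg (int n - 1 - int w + tri (int w - int u - 1)) (unit A {u, w}))))"
      unfolding t_def l(3,4) k w(2) ent_pi_twist[OF uv(1) w(1)] deg using l(2) by simp
    also have "\<dots> = sg ((p + int w - int v) * (int w - int u - 1) +
        (int n - 1 - int w + tri (int w - int u - 1)))
        (F A B (K - {u}) K (p + 2 - int (card K)) (ent f w v (K - {u})))"
      using l(1) J(1,2) by (subst vcmp_F_unit_right[OF AB _ KU fw'[unfolded l(4) k deg]]) auto
    also have "F A B (K - {u}) K = \<alpha> A B (K - {u}) u"
      using J by (simp add: \<alpha>_def insert_absorb)
    finally show ?thesis using True by (simp add: sum w_def Let_def)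
  next
    case False
    have "sum t K = 0"
      using False JsetD[OF K] by (intro sum.neutral ballI t0) auto
    then show ?thesis using False sum by simp
  qed
qed

section \<open>The Maurer-Cartan equation for the twist\<close>

lemma alpha_unit:
  assumes "A \<in> Ob" "insert l I \<subseteq> {..<n}"
  shows "\<alpha> A A I l 0 (sg e (unit A I)) = sg e (unit A (insert l I))"
proof -
  have I: "I \<subseteq> {..<n}" using assms by auto
  show ?thesis
    unfolding \<alpha>_def
    using additive_onD(5)[OF H_sub[OF assms(1,1) I] F_add[OF assms(1,1) subset_insertI assms(2)] unit_in[OF assms(1) I]]
    by (simp add: F_unit[OF assms(1) subset_insertI assms(2)])
qed

lemma alpha_0: "\<lbrakk>A \<in> Ob; B \<in> Ob; insert l I \<subseteq> {..<n}\<rbrakk> \<Longrightarrow> \<alpha> A B I l p 0 = 0"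
  unfolding \<alpha>_def by (rule F_0) auto

lemma dif_0: "\<lbrakk>A \<in> Ob; B \<in> Ob; I \<subseteq> {..<n}\<rbrakk> \<Longrightarrow> dif (H A B I) p 0 = 0"
  using additive_onD(1)[OF H_sub H_add] by blast

lemma
  assumes "\<not> (i < n \<and> j < n)"
  shows mat_dif_out: "mat_dif (Gac n Q) (objs A) (objs B) p f i j = 0"
    and mat_cmp_out: "mat_cmp (Gac n Q) (objs A) (objs B) (objs C) p q g f i j = 0"
  unfolding mat_dif_def mat_cmp_def objs_simps using assms by (rule if_not_P)+

text \<open>Both terms live on three-element sets \<open>{u, l, v}\<close>: the differential adjoins
  \<open>l\<close> to the twist at \<open>{u, v}\<close>, and the square joins the twists at
  \<open>{u, l}\<close> and \<open>{l, v}\<close>. Each gives a signed unit, and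
  \<open>tri_split\<close> shows the signs to be opposite. On all other sets both terms
  vanish.\<close>

lemma maurer_cartan:
  assumes A: "A \<in> Ob"
  shows "mat_dif (Gac n Q) (objs A) (objs A) 1 (pi_twist n Q A) +
    mat_cmp (Gac n Q) (objs A) (objs A) (objs A) 1 1 (pi_twist n Q A) (pi_twist n Q A) = 0"
    (is "?d + ?c = 0")
proof (rule mat_eqI)
  fix u v K assume uv: "u < n" "v < n"
  show "ent (?d + ?c) u v K = ent 0 u v K"
  proof (cases "K \<in> Jset u v")
    case K: True
    note J = JsetD[OF K]
    have KU: "K \<subseteq> {..<n}" using Jset_subset[OF K uv(2)] .
    note c = twist_left_entry[OF A A pi_twist_in[OF A] K uv, unfolded Let_def]
    \<comment> \<open>The twist is closed for the internal differential, being a signed unit on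
      \<open>{u, v}\<close> and zero on every other set.\<close>
    have d0: "dif (H A A K) (1 + 1 - int (card K)) (ent (pi_twist n Q A) u v K) = 0"
    proof (cases "u < v \<and> K = {u, v}")
      case True
      then have "1 + 1 - int (card K) = 0"
        "ent (pi_twist n Q A) u v K = sg (int n - 1 - int v + tri (int v - int u - 1)) (unit A K)"
        by (auto simp: ent_pi_twist uv)
      then show ?thesis
        by (simp only: additive_onD(5)[OF H_sub[OF A A KU] H_add[OF A A KU] unit_in[OF A KU]]
            unit_dif[OF A KU] sg_zero)
    next
      case False
      show ?thesis unfolding ent_pi_twist[OF uv] if_not_P[OF False] by (rule dif_0[OF A A KU])
    qed
    have d: "ent ?d u v K = sg (int n - 1 - int v)
      (\<Sum>l\<in>K - {u, v}. sg (int l - int u - int (card {m \<in> K. m < l}))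
        (\<alpha> A A (K - {l}) l (1 + 2 - int (card K)) (ent (pi_twist n Q A) u v (K - {l}))))"
      using ent_mat_dif[OF A A uv, of 1 "pi_twist n Q A" K] K by (simp only: if_True d0 sg_zero add_0_right)
    show ?thesis
    proof (cases "\<exists>l. u < l \<and> l < v \<and> K = {u, l, v}")
      case True
      then obtain l where l: "u < l" "l < v" "K = {u, l, v}" by blast
      have s: "K - {u, v} = {l}" "K - {l} = {u, v}" "K - {v} = {u, l}" "{m \<in> K. m < l} = {u}"
        "insert l {u, v} = K" "insert v {u, l} = K" "l < n" "u < v"
        using l uv by auto
      have cd: "int (card K) = 3" using l by simp
      have w: "Max (K - {v}) = l" using l s by simp
      have 1: "ent ?d u v K = sg (int n - 1 - int v + (int l - int u - 1) +
          (int n - 1 - int v + tri (int v - int u - 1))) (unit A K)"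
        unfolding d s(1) using s(8) alpha_unit[OF A, of l "{u, v}"] KU
        by (simp add: s cd ent_pi_twist uv algebra_simps del: insert_subset)
      have 2: "ent ?c u v K = sg ((1 + int l - int v) * (int l - int u + 2 - 3) +
          (int n - 1 - int v + tri (int v - int l - 1)) + (int n - 1 - int l + tri (int l - int u - 1))) (unit A K)"
        unfolding c w cd s(3) using s(8) l(1) alpha_unit[OF A, of v "{u, l}"] KU
        by (simp add: s ent_pi_twist uv algebra_simps del: insert_subset)
      have 3: "odd ((int n - 1 - int v + (int l - int u - 1) +
          (int n - 1 - int v + tri (int v - int u - 1))) - ((1 + int l - int v) * (int l - int u + 2 - 3) +
          (int n - 1 - int v + tri (int v - int l - 1)) + (int n - 1 - int l + tri (int l - int u - 1))))"
        unfolding tri_split[of v u l]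
        by (cases "even u"; cases "even v"; cases "even l"; cases "even n") simp_all
      show ?thesis unfolding ent_simps 1 2 sg_odd[OF 3] by simp
    next
      case False
      have t1: "ent (pi_twist n Q A) u v (K - {l}) = 0" if "l \<in> K - {u, v}" for l
      proof -
        have "\<not> (u < v \<and> K - {l} = {u, v})"
        proof
          assume *: "u < v \<and> K - {l} = {u, v}"
          have "K = insert l (K - {l})" using that by blast
          then have "K = {u, l, v}" using * by blast
          moreover have "l \<in> {u..v}" "l \<noteq> u" "l \<noteq> v" using that J(3) by blast+
          then have "u < l" "l < v" by simp_all
          ultimately show False using False by blast
        qed
        then show ?thesis unfolding ent_pi_twist[OF uv] by (rule if_not_P)
      qed
      have "ent ?d u v K = 0"
        unfolding d using KU by (simp add: t1 alpha_0 A insert_absorb sum.neutral)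
      moreover have "ent ?c u v K = 0"
      proof (cases "u < v")
        case True
        define w where "w = Max (K - {v})"
        note l = Jset_last[OF K True w_def]
        have "\<not> (u < w \<and> K - {v} = {u, w})"
        proof
          assume *: "u < w \<and> K - {v} = {u, w}"
          then have "K = {u, w, v}" using J(2) by auto
          then show False using False * l(2) by blast
        qed
        then have "ent (pi_twist n Q A) u w (K - {v}) = 0"
          using l(1) KU unfolding ent_pi_twist[OF uv(1) subsetD[OF KU l(1), unfolded lessThan_iff]]
          by (intro if_not_P)
        then show ?thesis
          unfolding c w_def[symmetric] using KU J(2) by (simp add: alpha_0 A insert_absorb uv)
      qed (use c in simp)
      ultimately show ?thesis by simp
    qed
  qed (simp add: ent_mat_dif ent_mat_cmp A uv)
qed (simp only: not_False_eq_True mat_dif_out mat_cmp_out plus_fun_apply zero_fun_apply add_0_left)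

lemma pi_obj_in: "A \<in> Ob \<Longrightarrow> (objs A, pi_twist n Q A) \<in> Obj (Glue n Q)"
  using maurer_cartan[of A] pi_twist_in[of A]
  by (auto simp: Glue_def tw_def objs_def Gac_def ul_less V_obj pi_twist_def fun_eq_iff)

section \<open>The Hom complexes of the gluing between \<open>\<pi> A\<close> and
  \<open>\<pi> B\<close>\<close>

abbreviation Hom_pi :: "'o \<Rightarrow> 'o \<Rightarrow> (nat set \<Rightarrow> 'm) mat cplx"
  where "Hom_pi A B \<equiv> Hom (Glue n Q) (objs A, pi_twist n Q A) (objs B, pi_twist n Q B)"

lemma gr_Hom_pi: "gr (Hom_pi A B) p = M A B p"
  by (simp add: Glue_def tw_def)

lemma dif_Hom_pi: "dif (Hom_pi A B) p f =
    mat_dif (Gac n Q) (objs A) (objs B) p f +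
    mat_cmp (Gac n Q) (objs A) (objs B) (objs B) 1 p (pi_twist n Q B) f -
    sg p (mat_cmp (Gac n Q) (objs A) (objs A) (objs B) p 1 f (pi_twist n Q A))"
  by (simp add: Glue_def tw_def)

text \<open>In degree \<open>p + 1\<close> the component at \<open>K\<close> has internal degree
  \<open>p + 2 - card K\<close>, which is the degree that \<open>f\<close> has at \<open>K\<close>
  with one element removed; so the edges, and with them both twist terms, land in the right
  piece.\<close>

lemma dif_Hom_pi_in:
  assumes AB: "A \<in> Ob" "B \<in> Ob" and f: "f \<in> M A B p"
  shows "dif (Hom_pi A B) p f \<in> M A B (p + 1)"
  unfolding M_iff[OF AB]
proof (intro conjI allI impI)
  fix u v K assume uv: "u < n" "v < n"
  show "if K \<in> Jset u v then ent (dif (Hom_pi A B) p f) u v K \<in> gr (H A B K) (p + 1 + 1 - int (card K))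
      else ent (dif (Hom_pi A B) p f) u v K = 0"
  proof (cases "K \<in> Jset u v")
    case K: True
    note J = JsetD[OF K]
    have KU: "K \<subseteq> {..<n}" using Jset_subset[OF K uv(2)] .
    have e: "p + 1 + 1 - int (card K) = p + 2 - int (card K)" by simp
    note s = subgroup_setD[OF H_sub[OF AB KU, of "p + 2 - int (card K)"]]
    have \<alpha>: "\<alpha> A B (K - {l}) l (p + 2 - int (card K)) (ent f u' v' (K - {l})) \<in> gr (H A B K) (p + 2 - int (card K))"
      if l: "l \<in> K" "K - {l} \<in> Jset u' v'" "u' < n" "v' < n" for l u' v'
    proof -
      have "ent f u' v' (K - {l}) \<in> gr (H A B (K - {l})) (p + 2 - int (card K))"
        using M_D(1)[OF f AB l(2-4)] int_card_Diff_singleton[OF J(5) l(1)] by (simp add: algebra_simps)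
      then show ?thesis
        using l(1) KU cplx_cube.\<alpha>_in[OF cube[OF AB], of l "K - {l}"] by (simp add: insert_absorb)
    qed
    have 1: "ent (mat_dif (Gac n Q) (objs A) (objs B) p f) u v K \<in> gr (H A B K) (p + 2 - int (card K))"
    proof -
      have "dif (H A B K) (p + 1 - int (card K)) (ent f u v K) \<in> gr (H A B K) (p + 2 - int (card K))"
        using H_in[OF AB KU M_D(1)[OF f AB K uv]] by (simp add: algebra_simps)
      moreover have "K - {l} \<in> Jset u v" "l \<in> K" if "l \<in> K - {u, v}" for l
        using that J by (auto simp: Jset_def)
      ultimately show ?thesis
        unfolding ent_mat_dif[OF AB uv] if_P[OF K]
        by (intro s(2,5) subgroup_set_sum[OF H_sub[OF AB KU]] \<alpha>[OF _ _ uv]) assumption+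
    qed
    have 2: "ent (mat_cmp (Gac n Q) (objs A) (objs B) (objs B) 1 p (pi_twist n Q B) f) u v K
      \<in> gr (H A B K) (p + 2 - int (card K))"
    proof (cases "u < v")
      case True
      note l = Jset_last[OF K True refl]
      have "Max (K - {v}) < n" using l(1) KU by auto
      then show ?thesis
        unfolding twist_left_entry[OF AB f K uv] Let_def if_P[OF True]
        by (intro s(5) \<alpha>[OF J(2) l(5) uv(1)])
    qed (use s(1) in \<open>simp add: twist_left_entry[OF AB f K uv]\<close>)
    have 3: "ent (mat_cmp (Gac n Q) (objs A) (objs A) (objs B) p 1 f (pi_twist n Q A)) u v K
      \<in> gr (H A B K) (p + 2 - int (card K))"
    proof (cases "u < v")
      case True
      note l = Jset_first[OF K True refl]
      have "Min (K - {u}) < n" using l(1) KU by auto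
      then show ?thesis
        unfolding twist_right_entry[OF AB f K uv] Let_def if_P[OF True]
        by (intro s(5) \<alpha>[OF J(1) l(5) _ uv(2)])
    qed (use s(1) in \<open>simp add: twist_right_entry[OF AB f K uv]\<close>)
    show ?thesis
      unfolding if_P[OF K] dif_Hom_pi e ent_simps using 1 2 3 by (intro s(2,4,5))
  qed (simp add: dif_Hom_pi ent_mat_dif ent_mat_cmp AB uv)
qed (simp only: not_False_eq_True dif_Hom_pi mat_dif_out mat_cmp_out plus_fun_apply zero_fun_apply minus_apply
    sg_fun_apply sg_zero add_0_left diff_0_right)

section \<open>The totalisation as a cone\<close>

text \<open>
  The signs are determined, up to a common one, by the requirement that \<open>cone_iso\<close> below is compatible
  with the differentials: \<open>Min K * p\<close> removes the dependence of the internal differential on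
  \<open>Min K\<close>, and the remaining terms solve the recursion for the removal of one element of \<open>K\<close>.
\<close>

definition cone_exp :: "int \<Rightarrow> nat set \<Rightarrow> int"
  where "cone_exp p K = int (Min K) * p + tri (int (Max K) - int (Min K) - 1) + int n
    + int (card K) * (int n - 1 - int (Max K))"

text \<open>At the empty set the totalisation gives the internal differential the sign
  \<open>(-1)^n\<close> and the cone gives it -1, so the exponent must change by
  \<open>n - 1\<close> with each degree; this is the origin of \<open>(n - 1) * p\<close>. At
  nonempty \<open>K\<close> the exponent is taken for \<open>p - 1\<close>, the degree of
  \<open>y\<close>.\<close>

definition cone_iso :: "int \<Rightarrow> 'm \<Rightarrow> (nat set \<Rightarrow> 'm) mat \<Rightarrow> nat set \<Rightarrow> 'm"
  where "cone_iso p x y K =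
    (if K = {} then sg ((int n - 1) * p) x
     else if K \<subseteq> {..<n} then sg (cone_exp (p - 1) K) (ent y (Min K) (Max K) K)
     else 0)"

lemma cone_iso_dif:
  assumes AB: "A \<in> Ob" "B \<in> Ob" and x: "x \<in> gr (H A B {}) p" and y: "y \<in> M A B (p - 1)"
  shows "dif (totalisation n (H A B) (\<alpha> A B)) (p + - int n) (cone_iso p x y) =
    cone_iso (p + 1) (- dif (H A B {}) p x) (fmor (pi_functor n Q) A B p x + dif (Hom_pi A B) (p - 1) y)"
proof
  interpret cplx_cube n "H A B" "\<alpha> A B" using cube[OF AB] .
  fix K
  show "dif T (p + - int n) (cone_iso p x y) K =
    cone_iso (p + 1) (- dif (H A B {}) p x) (fmor (pi_functor n Q) A B p x + dif (Hom_pi A B) (p - 1) y) K"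
  proof (cases "K \<subseteq> {..<n}")
    case KU: True
    have deg: "p + - int n + 1 + (int n - int (card K)) = p + 1 - int (card K)"
      "p + - int n + (int n - int (card K)) = p - int (card K)" by simp_all
    show ?thesis
    proof (cases "K = {}")
      case True
      have "dif T (p + - int n) (cone_iso p x y) K = sg (int n) (dif (H A B {}) p (sg ((int n - 1) * p) x))"
        unfolding T_dif[OF KU] deg using True by (simp add: cone_iso_def)
      also have "\<dots> = sg (int n + (int n - 1) * p) (dif (H A B {}) p x)"
        using additive_onD(5)[OF H_sub[OF AB] H_add[OF AB] x] by simp
      also have "\<dots> = - sg ((int n - 1) * (p + 1)) (dif (H A B {}) p x)"
        by (rule sg_odd) (cases "even n"; cases "even p"; simp)
      finally show ?thesis using True by (simp add: cone_iso_def sg_minus)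
    next
      case ne: False
      define u v where "u = Min K" and "v = Max K"
      have fin: "finite K" using KU finite_subset by blast
      have K: "K \<in> Jset u v" using Jset_Min_Max[OF fin ne] by (simp add: u_def v_def)
      note J = JsetD[OF K]
      have uv: "u < n" "v < n" using KU J by auto
      let ?D = "mat_dif (Gac n Q) (objs A) (objs B) (p - 1) y"
      let ?L = "mat_cmp (Gac n Q) (objs A) (objs B) (objs B) 1 (p - 1) (pi_twist n Q B) y"
      let ?R = "mat_cmp (Gac n Q) (objs A) (objs A) (objs B) (p - 1) 1 y (pi_twist n Q A)"
      let ?pi = "fmor (pi_functor n Q) A B p x"
      have rhs: "cone_iso (p + 1) (- dif (H A B {}) p x) (?pi + dif (Hom_pi A B) (p - 1) y) K =
        sg (cone_exp p K) (ent ?pi u v K + (ent ?D u v K + ent ?L u v K - sg (p - 1) (ent ?R u v K)))"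
        using KU ne by (simp add: cone_iso_def u_def v_def dif_Hom_pi)
      have exp: "cone_exp q K = int u * q + tri (int v - int u - 1) + int n + int (card K) * (int n - 1 - int v)" for q
        by (simp add: cone_exp_def u_def v_def)
      have yK: "ent y u v K \<in> gr (H A B K) (p - int (card K))"
        using M_D(1)[OF y AB K uv] by simp
      have dif_sg: "dif (H A B K) (p - int (card K)) (sg e (ent y u v K)) = sg e (dif (H A B K) (p - int (card K)) (ent y u v K))" for e
        by (rule additive_onD(5)[OF H_sub[OF AB KU] H_add[OF AB KU] yK])
      define t where "t l = sg (int l - int (card {m \<in> K. m < l}))
        (\<alpha> A B (K - {l}) l (p + 1 - int (card K)) (cone_iso p x y (K - {l})))" for l
      have lhs: "dif T (p + - int n) (cone_iso p x y) K = sum t K +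
        sg (int n - int (card K) + cone_exp (p - 1) K) (dif (H A B K) (p - int (card K)) (ent y u v K))"
        unfolding T_dif[OF KU] deg t_def[abs_def] using ne KU by (simp add: cone_iso_def dif_sg flip: u_def v_def)
      \<comment> \<open>Raising the degree by one adds \<open>u\<close> to \<open>cone_exp\<close>.
        This cancels the \<open>u\<close> in the Koszul sign of the gluing category, and the sign of
        the shift cancels its \<open>v\<close>.\<close>
      have Dd: "sg (cone_exp p K + (int n - 1 - int v) + (int v - int u + 1 - int (card K))) z =
          sg (int n - int (card K) + cone_exp (p - 1) K) z" for z :: 'm
        unfolding exp by (rule sg_cong) (cases "even u"; cases "even v"; cases "even p"; cases "even n"; simp)
      have D: "sg (cone_exp p K) (ent ?D u v K) =
          (\<Sum>l\<in>K - {u, v}. sg (cone_exp p K + (int n - 1 - int v) + (int l - int u - int (card {m \<in> K. m < l})))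
            (\<alpha> A B (K - {l}) l (p + 1 - int (card K)) (ent y u v (K - {l})))) +
          sg (int n - int (card K) + cone_exp (p - 1) K) (dif (H A B K) (p - int (card K)) (ent y u v K))"
      proof -
        have "p - 1 + 2 - int (card K) = p + 1 - int (card K)" "p - 1 + 1 - int (card K) = p - int (card K)"
          by simp_all
        note d = ent_mat_dif[OF AB uv, of "p - 1" y K, unfolded this if_P[OF K]]
        show ?thesis
          unfolding d by (simp only: sg_add sg_sum sg_sg Dd add.assoc[symmetric])
      qed
      show ?thesis
      proof (cases "u = v")
        case True
        then have Ku: "K = {u}" using K by (simp add: Jset_refl)
        have "t u = sg (int u) (\<alpha> A B {} u p (sg ((int n - 1) * p) x))"
          using Ku by (simp add: t_def cone_iso_def Collect_conv_if)
        also have "\<dots> = sg (int u + (int n - 1) * p) (F A B {} {u} p x)"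
          unfolding \<alpha>_def using additive_onD(5)[OF H_sub[OF AB] F_add[OF AB] x] uv by simp
        \<comment> \<open>For \<open>K = {u}\<close> the triangular number is that of -1, namely 1,
          and \<open>cone_exp p K\<close> has the parity of \<open>u * p + u\<close>. The sign in
          the definition of \<open>\<pi>\<close> on morphisms makes up exactly the difference to
          \<open>u + (n - 1) * p\<close>.\<close>
        also have "\<dots> = sg (cone_exp p K + (int n - 1 - int u) * p) (F A B {} {u} p x)"
          unfolding exp True[symmetric]
          by (rule sg_cong) (cases "even u"; cases "even p"; cases "even n"; simp add: Ku tri_def)
        also have "\<dots> = sg (cone_exp p K) (ent ?pi u v K)"
          using True Ku uv by (simp add: ent_pi_mor[OF AB])
        finally have tK: "sum t K = sg (cone_exp p K) (ent ?pi u v K)" using Ku by simp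
        have Ke: "K - {u, v} = {}" using Ku by simp
        have LR: "ent ?L u v K = 0" "ent ?R u v K = 0"
          using True twist_left_entry[OF AB y K uv] twist_right_entry[OF AB y K uv] by simp_all
        show ?thesis
          unfolding lhs rhs LR sg_zero add_0_right diff_0_right sg_add D Ke tK by simp
      next
        case False
        then have less: "u < v" using J by simp
        have degp: "p - 1 + 2 - int (card K) = p + 1 - int (card K)" by simp
        have pi0: "ent ?pi u v K = 0" using False by (simp add: ent_pi_mor[OF AB uv])
        have K': "K - {l} \<subseteq> {..<n}" "insert l (K - {l}) = K" "int (card (K - {l})) = int (card K) - 1"
          if "l \<in> K" for l
          using that KU int_card_Diff_singleton[OF fin that] by auto
        have tl: "t l = sg (int l - int (card {m \<in> K. m < l}) + cone_exp (p - 1) (K - {l}))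
            (\<alpha> A B (K - {l}) l (p + 1 - int (card K)) (ent y u' v' (K - {l})))"
          if l: "l \<in> K" "K - {l} \<in> Jset u' v'" "u' < n" "v' < n" for l u' v'
        proof -
          note J' = JsetD[OF l(2)]
          have "l < n" using l(1) KU by auto
          moreover have "ent y u' v' (K - {l}) \<in> gr (H A B (K - {l})) (p + 1 - int (card K))"
            using M_D(1)[OF y AB l(2-4)] K'(3)[OF l(1)] by (simp add: algebra_simps)
          ultimately have "\<alpha> A B (K - {l}) l (p + 1 - int (card K)) (sg e (ent y u' v' (K - {l}))) =
              sg e (\<alpha> A B (K - {l}) l (p + 1 - int (card K)) (ent y u' v' (K - {l})))" for e
            using \<alpha>_a(3)[of l "K - {l}"] K'(2)[OF l(1)] KU by simp
          then show ?thesis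
            using J' K'(1)[OF l(1)] by (simp add: t_def cone_iso_def)
        qed
        have S: "sum t K = t v + (t u + sum t (K - {u, v}))"
        proof -
          have "sum t K = t v + sum t (K - {v})" by (rule sum.remove[OF fin J(2)])
          also have "sum t (K - {v}) = t u + sum t (K - {v} - {u})"
            using fin J False by (intro sum.remove) auto
          also have "K - {v} - {u} = K - {u, v}" by auto
          finally show ?thesis .
        qed
        have Si: "sum t (K - {u, v}) =
          (\<Sum>l\<in>K - {u, v}. sg (cone_exp p K + (int n - 1 - int v) + (int l - int u - int (card {m \<in> K. m < l})))
            (\<alpha> A B (K - {l}) l (p + 1 - int (card K)) (ent y u v (K - {l}))))"
        proof (rule sum.cong[OF refl])
          fix l assume l: "l \<in> K - {u, v}"
          then have K1: "K - {l} \<in> Jset u v" and lK: "l \<in> K" using J by (auto simp: Jset_def)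
          note J1 = JsetD[OF K1]
          \<comment> \<open>Removing an interior element keeps both ends, so only the cardinality
            and the degree change.\<close>
          have e1: "cone_exp (p - 1) (K - {l}) = int u * (p - 1) + tri (int v - int u - 1) + int n
              + (int (card K) - 1) * (int n - 1 - int v)"
            unfolding cone_exp_def J1(7,8) K'(3)[OF lK] ..
          show "t l = sg (cone_exp p K + (int n - 1 - int v) + (int l - int u - int (card {m \<in> K. m < l})))
              (\<alpha> A B (K - {l}) l (p + 1 - int (card K)) (ent y u v (K - {l})))"
            unfolding tl[OF lK K1 uv] e1 exp
            by (rule sg_cong) (cases "even u"; cases "even v"; cases "even p"; cases "even n"; simp)
        qed
        have Sv: "t v = sg (cone_exp p K) (ent ?L u v K)"
        proof -
          define w where "w = Max (K - {v})"
          note l = Jset_last[OF K less w_def]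
          have w: "w < n" using l(1) KU by auto
          have c: "int (card {m \<in> K. m < v}) = int (card K) - 1"
          proof -
            have "{m \<in> K. m < v} = K - {v}" using J(3) by (auto simp: order.order_iff_strict)
            then show ?thesis using K'(3)[OF J(2)] by simp
          qed
          have L: "ent ?L u v K = sg ((1 + int w - int v) * (int w - int u + 2 - int (card K)) +
              (int n - 1 - int v + tri (int v - int w - 1)))
              (\<alpha> A B (K - {v}) v (p + 1 - int (card K)) (ent y u w (K - {v})))"
            unfolding w_def by (rule twist_left_entry[OF AB y K uv, unfolded Let_def if_P[OF less] degp])
          \<comment> \<open>The maximum drops from \<open>v\<close> to \<open>w\<close>, which
            changes the triangular number as in \<open>tri_split\<close>. The product of
            \<open>card K\<close> with \<open>Max K\<close> in \<open>cone_exp\<close> answers the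
            product of \<open>card K\<close> with \<open>1 + w - v\<close> in the sign of the
            cut.\<close>
          have e1: "cone_exp (p - 1) (K - {v}) = int u * (p - 1) + tri (int w - int u - 1) + int n
              + (int (card K) - 1) * (int n - 1 - int w)"
            unfolding cone_exp_def JsetD(7,8)[OF l(5)] K'(3)[OF J(2)] ..
          show ?thesis
            unfolding L sg_sg tl[OF J(2) l(5) uv(1) w] e1 exp c tri_split[of v u w]
            by (rule sg_cong)
              (cases "even u"; cases "even v"; cases "even w"; cases "even p"; cases "even n"; cases "even (card K)"; simp)
        qed
        have Su: "t u = - sg (cone_exp p K) (sg (p - 1) (ent ?R u v K))"
        proof -
          define w where "w = Min (K - {u})"
          note l = Jset_first[OF K less w_def]
          have w: "w < n" using l(1) KU by auto
          have c: "int (card {m \<in> K. m < u}) = 0"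
          proof -
            have "{m \<in> K. m < u} = {}" using J(3) by auto
            then show ?thesis by simp
          qed
          have R: "ent ?R u v K = sg ((p - 1 + int w - int v) * (int w - int u - 1) +
              (int n - 1 - int w + tri (int w - int u - 1)))
              (\<alpha> A B (K - {u}) u (p + 1 - int (card K)) (ent y w v (K - {u})))"
            unfolding w_def by (rule twist_right_entry[OF AB y K uv, unfolded Let_def if_P[OF less] degp])
          \<comment> \<open>The minimum rises from \<open>u\<close> to \<open>w\<close>, so the
            coefficient of the degree changes by \<open>w - u\<close>. This is matched by
            \<open>w - u - 1\<close> from the sign of the cut and 1 from the sign in front of the
            composite with the twist of \<open>\<pi> A\<close>.\<close>
          have e1: "cone_exp (p - 1) (K - {u}) = int w * (p - 1) + tri (int v - int w - 1) + int n
              + (int (card K) - 1) * (int n - 1 - int v)"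
            unfolding cone_exp_def JsetD(7,8)[OF l(5)] K'(3)[OF J(1)] ..
          show ?thesis
            unfolding R sg_sg tl[OF J(1) l(5) w uv(2)] e1 exp c tri_split[of v u w]
            by (rule sg_odd)
              (cases "even u"; cases "even v"; cases "even w"; cases "even p"; cases "even n"; cases "even (card K)"; simp)
        qed
        show ?thesis
          unfolding lhs rhs pi0 add_0_left sg_diff sg_add D S Si Sv Su
          by (simp add: algebra_simps)
      qed
    qed
  qed (auto simp: T_dif_out cone_iso_def)
qed

lemma pi_mor_add:
  assumes AB: "A \<in> Ob" "B \<in> Ob"
  shows "additive_on (gr (H A B {}) p) (fmor (pi_functor n Q) A B p)"
  unfolding additive_on_def
proof (intro ballI mat_eqI)
  fix x y u v K
  assume xy: "x \<in> gr (H A B {}) p" "y \<in> gr (H A B {}) p" and uv: "u < n" "v < n"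
  have "F A B {} {u} p (x + y) = F A B {} {u} p x + F A B {} {u} p y"
    using uv by (intro additive_onD(2)[OF H_sub F_add] AB xy) auto
  then show "ent (fmor (pi_functor n Q) A B p (x + y)) u v K =
      ent (fmor (pi_functor n Q) A B p x + fmor (pi_functor n Q) A B p y) u v K"
    by (auto simp: ent_pi_mor AB uv sg_add)
qed (simp add: pi_mor_out)

text \<open>A nonempty \<open>K\<close> occurs in one matrix entry only, the one given by its
  minimum and maximum, and every sign is its own inverse. The inverse map therefore redistributes
  the components and applies the same signs again.\<close>

lemma cone_iso_bij:
  assumes AB: "A \<in> Ob" "B \<in> Ob"
  shows "bij_betw (\<lambda>(x, y). cone_iso p x y) (gr (H A B {}) p \<times> M A B (p - 1))
    (gr (totalisation n (H A B) (\<alpha> A B)) (p + - int n))"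
proof -
  interpret cplx_cube n "H A B" "\<alpha> A B" using cube[OF AB] .
  have T: "z \<in> gr T (p + - int n) \<longleftrightarrow> (\<forall>I\<subseteq>{..<n}. z I \<in> gr (H A B I) (p - int (card I))) \<and>
      (\<forall>I. \<not> I \<subseteq> {..<n} \<longrightarrow> z I = 0)" for z
    by (simp add: T_gr)
  have sg_cancel: "sg e (sg e z) = z" for e and z :: 'm
    by (simp add: sg_def)
  have MM: "Min K < n" "Max K < n" "K \<in> Jset (Min K) (Max K)" if "K \<subseteq> {..<n}" "K \<noteq> {}" for K
  proof -
    have "finite K" using that(1) finite_subset by blast
    with that show "Min K < n" "Max K < n" "K \<in> Jset (Min K) (Max K)"
      using Min_in[of K] Max_in[of K] Jset_Min_Max[of K] by blast+
  qed
  define inv where "inv z =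
    (sg ((int n - 1) * p) (z {}),
     \<lambda>i j K. if i < n \<and> j < n \<and> K \<in> Jset (ul n j) (ul n i) then sg (cone_exp (p - 1) K) (z K) else 0)"
    for z :: "nat set \<Rightarrow> 'm"
  have ent_inv: "ent (snd (inv z)) u v K = (if K \<in> Jset u v then sg (cone_exp (p - 1) K) (z K) else 0)"
    if "u < n" "v < n" for z u v K
    using that by (simp add: ent_def inv_def ul_less ul_ul)
  show ?thesis
  proof (rule bij_betw_byWitness[where f' = inv])
    show "\<forall>a\<in>gr (H A B {}) p \<times> M A B (p - 1). inv (case a of (x, y) \<Rightarrow> cone_iso p x y) = a"
    proof (clarify)
      fix x y assume x: "x \<in> gr (H A B {}) p" and y: "y \<in> M A B (p - 1)"
      have "snd (inv (cone_iso p x y)) = y"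
      proof (rule mat_eqI)
        fix u v K assume uv: "u < n" "v < n"
        show "ent (snd (inv (cone_iso p x y))) u v K = ent y u v K"
        proof (cases "K \<in> Jset u v")
          case True
          then have "Min K = u" "Max K = v" "K \<noteq> {}" "K \<subseteq> {..<n}"
            using JsetD[OF True] Jset_subset[OF True uv(2)] by auto
          then show ?thesis using True by (simp add: ent_inv uv cone_iso_def sg_cancel del: sg_sg)
        qed (use M_D(2)[OF y AB] uv in \<open>simp add: ent_inv\<close>)
      qed (auto simp: inv_def M_D(3)[OF y AB] fun_eq_iff)
      moreover have "fst (inv (cone_iso p x y)) = x"
        by (simp add: inv_def cone_iso_def sg_cancel del: sg_sg)
      ultimately show "inv (cone_iso p x y) = (x, y)" by (simp add: prod_eq_iff)
    qed
    show "\<forall>z\<in>gr T (p + - int n). (case inv z of (x, y) \<Rightarrow> cone_iso p x y) = z"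
    proof (intro ballI ext)
      fix z K assume z: "z \<in> gr T (p + - int n)"
      have "(case inv z of (x, y) \<Rightarrow> cone_iso p x y) K = cone_iso p (fst (inv z)) (snd (inv z)) K"
        by (simp add: case_prod_beta)
      also have "\<dots> = z K"
        using z MM[of K] unfolding T
        by (auto simp: cone_iso_def ent_inv sg_cancel simp del: sg_sg) (simp add: inv_def sg_cancel del: sg_sg)
      finally show "(case inv z of (x, y) \<Rightarrow> cone_iso p x y) K = z K" .
    qed
    show "(\<lambda>(x, y). cone_iso p x y) ` (gr (H A B {}) p \<times> M A B (p - 1)) \<subseteq> gr T (p + - int n)"
    proof (clarify)
      fix x y assume x: "x \<in> gr (H A B {}) p" and y: "y \<in> M A B (p - 1)"
      have "cone_iso p x y K \<in> gr (H A B K) (p - int (card K))" if K: "K \<subseteq> {..<n}" for K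
        using K x M_D(1)[OF y AB, of K "Min K" "Max K"] MM[OF K] subgroup_setD(5)[OF H_sub[OF AB K]]
        by (auto simp: cone_iso_def)
      then show "cone_iso p x y \<in> gr T (p + - int n)"
        unfolding T by (auto simp: cone_iso_def)
    qed
    show "inv ` gr T (p + - int n) \<subseteq> gr (H A B {}) p \<times> M A B (p - 1)"
    proof (rule image_subsetI)
      fix z assume "z \<in> gr T (p + - int n)"
      then have z: "\<And>I. I \<subseteq> {..<n} \<Longrightarrow> z I \<in> gr (H A B I) (p - int (card I))" unfolding T by blast
      have "fst (inv z) \<in> gr (H A B {}) p"
        using z[of "{}"] subgroup_setD(5)[OF H_sub[OF AB, of "{}" p]] by (simp add: inv_def)
      moreover have "ent (snd (inv z)) u v K \<in> gr (H A B K) (p - 1 + 1 - int (card K))"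
        if "K \<in> Jset u v" "u < n" "v < n" for u v K
        using that z[OF Jset_subset[OF that(1,3)]] subgroup_setD(5)[OF H_sub[OF AB Jset_subset[OF that(1,3)]]]
        by (simp add: ent_inv)
      moreover have "snd (inv z) i j = 0" if "\<not> (i < n \<and> j < n)" for i j
        using that by (auto simp: inv_def fun_eq_iff)
      ultimately show "inv z \<in> gr (H A B {}) p \<times> M A B (p - 1)"
        by (simp add: mem_Times_iff M_iff[OF AB] ent_inv)
    qed
  qed
qed

text \<open>The offset is \<open>- n\<close> because the empty set carries all \<open>n\<close>
  variables, each of degree -1. Besides the comparison of acyclicity with quasi-isomorphism, this
  interpretation yields the compatibility of \<open>\<pi>\<close> with the differentials.\<close>

lemma pi_cone:
  assumes AB: "A \<in> Ob" "B \<in> Ob"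
  shows "mapping_cone (H A B {}) (Hom_pi A B) (totalisation n (H A B) (\<alpha> A B))
    (fmor (pi_functor n Q) A B) cone_iso (- int n)"
proof -
  interpret cplx_cube n "H A B" "\<alpha> A B" using cube[OF AB] .
  show ?thesis
  proof
    show "cone_iso p (x + x') (y + y') = cone_iso p x y + cone_iso p x' y'" for p x x' y y'
      by (auto simp: cone_iso_def sg_add)
  qed (use AB in \<open>auto simp only: gr_Hom_pi intro: H_sub H_add H_in H_dd M_sub dif_Hom_pi_in pi_mor_in
      pi_mor_add T_sub T_add T_dd cone_iso_bij cone_iso_dif empty_subsetI\<close>)
qed

section \<open>Functoriality of \<open>\<pi>\<close> and the conclusion\<close>

lemma H_empty: "A \<in> Ob \<Longrightarrow> B \<in> Ob \<Longrightarrow> H A B {} = Hom (cat Q {}) A B"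
  by (simp add: H_def V_empty)

lemma pi_mor_linear:
  assumes AB: "A \<in> Ob" "B \<in> Ob"
  shows "linear_on s (glue_scale s) (gr (H A B {}) p) (fmor (pi_functor n Q) A B p)"
  unfolding linear_on_def
proof (intro conjI ballI allI)
  interpret vector_space s
    using H_complex[OF AB, of "{}"] by (simp add: cochain_complex_def)
  fix c x assume x: "x \<in> gr (H A B {}) p"
  show "fmor (pi_functor n Q) A B p (s c x) = glue_scale s c (fmor (pi_functor n Q) A B p x)"
  proof (rule mat_eqI)
    fix u v K assume uv: "u < n" "v < n"
    have "F A B {} {u} p (s c x) = s c (F A B {} {u} p x)"
      using F_linear[OF AB, of "{}" "{u}" p] x uv by (simp add: linear_on_def)
    moreover have "ent (glue_scale s c f) u v K = s c (ent f u v K)" for f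
      by (simp add: ent_def glue_scale_def)
    ultimately show "ent (fmor (pi_functor n Q) A B p (s c x)) u v K =
        ent (glue_scale s c (fmor (pi_functor n Q) A B p x)) u v K"
      by (auto simp: ent_pi_mor AB uv scale_sg)
  qed (auto simp: glue_scale_def pi_mor_out fun_eq_iff)
qed (use pi_mor_add[OF AB] in \<open>auto simp: additive_on_def\<close>)

text \<open>On a singleton the only cut has no variables to commute with, and the exponents
  \<open>(n - 1 - u) * p\<close> and \<open>(n - 1 - u) * q\<close> add up. On larger sets the
  diagonal matrices contribute nothing.\<close>

lemma pi_mor_cmp:
  assumes ABC: "A \<in> Ob" "B \<in> Ob" "C \<in> Ob" and g: "g \<in> gr (H B C {}) p" and f: "f \<in> gr (H A B {}) q"
  shows "fmor (pi_functor n Q) A C (p + q) (vcmp A B C {} p q g f) =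
    mat_cmp (Gac n Q) (objs A) (objs B) (objs C) p q
      (fmor (pi_functor n Q) B C p g) (fmor (pi_functor n Q) A B q f)" (is "_ = ?c")
proof (rule mat_eqI)
  note AB = ABC(1,2) and BC = ABC(2,3) and AC = ABC(1,3)
  fix u v K assume uv: "u < n" "v < n"
  show "ent (fmor (pi_functor n Q) A C (p + q) (vcmp A B C {} p q g f)) u v K = ent ?c u v K"
  proof (cases "K \<in> Jset u v")
    case K: True
    note J = JsetD[OF K]
    have KU: "K \<subseteq> {..<n}" using Jset_subset[OF K uv(2)] .
    show ?thesis
    proof (cases "K = {u}")
      case True
      then have [simp]: "v = u" "K = {u}" using J by auto
      have i: "{u} \<inter> {u..} = {u}" "{u} \<inter> {..u} = {u}" by auto
      have Fg: "F B C {} {u} p g \<in> gr (H B C {u}) p" and Ff: "F A B {} {u} q f \<in> gr (H A B {u}) q"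
        using uv by (auto intro!: F_in ABC f g)
      have "ent ?c u v K = vcmp A B C {u} p q
          (F B C {u} {u} p (sg ((int n - 1 - int u) * p) (F B C {} {u} p g)))
          (F A B {u} {u} q (sg ((int n - 1 - int u) * q) (F A B {} {u} q f)))"
        unfolding ent_mat_cmp[OF ABC uv] if_P[OF K]
        by (simp add: i ent_pi_mor ABC uv)
      also have "\<dots> = vcmp A B C {u} p q (sg ((int n - 1 - int u) * p) (F B C {} {u} p g))
          (sg ((int n - 1 - int u) * q) (F A B {} {u} q f))"
        using uv Fg Ff by (simp add: F_id ABC subgroup_setD(5)[OF H_sub])
      also have "\<dots> = sg ((int n - 1 - int u) * (p + q)) (vcmp A B C {u} p q (F B C {} {u} p g) (F A B {} {u} q f))"
      proof -
        have U: "{u} \<subseteq> {..<n}" using uv by simp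
        have sf: "sg ((int n - 1 - int u) * q) (F A B {} {u} q f) \<in> gr (H A B {u}) q"
          using Ff by (rule subgroup_setD(5)[OF H_sub[OF AB U]])
        show ?thesis
          by (simp add: additive_onD(5)[OF H_sub[OF BC U] vcmp_add_left[OF ABC U sf] Fg]
              additive_onD(5)[OF H_sub[OF AB U] vcmp_add_right[OF ABC U Fg] Ff] distrib_left)
      qed
      also have "vcmp A B C {u} p q (F B C {} {u} p g) (F A B {} {u} q f) =
          F A C {} {u} (p + q) (vcmp A B C {} p q g f)"
        using uv by (intro F_vcmp[symmetric] ABC f g) auto
      finally show ?thesis by (simp add: ent_pi_mor AC uv)
    next
      case False
      have in_f: "F A B (K \<inter> {..w}) K (q + 1 - int (card (K \<inter> {..w})))
          (ent (fmor (pi_functor n Q) A B q f) u w (K \<inter> {..w})) \<in> gr (H A B K) (q + 1 - int (card (K \<inter> {..w})))"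
        if "w \<in> K" for w
      proof (intro F_in AB KU M_D(1)[OF pi_mor_in[OF AB f] AB])
        show "K \<inter> {..w} \<in> Jset u w" "u < n" "w < n" using that K uv by (auto simp: Jset_def)
      qed simp
      have in_g: "F B C (K \<inter> {w..}) K (p + 1 - int (card (K \<inter> {w..})))
          (ent (fmor (pi_functor n Q) B C p g) w v (K \<inter> {w..})) \<in> gr (H B C K) (p + 1 - int (card (K \<inter> {w..})))"
        if "w \<in> K" for w
      proof (intro F_in BC KU M_D(1)[OF pi_mor_in[OF BC g] BC])
        show "K \<inter> {w..} \<in> Jset w v" "w < n" "v < n" using that K uv by (auto simp: Jset_def)
      qed simp
      have "vcmp A B C K (p + 1 - int (card (K \<inter> {w..}))) (q + 1 - int (card (K \<inter> {..w})))
          (F B C (K \<inter> {w..}) K (p + 1 - int (card (K \<inter> {w..}))) (ent (fmor (pi_functor n Q) B C p g) w v (K \<inter> {w..})))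
          (F A B (K \<inter> {..w}) K (q + 1 - int (card (K \<inter> {..w}))) (ent (fmor (pi_functor n Q) A B q f) u w (K \<inter> {..w}))) = 0"
        if w: "w \<in> K" for w
      \<comment> \<open>The ends \<open>u\<close> and \<open>v\<close> differ because
        \<open>K\<close> is not \<open>{u}\<close>, so \<open>w\<close> misses one of them and the
        corresponding factor is an off-diagonal entry.\<close>
      proof (cases "w = v")
        case True
        have "u \<noteq> w"
          using True False K by (auto simp: Jset_refl)
        then have "ent (fmor (pi_functor n Q) A B q f) u w (K \<inter> {..w}) = 0"
          using w KU uv by (simp add: ent_pi_mor AB subset_iff)
        then show ?thesis using vcmp_0_right[OF ABC KU in_g[OF w]] by (simp add: F_0 AB KU)
      next
        case False
        then have "ent (fmor (pi_functor n Q) B C p g) w v (K \<inter> {w..}) = 0"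
          using w KU uv by (simp add: ent_pi_mor BC subset_iff)
        then show ?thesis using vcmp_0_left[OF ABC KU in_f[OF w]] by (simp add: F_0 BC KU)
      qed
      then have "ent ?c u v K = 0"
        unfolding ent_mat_cmp[OF ABC uv] if_P[OF K] by (intro sum.neutral ballI) (simp only: sg_zero)
      then show ?thesis using False by (simp add: ent_pi_mor AC uv)
    qed
  next
    case False
    then have "\<not> (u = v \<and> K = {u})" using Jset_singleton by auto
    then show ?thesis
      unfolding ent_mat_cmp[OF ABC uv] if_not_P[OF False] ent_pi_mor[OF AC uv] by (rule if_not_P)
  qed
qed (simp only: not_False_eq_True mat_cmp_out pi_mor_out)

lemma pi_mor_idm:
  assumes A: "A \<in> Ob"
  shows "fmor (pi_functor n Q) A A 0 (idm (cat Q {}) A) = idm (Glue n Q) (objs A, pi_twist n Q A)"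
proof (rule mat_eqI)
  fix u v K assume uv: "u < n" "v < n"
  have "F A A {} {u} 0 (idm (cat Q {}) A) = unit A {u}"
    using F_unit[OF A, of "{}" "{u}"] uv by (simp add: unit_def V_empty A)
  moreover have "ent (idm (Glue n Q) (objs A, pi_twist n Q A)) u v K =
      (if u = v \<and> K = {u} then unit A {u} else 0)"
    using uv by (auto simp: ent_def Glue_def tw_def Gac_def objs_simps ul_less ul_inject unit_def)
  ultimately show "ent (fmor (pi_functor n Q) A A 0 (idm (cat Q {}) A)) u v K =
      ent (idm (Glue n Q) (objs A, pi_twist n Q A)) u v K"
    by (auto simp: ent_pi_mor A uv)
qed (auto simp: pi_mor_out Glue_def tw_def objs_simps)

lemma dg_functor_pi: "dg_functor s (glue_scale s) (cat Q {}) (Glue n Q) (pi_functor n Q)"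
  unfolding dg_functor_def pi_obj
proof (intro conjI ballI allI)
  fix A B p f assume AB: "A \<in> Ob" "B \<in> Ob"
  show "linear_on s (glue_scale s) (gr (Hom (cat Q {}) A B) p) (fmor (pi_functor n Q) A B p)"
    using pi_mor_linear[OF AB] by (simp add: H_empty AB)
  assume f: "f \<in> gr (Hom (cat Q {}) A B) p"
  show "fmor (pi_functor n Q) A B p f \<in> gr (Hom_pi A B) p"
    using pi_mor_in[OF AB] f by (simp add: H_empty AB gr_Hom_pi)
  show "fmor (pi_functor n Q) A B (p + 1) (dif (Hom (cat Q {}) A B) p f) =
      dif (Hom_pi A B) p (fmor (pi_functor n Q) A B p f)"
    using mapping_cone.chain_map[OF pi_cone[OF AB], of f p] f by (simp add: H_empty AB)
next
  fix A B C p q g f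
  assume "A \<in> Ob" "B \<in> Ob" "C \<in> Ob" "g \<in> gr (Hom (cat Q {}) B C) p" "f \<in> gr (Hom (cat Q {}) A B) q"
  then show "fmor (pi_functor n Q) A C (p + q) (cmp (cat Q {}) A B C p q g f) =
      cmp (Glue n Q) (objs A, pi_twist n Q A) (objs B, pi_twist n Q B) (objs C, pi_twist n Q C) p q
        (fmor (pi_functor n Q) B C p g) (fmor (pi_functor n Q) A B q f)"
    using pi_mor_cmp[of A B C g p f q] by (simp add: H_empty vcmp_def V_empty Glue_def tw_def)
qed (auto intro: pi_obj_in pi_mor_idm)

text \<open>With \<open>dg_functor_pi\<close> at hand only the quasi-isomorphism clause remains, and
  the cone criterion settles it separately for each pair of objects.\<close>

theorem acyclic_iff_quasi_fully_faithful_pi: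
  "acyclic_hypercube n Q \<longleftrightarrow>
    quasi_fully_faithful s (glue_scale s) (cat Q {}) (Glue n Q) (pi_functor n Q)"
proof -
  have "acyclic_hypercube n Q \<longleftrightarrow>
      (\<forall>A\<in>Ob. \<forall>B\<in>Ob. acyclic_cplx (totalisation n (H A B) (\<alpha> A B)))"
    by (simp add: acyclic_hypercube_def H_def[abs_def] \<alpha>_def[abs_def] F_def V_def)
  also have "\<dots> \<longleftrightarrow> (\<forall>A\<in>Ob. \<forall>B\<in>Ob. quasi_iso (Hom (cat Q {}) A B) (Hom_pi A B) (fmor (pi_functor n Q) A B))"
    using mapping_cone.acyclic_iff_quasi_iso[OF pi_cone] by (simp add: H_empty)
  finally show ?thesis
    by (simp add: quasi_fully_faithful_def dg_functor_pi pi_obj)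
qed

end

theorem proposition5p13:
  fixes s :: "'k::field_char_0 \<Rightarrow> 'm::ab_group_add \<Rightarrow> 'm"
    and n :: nat
    and Q :: "('o, 'm) hypercube"
  assumes "n \<ge> 1"
    and "dg_hypercube s n Q"
  shows "acyclic_hypercube n Q \<longleftrightarrow>
    quasi_fully_faithful s (glue_scale s) (cat Q {}) (Glue n Q) (pi_functor n Q)"
  using dg_hypercube.acyclic_iff_quasi_fully_faithful_pi[OF assms(2)] .

end
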